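(* Let $N\ge m\ge 0$ and let $\Lambda=(\pmb a;\lambda)$ be an $m$-partition. The principal specialization $u_\emptyset\bigl(f(x_1,\dots,x_N)\bigr):=f(1,t,\dots,t^{N-1})$ of the $m$-symmetric Macdonald polynomial in $N$ variables is $$ u_\emptyset(P_\Lambda(x;q,t))=t^{n(\Lambda)-{\rm coInv}(\pmb a)}\,\frac{[N-m]_t!}{[N]_t!}\prod_{s\in\Lambda^\circ}\frac{1-q^{a'(s)}t^{N-\ell'(s)}}{1-q^{a(s)}t^{\ell(s)+1}} $$ where $\Lambda^\circ$ is the set of cells (including the circles) in the diagram of $\Lambda$, and where the co-arm and co-leg are $a'(s)=j-1$ and $\ell'(s)=i-1$ for the cell $s=(i,j)$ in row $i$ and column $j$.
   Context: $m$-partitions and diagrams. An $m$-partition is a pair $\Lambda=(\pmb a;\lambda)$ with $\pmb a=(a_1,\dots,a_m)\in\mathbb Z_{\ge0}^m$ and $\lambda$ a partition. Its diagram is the Young diagram (English notation) of the partition $\pmb a\cup\lambda$ obtained by sorting all the parts of $\pmb a$ and $\lambda$, with an $i$-circle (a circle filled with $i$) added immediately to the right of a row of length $a_i$ (possibly $0$) for each $i=1,\dots,m$; among rows of equal length the rows with circles lie above those without, and their circles increase from top to bottom. $\Lambda^{(m)}$ is the partition $(a_1+1,\dots,a_m+1)\cup\lambda$ (all circles turned into squares), $n(\nu)=\sum_i(i-1)\nu_i$ for a partition $\nu$, and $n(\Lambda):=n(\Lambda^{(m)})$. ${\rm coInv}(\pmb a)=\#\{1\le i<j\le m\mid a_i\ge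 a_j\}$. $[k]_p!=\prod_{j=1}^k\frac{1-p^j}{1-p}$. Arms and legs. For a square $s$ of the diagram, $a(s)$ is the number of squares strictly to the right of $s$ in its row, plus one if the row ends with a circle. $\ell(s)$ is the number of squares strictly below $s$ in its column, plus, if the row of $s$ ends with a circle, the number of circles at the bottom of the column of $s$ (i.e. lying in that column, below $s$) with filling smaller than that of the circle ending the row of $s$ (if the row of $s$ has no circle, circles do not contribute to $\ell(s)$). When $s$ is the position of a circle, $a(s)=\ell(s)=0$. Non-symmetric Macdonald polynomials. In $N$ variables let $K_{i,j}$ exchange $x_i$ and $x_j$, let $\tau_i$ replace $x_i$ by $qx_i$, and put $T_i=t+\frac{tx_i-x_{i+1}}{x_i-x_{i+1}}(K_{i,i+1}-1)$ for $1\le i\le N-1$, $\omega=K_{N-1,N}\cdots K_{1,2}\tau_1$, $Y_i=t^{-N+i}T_i\cdots T_{N-1}\,\omega\,T_1^{-1}\cdots T_{i-1}^{-1}$. For $\eta\in\mathbb Z_{\ge0}^N$, $E_\eta(x;q,t)$ is the unique polynomial over $\mathbb Q(q,t)$ of the form $x^\eta+\sum_{\nu\prec\eta}b_{\eta\nu}(q,t)x^\nu$ with $Y_iE_\eta=q^{\eta_i}t^{1-r_\eta(i)}E_\eta$ for $i=1,\dots,N$, where $r_\eta(i)=\#\{j:\eta_j>\eta_i\}+\#\{j\le i:\eta_j=\eta_i\}$. Here $\nu\prec\eta$ iff $\nu^+<\eta^+$ in dominance order, or $\nu^+=\eta^+$ and $w_\eta<w_\nu$ in Bruhat order, where $\eta^+$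 is the decreasing rearrangement of $\eta$ and $w_\eta$ is the minimal length permutation with $\eta=w_\eta\eta^+$. $m$-symmetric Macdonald polynomials. For $N\ge m+\ell(\lambda)$ let $\eta_{\Lambda,N}=(a_1,\dots,a_m,\lambda_{N-m},\dots,\lambda_1)$ (with $\lambda_i=0$ for $i>\ell(\lambda)$) and $$P_\Lambda(x_1,\dots,x_N;q,t)=\frac1{u_{\Lambda,N}(t)}\sum_{\sigma}T_\sigma E_{\eta_{\Lambda,N}}(x_1,\dots,x_N;q,t),$$ the sum being over permutations $\sigma$ of $\{m+1,\dots,N\}$, $T_\sigma=T_{i_1}\cdots T_{i_r}$ for a reduced decomposition $\sigma=s_{i_1}\cdots s_{i_r}$, and $u_{\Lambda,N}(t)=\bigl(\prod_{i\ge0}[n_\lambda(i)]_{t^{-1}}!\bigr)t^{(N-m)(N-m-1)/2}$ with $n_\lambda(i)$ the number of entries of $(\lambda_1,\dots,\lambda_{N-m})$ equal to $i$. For $m\le N<m+\ell(\lambda)$ put $P_\Lambda(x_1,\dots,x_N;q,t)=0$. *)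

theory Defs
  imports
    "HOL-Library.Poly_Mapping"
    "HOL-Computational_Algebra.Polynomial"
    "HOL-Computational_Algebra.Fraction_Field"
    "HOL-Combinatorics.Permutations"
begin

section \<open>Coefficients and polynomials\<close>

text \<open>The field of rational functions in \<open>q\<close> and \<open>t\<close> over the rationals: \<open>q\<close> is the inner and
  \<open>t\<close> the outer polynomial variable.\<close>

type_synonym qt = "rat poly poly fract"

definition qq :: qt where "qq = Fract [:[:0, 1:]:] 1"

definition tt :: qt where "tt = Fract [:0, 1:] 1"

text \<open>Polynomials in \<open>x\<^sub>1, x\<^sub>2, \<dots>\<close>; a monomial is given by its finitely supported exponent vector.
  All indices of variables, of entries of compositions, of rows and of columns start at 1.
  A composition in \<open>\<int>\<^sub>\<ge>\<^sub>0\<^sup>N\<close> is an exponent vector with support in \<open>{1..N}\<close>.\<close>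

type_synonym expo = "nat \<Rightarrow>\<^sub>0 nat"

type_synonym mpol = "expo \<Rightarrow>\<^sub>0 qt"

definition const :: "qt \<Rightarrow> mpol" where "const c = Poly_Mapping.single 0 c"

definition X :: "nat \<Rightarrow> mpol" where "X i = Poly_Mapping.single (Poly_Mapping.single i 1) 1"

text \<open>Substitution of \<open>g i\<close> for \<open>x\<^sub>i\<close>, where \<open>h\<close> embeds the coefficients into the target ring.\<close>

definition mpol_subst :: "(qt \<Rightarrow> 'b) \<Rightarrow> (nat \<Rightarrow> 'b) \<Rightarrow> mpol \<Rightarrow> 'b::comm_ring_1" where
  "mpol_subst h g f =
     (\<Sum>\<nu>\<in>Poly_Mapping.keys f. h (Poly_Mapping.lookup f \<nu>) *
        (\<Prod>i\<in>Poly_Mapping.keys \<nu>. g i ^ Poly_Mapping.lookup \<nu> i))"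

definition principal_spec :: "mpol \<Rightarrow> qt" where
  "principal_spec f = mpol_subst (\<lambda>c. c) (\<lambda>i. tt ^ (i - 1)) f"


section \<open>Hecke and Cherednik operators\<close>

definition exch :: "nat \<Rightarrow> nat \<Rightarrow> mpol \<Rightarrow> mpol" where
  "exch i j f = mpol_subst const (\<lambda>k. X (transpose i j k)) f"

definition qshift :: "nat \<Rightarrow> mpol \<Rightarrow> mpol" where
  "qshift i f = mpol_subst const (\<lambda>k. if k = i then const qq * X k else X k) f"

text \<open>The quotient \<open>f / g\<close> when \<open>g\<close> is nonzero and divides \<open>f\<close>; it is unique because
  polynomials form an integral domain. It is only applied to \<open>f = exch i (i + 1) p - p\<close> and
  \<open>g = x\<^sub>i - x\<^sub>i\<^sub>+\<^sub>1\<close>.\<close>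

definition exact_quot :: "mpol \<Rightarrow> mpol \<Rightarrow> mpol" where
  "exact_quot f g = (THE h. h * g = f)"

definition hecke :: "nat \<Rightarrow> mpol \<Rightarrow> mpol" where
  "hecke i f = const tt * f
     + (const tt * X i - X (i + 1)) * exact_quot (exch i (i + 1) f - f) (X i - X (i + 1))"

text \<open>The composition \<open>f\<^sub>1 \<circ> \<dots> \<circ> f\<^sub>r\<close> of a list of operators; the last one is applied first.\<close>

definition compose :: "('a \<Rightarrow> 'a) list \<Rightarrow> 'a \<Rightarrow> 'a" where
  "compose fs = foldr (\<circ>) fs id"

definition omega :: "nat \<Rightarrow> mpol \<Rightarrow> mpol" where
  "omega N = compose (map (\<lambda>k. exch k (k + 1)) (rev [1..<N])) \<circ> qshift 1"

definition cherednik :: "nat \<Rightarrow> nat \<Rightarrow> mpol \<Rightarrow> mpol" where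
  "cherednik N i f = const (tt powi (int i - int N)) *
     (compose (map hecke [i..<N]) \<circ> omega N \<circ> compose (map (\<lambda>k. inv (hecke k)) [1..<i])) f"


section \<open>Permutations and Bruhat order\<close>

definition word_perm :: "nat list \<Rightarrow> nat \<Rightarrow> nat" where
  "word_perm is = compose (map (\<lambda>i. transpose i (i + 1)) is)"

definition perm_length :: "nat \<Rightarrow> (nat \<Rightarrow> nat) \<Rightarrow> nat" where
  "perm_length N w =
     (LEAST r. \<exists>is. set is \<subseteq> {1..<N} \<and> word_perm is = w \<and> length is = r)"

definition reduced_word :: "nat \<Rightarrow> (nat \<Rightarrow> nat) \<Rightarrow> nat list \<Rightarrow> bool" where
  "reduced_word N w is \<longleftrightarrow>
     set is \<subseteq> {1..<N} \<and> word_perm is = w \<and> length is = perm_length N w"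

text \<open>\<open>hecke_perm N \<sigma>\<close> is \<open>T\<^sub>\<sigma>\<close>; by the braid relations it does not depend on the reduced word.\<close>

definition hecke_perm :: "nat \<Rightarrow> (nat \<Rightarrow> nat) \<Rightarrow> mpol \<Rightarrow> mpol" where
  "hecke_perm N w = compose (map hecke (SOME is. reduced_word N w is))"

definition bruhat_step :: "nat \<Rightarrow> (nat \<Rightarrow> nat) \<Rightarrow> (nat \<Rightarrow> nat) \<Rightarrow> bool" where
  "bruhat_step N u v \<longleftrightarrow>
     (\<exists>a\<in>{1..N}. \<exists>b\<in>{1..N}. a \<noteq> b \<and> v = u \<circ> transpose a b)
     \<and> perm_length N u < perm_length N v"

definition bruhat_less :: "nat \<Rightarrow> (nat \<Rightarrow> nat) \<Rightarrow> (nat \<Rightarrow> nat) \<Rightarrow> bool" where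
  "bruhat_less N = (bruhat_step N)\<^sup>+\<^sup>+"


section \<open>Non-symmetric Macdonald polynomials\<close>

definition decr_rearr :: "nat \<Rightarrow> expo \<Rightarrow> nat list" where
  "decr_rearr N \<eta> = rev (sort (map (Poly_Mapping.lookup \<eta>) [1..<N + 1]))"

definition dominance_less :: "nat list \<Rightarrow> nat list \<Rightarrow> bool" where
  "dominance_less \<mu> \<nu> \<longleftrightarrow> \<mu> \<noteq> \<nu> \<and> sum_list \<mu> = sum_list \<nu> \<and>
     (\<forall>k. sum_list (take k \<mu>) \<le> sum_list (take k \<nu>))"

text \<open>The shortest permutation \<open>w\<close> with \<open>\<eta> = w \<eta>\<^sup>+\<close>, where \<open>w\<close> moves the entry at position \<open>i\<close>
  to position \<open>w i\<close>. (The opposite convention replaces \<open>w\<close> by its inverse, which affects neither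
  lengths nor the Bruhat order.)\<close>

definition min_perm :: "nat \<Rightarrow> expo \<Rightarrow> nat \<Rightarrow> nat" where
  "min_perm N \<eta> = (THE w. is_arg_min (perm_length N)
     (\<lambda>w. w permutes {1..N} \<and>
        (\<forall>i\<in>{1..N}. Poly_Mapping.lookup \<eta> (w i) = decr_rearr N \<eta> ! (i - 1))) w)"

definition expo_prec :: "nat \<Rightarrow> expo \<Rightarrow> expo \<Rightarrow> bool" where
  "expo_prec N \<nu> \<eta> \<longleftrightarrow>
     dominance_less (decr_rearr N \<nu>) (decr_rearr N \<eta>) \<or>
     decr_rearr N \<nu> = decr_rearr N \<eta> \<and> bruhat_less N (min_perm N \<eta>) (min_perm N \<nu>)"

definition rank :: "nat \<Rightarrow> expo \<Rightarrow> nat \<Rightarrow> nat" where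
  "rank N \<eta> i =
     card {j \<in> {1..N}. Poly_Mapping.lookup \<eta> j > Poly_Mapping.lookup \<eta> i} +
     card {j \<in> {1..i}. Poly_Mapping.lookup \<eta> j = Poly_Mapping.lookup \<eta> i}"

definition is_nonsym_macdonald :: "nat \<Rightarrow> expo \<Rightarrow> mpol \<Rightarrow> bool" where
  "is_nonsym_macdonald N \<eta> E \<longleftrightarrow>
     Poly_Mapping.lookup E \<eta> = 1 \<and>
     (\<forall>\<nu>\<in>Poly_Mapping.keys E. \<nu> = \<eta> \<or> Poly_Mapping.keys \<nu> \<subseteq> {1..N} \<and> expo_prec N \<nu> \<eta>) \<and>
     (\<forall>i\<in>{1..N}. cherednik N i E =
        const (qq ^ Poly_Mapping.lookup \<eta> i * tt powi (1 - int (rank N \<eta> i))) * E)"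

definition nonsym_macdonald :: "nat \<Rightarrow> expo \<Rightarrow> mpol" where
  "nonsym_macdonald N \<eta> = (THE E. is_nonsym_macdonald N \<eta> E)"


section \<open>\<open>m\<close>-partitions and their diagrams\<close>

text \<open>A partition is the weakly decreasing list of its (positive) parts.\<close>

definition is_partition :: "nat list \<Rightarrow> bool" where
  "is_partition lam \<longleftrightarrow> sorted_wrt (\<ge>) lam \<and> 0 \<notin> set lam"

definition m_partition :: "nat \<Rightarrow> nat list \<times> nat list \<Rightarrow> bool" where
  "m_partition m \<Lambda> \<longleftrightarrow> length (fst \<Lambda>) = m \<and> is_partition (snd \<Lambda>)"

definition coInv :: "nat list \<Rightarrow> nat" where
  "coInv a = card {(i, j). 1 \<le> i \<and> i < j \<and> j \<le> length a \<and> a ! (i - 1) \<ge> a ! (j - 1)}"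

definition partition_n :: "nat list \<Rightarrow> nat" where
  "partition_n \<nu> = (\<Sum>i = 1..length \<nu>. (i - 1) * \<nu> ! (i - 1))"

definition squared_partition :: "nat list \<times> nat list \<Rightarrow> nat list" where
  "squared_partition \<Lambda> = rev (sort (map (\<lambda>k. k + 1) (fst \<Lambda>) @ snd \<Lambda>))"

definition mpart_n :: "nat list \<times> nat list \<Rightarrow> nat" where
  "mpart_n \<Lambda> = partition_n (squared_partition \<Lambda>)"

text \<open>The rows of the diagram from top to bottom, each given by its number of squares and the
  filling of the circle at its end, if any. Since \<open>sort_key\<close> is stable, rows of
  equal length stay in the order of the list being sorted: rows with circles by increasing filling,
  then rows without circle.\<close>

definition diagram_rows :: "nat list \<times> nat list \<Rightarrow> (nat \<times> nat option) list" where
  "diagram_rows \<Lambda> = sort_key (\<lambda>r. - int (fst r))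
     (map (\<lambda>i. (fst \<Lambda> ! (i - 1), Some i)) [1..<length (fst \<Lambda>) + 1]
      @ map (\<lambda>k. (k, None)) (snd \<Lambda>))"

definition row_len :: "nat list \<times> nat list \<Rightarrow> nat \<Rightarrow> nat" where
  "row_len \<Lambda> i = fst (diagram_rows \<Lambda> ! (i - 1))"

definition row_circle :: "nat list \<times> nat list \<Rightarrow> nat \<Rightarrow> nat option" where
  "row_circle \<Lambda> i = snd (diagram_rows \<Lambda> ! (i - 1))"

definition squares :: "nat list \<times> nat list \<Rightarrow> (nat \<times> nat) set" where
  "squares \<Lambda> = {(i, j). 1 \<le> i \<and> i \<le> length (diagram_rows \<Lambda>) \<and> 1 \<le> j \<and> j \<le> row_len \<Lambda> i}"

definition circles :: "nat list \<times> nat list \<Rightarrow> (nat \<times> nat) set" where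
  "circles \<Lambda> = {(i, j). 1 \<le> i \<and> i \<le> length (diagram_rows \<Lambda>) \<and>
     row_circle \<Lambda> i \<noteq> None \<and> j = row_len \<Lambda> i + 1}"

definition cells :: "nat list \<times> nat list \<Rightarrow> (nat \<times> nat) set" where
  "cells \<Lambda> = squares \<Lambda> \<union> circles \<Lambda>"

definition arm :: "nat list \<times> nat list \<Rightarrow> nat \<times> nat \<Rightarrow> nat" where
  "arm \<Lambda> s = (case s of (i, j) \<Rightarrow>
     if s \<in> circles \<Lambda> then 0
     else card {j'. j < j' \<and> (i, j') \<in> squares \<Lambda>}
       + (if row_circle \<Lambda> i \<noteq> None then 1 else 0))"

definition leg :: "nat list \<times> nat list \<Rightarrow> nat \<times> nat \<Rightarrow> nat" where
  "leg \<Lambda> s = (case s of (i, j) \<Rightarrow>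
     if s \<in> circles \<Lambda> then 0
     else card {i'. i < i' \<and> (i', j) \<in> squares \<Lambda>}
       + (case row_circle \<Lambda> i of
            None \<Rightarrow> 0
          | Some c \<Rightarrow> card {i'. i < i' \<and> (i', j) \<in> circles \<Lambda> \<and> the (row_circle \<Lambda> i') < c}))"

definition coarm :: "nat \<times> nat \<Rightarrow> nat" where "coarm s = snd s - 1"

definition coleg :: "nat \<times> nat \<Rightarrow> nat" where "coleg s = fst s - 1"


section \<open>\<open>m\<close>-symmetric Macdonald polynomials\<close>

definition qfact :: "qt \<Rightarrow> nat \<Rightarrow> qt" where
  "qfact p k = (\<Prod>j = 1..k. (1 - p ^ j) / (1 - p))"

text \<open>The entries \<open>\<lambda>\<^sub>1, \<dots>, \<lambda>\<^sub>N\<^sub>-\<^sub>m\<close> for \<open>N \<ge> m + \<ell>(\<lambda>)\<close>.\<close>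

definition padded :: "nat list \<times> nat list \<Rightarrow> nat \<Rightarrow> nat list" where
  "padded \<Lambda> N = snd \<Lambda> @ replicate (N - length (fst \<Lambda>) - length (snd \<Lambda>)) 0"

definition eta :: "nat list \<times> nat list \<Rightarrow> nat \<Rightarrow> expo" where
  "eta \<Lambda> N = (let xs = fst \<Lambda> @ rev (padded \<Lambda> N) in
     \<Sum>i = 1..N. Poly_Mapping.single i (xs ! (i - 1)))"

text \<open>Values \<open>i\<close> that are not entries of the padded \<open>\<lambda>\<close> contribute the factor \<open>[0]! = 1\<close> to the
  product over all \<open>i \<ge> 0\<close>.\<close>

definition u_norm :: "nat list \<times> nat list \<Rightarrow> nat \<Rightarrow> qt" where
  "u_norm \<Lambda> N = (let m = length (fst \<Lambda>) in
     (\<Prod>i\<in>set (padded \<Lambda> N). qfact (inverse tt) (count_list (padded \<Lambda> N) i))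
       * tt ^ ((N - m) * (N - m - 1) div 2))"

definition msym_macdonald :: "nat list \<times> nat list \<Rightarrow> nat \<Rightarrow> mpol" where
  "msym_macdonald \<Lambda> N = (let m = length (fst \<Lambda>) in
     if m + length (snd \<Lambda>) \<le> N then
       const (1 / u_norm \<Lambda> N) *
         (\<Sum>\<sigma> | \<sigma> permutes {m + 1..N}. hecke_perm N \<sigma> (nonsym_macdonald N (eta \<Lambda> N)))
     else 0)"

end

theory Submission
  imports Defs
begin

text \<open>
  At the point \<open>(1, t, \<dots>, t\<^sup>N\<^sup>-\<^sup>1)\<close> one has \<open>u(T\<^sub>i f) = t u(f)\<close>, because \<open>t x\<^sub>i - x\<^sub>i\<^sub>+\<^sub>1\<close> vanishes there.
  Hence symmetrizing only multiplies \<open>u(E\<^sub>\<eta>)\<close> by the length generating function \<open>[N - m]\<^sub>t!\<close>, without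
  any use of the independence of \<open>T\<^sub>\<sigma>\<close> of the reduced word, and everything reduces to \<open>u(E\<^sub>\<eta>)\<close>.

  The polynomials \<open>E\<^sub>\<eta>\<close> are built from \<open>E\<^sub>0 = 1\<close> by the raising operator \<open>x\<^sub>N \<omega>\<close>, which sends \<open>\<eta>\<close> to
  \<open>(\<eta>\<^sub>2, \<dots>, \<eta>\<^sub>N, \<eta>\<^sub>1 + 1)\<close>, and by the intertwiners \<open>T\<^sub>i + c\<close>, which exchange \<open>\<eta>\<^sub>i < \<eta>\<^sub>i\<^sub>+\<^sub>1\<close>. Both produce joint
  eigenvectors of the \<open>Y\<^sub>i\<close>, and both change \<open>u\<close> by an explicit factor; triangularity of the \<open>Y\<^sub>i\<close> and
  separation of their spectrum identify these eigenvectors with the \<open>E\<^sub>\<eta>\<close>. The resulting value of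
  \<open>u(E\<^sub>\<eta>)\<close> is a product over pairs of positions which is invariant under raising: with \<open>r\<close> the rank of a
  position, the pair \<open>(i, j)\<close> with \<open>r(i) < r(j)\<close> contributes \<open>(1 - q\<^sup>k t\<^sup>\<rho>\<^sup>+\<^sup>1) / (1 - q\<^sup>k t\<^sup>\<rho>)\<close>, where
  \<open>\<rho> = r(j) - r(i)\<close> and \<open>1 \<le> k \<le> \<eta>\<^sub>i - \<eta>\<^sub>j\<close>, with \<open>k = \<eta>\<^sub>i - \<eta>\<^sub>j\<close> left out if \<open>j < i\<close>. Row by row this product
  telescopes to the arms and legs of the diagram.
\<close>

text \<open>\<open>nonsym_macdonald\<close> is a definite description whose order mixes dominance
  and Bruhat order. The argument runs on the relation \<open>below\<close> instead: truncated sums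
  of entries stand for dominance, and chains of transpositions moving a larger entry right stand for
  Bruhat order. It suffices that \<open>below\<close> implies \<open>expo_prec\<close>, because
  uniqueness is forced by the spectrum: a nonzero joint eigenvector supported on compositions must
  contain the exponent named by its eigenvalues. The factors come from the constants of the
  intertwiners. With y = q^k t^\<rho> the ratio of the exchanged eigenvalues, the intertwiner is T_i
  + (1 - t) / (1 - y); as T_i specializes to t, it contributes (1 - t y) / (1 - y). This is the
  factor for the largest k, left out before the exchange and included after it. Raising contributes
  a power of q, removed by normalization, and a power of t. If N is smaller than m plus the number
  of parts of \<lambda>, the polynomial is 0 by definition, and the product vanishes through the
  cell (N + 1, 1), whose numerator is 1 - q^0 t^0.\<close>

abbreviation lookup :: "('a \<Rightarrow>\<^sub>0 'b::zero) \<Rightarrow> 'a \<Rightarrow> 'b" where "lookup \<equiv> Poly_Mapping.lookup"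

abbreviation keys :: "('a \<Rightarrow>\<^sub>0 'b::zero) \<Rightarrow> 'a set" where "keys \<equiv> Poly_Mapping.keys"

abbreviation single :: "'a \<Rightarrow> 'b \<Rightarrow> 'a \<Rightarrow>\<^sub>0 'b::zero" where "single \<equiv> Poly_Mapping.single"

abbreviation xmon :: "expo \<Rightarrow> mpol" where "xmon \<nu> \<equiv> single \<nu> 1"

section \<open>Finitely supported functions as sums of single terms\<close>

lemma poly_mapping_sum_single:
  fixes f :: "'a \<Rightarrow>\<^sub>0 'b::comm_monoid_add"
  shows "f = (\<Sum>k\<in>keys f. single k (lookup f k))"
  by (rule poly_mapping_eqI)
    (auto simp: lookup_sum lookup_single when_def sum.delta in_keys_iff)

lemma poly_mapping_single_add_induct [case_names single add]:
  fixes f :: "'a \<Rightarrow>\<^sub>0 'b::comm_monoid_add"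
  assumes single: "\<And>k c. P (single k c)"
    and add: "\<And>f g. P f \<Longrightarrow> P g \<Longrightarrow> P (f + g)"
  shows "P f"
proof -
  have "P (\<Sum>k\<in>A. single k (lookup f k))" if "finite A" for A
    using that
  proof (induction A)
    case empty
    \<comment> \<open>The zero function is a single term with coefficient 0; its place is
      arbitrary.\<close>
    show ?case using single[of undefined 0] by simp
  qed (auto intro: single add)
  from this[OF finite_keys[of f]] show ?thesis
    using poly_mapping_sum_single[of f] by simp
qed

subsection \<open>Substitution homomorphisms\<close>

definition ring_map :: "('a::comm_ring_1 \<Rightarrow> 'b::comm_ring_1) \<Rightarrow> bool" where
  "ring_map \<phi> \<longleftrightarrow> \<phi> 1 = 1 \<and> (\<forall>f g. \<phi> (f + g) = \<phi> f + \<phi> g) \<and> (\<forall>f g. \<phi> (f * g) = \<phi> f * \<phi> g)"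

lemma ring_mapI:
  assumes "\<phi> 1 = 1" "\<And>f g. \<phi> (f + g) = \<phi> f + \<phi> g" "\<And>f g. \<phi> (f * g) = \<phi> f * \<phi> g"
  shows "ring_map \<phi>"
  using assms by (simp add: ring_map_def)

lemma
  assumes "ring_map \<phi>"
  shows ring_map_one: "\<phi> 1 = 1"
    and ring_map_add: "\<phi> (f + g) = \<phi> f + \<phi> g"
    and ring_map_mult: "\<phi> (f * g) = \<phi> f * \<phi> g"
    and ring_map_zero: "\<phi> 0 = 0"
    and ring_map_diff: "\<phi> (f - g) = \<phi> f - \<phi> g"
proof -
  show *: "\<phi> 1 = 1" "\<phi> (f * g) = \<phi> f * \<phi> g" "\<phi> (f + g) = \<phi> f + \<phi> g" for f g
    using assms by (auto simp: ring_map_def)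
  have "\<phi> 0 + \<phi> 0 = \<phi> 0" using *(3)[of 0 0] by simp
  then show "\<phi> 0 = 0" by (metis add_cancel_right_left)
  show "\<phi> (f - g) = \<phi> f - \<phi> g" for f g using *(3)[of "f - g" g] by (simp add: algebra_simps)
qed

lemma ring_map_power: "ring_map \<phi> \<Longrightarrow> \<phi> (f ^ n) = \<phi> f ^ n"
  by (induction n) (simp_all add: ring_map_one ring_map_mult)

lemma ring_map_comp: "ring_map \<phi> \<Longrightarrow> ring_map \<psi> \<Longrightarrow> ring_map (\<phi> \<circ> \<psi>)"
  by (auto simp: ring_map_def)

lemma ring_map_id: "ring_map (\<lambda>x. x)"
  by (simp add: ring_map_def)

section \<open>Constants and monomials\<close>

lemma const_simps [simp]:
  "const 0 = 0" "const 1 = 1"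
  by (simp_all add: const_def)

lemma const_add: "const (a + b) = const a + const b"
  and const_mult: "const (a * b) = const a * const b"
  and const_diff: "const (a - b) = const a - const b"
  by (simp_all add: const_def single_add mult_single single_diff)

lemma const_power: "const (a ^ n) = const a ^ n"
  by (induction n) (simp_all add: const_mult)

lemma ring_map_const: "ring_map const"
  by (simp add: ring_map_def const_add const_mult)

lemma const_eq_iff [simp]: "const a = const b \<longleftrightarrow> a = b"
  by (metis const_def lookup_single_eq)

lemma const_eq_0_iff [simp]: "const a = 0 \<longleftrightarrow> a = 0"
  using const_eq_iff[of a 0] by simp

lemma lookup_const_mult: "lookup (const c * f) \<nu> = c * lookup f \<nu>"
proof -
  have "lookup (single 0 c * f) \<nu> = c * lookup f \<nu>"
  proof (induction f rule: poly_mapping_single_add_induct)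
    case (single k d)
    then show ?case by (simp add: mult_single lookup_single when_def)
  next
    case (add f g)
    then show ?case by (simp add: distrib_left lookup_add)
  qed
  then show ?thesis by (simp add: const_def)
qed

lemma single_eq_const_mult: "single \<nu> c = const c * xmon \<nu>"
  by (simp add: const_def mult_single)

lemma xmon_add: "xmon (\<mu> + \<nu>) = xmon \<mu> * xmon \<nu>"
  by (simp add: mult_single)

lemma X_power: "X i ^ n = xmon (single i n)"
  by (induction n) (simp_all add: X_def mult_single flip: single_add)

section \<open>Evaluation of monomials and polynomials\<close>

definition mon_eval :: "(nat \<Rightarrow> 'b) \<Rightarrow> expo \<Rightarrow> 'b::comm_ring_1" where
  "mon_eval g \<nu> = (\<Prod>i\<in>keys \<nu>. g i ^ lookup \<nu> i)"

lemma mon_eval_superset: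
  assumes "finite A" "keys \<nu> \<subseteq> A"
  shows "mon_eval g \<nu> = (\<Prod>i\<in>A. g i ^ lookup \<nu> i)"
  unfolding mon_eval_def by (rule prod.mono_neutral_left) (use assms in \<open>auto simp: in_keys_iff\<close>)

lemma mon_eval_zero [simp]: "mon_eval g 0 = 1"
  by (simp add: mon_eval_def)

lemma mon_eval_single [simp]: "mon_eval g (single i n) = g i ^ n"
  by (subst mon_eval_superset[where A = "{i}"]) auto

lemma mon_eval_add: "mon_eval g (\<mu> + \<nu>) = mon_eval g \<mu> * mon_eval g \<nu>"
proof -
  let ?A = "keys \<mu> \<union> keys \<nu>"
  have "keys (\<mu> + \<nu>) \<subseteq> ?A" by (rule keys_add)
  then show ?thesis
    by (simp add: mon_eval_superset[where A = ?A] lookup_add power_add prod.distrib)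
qed

lemma mpol_subst_superset:
  assumes "finite A" "keys f \<subseteq> A" "h 0 = 0"
  shows "mpol_subst h g f = (\<Sum>\<nu>\<in>A. h (lookup f \<nu>) * mon_eval g \<nu>)"
  unfolding mpol_subst_def mon_eval_def[symmetric]
  by (rule sum.mono_neutral_left) (use assms in \<open>auto simp: in_keys_iff\<close>)

lemma mpol_subst_single:
  assumes "h 0 = 0"
  shows "mpol_subst h g (single \<nu> c) = h c * mon_eval g \<nu>"
  by (subst mpol_subst_superset[where A = "{\<nu>}"]) (use assms in auto)

lemma mpol_subst_add:
  assumes "ring_map h"
  shows "mpol_subst h g (f1 + f2) = mpol_subst h g f1 + mpol_subst h g f2"
proof -
  let ?A = "keys f1 \<union> keys f2"
  have "keys (f1 + f2) \<subseteq> ?A" by (rule keys_add)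
  then show ?thesis
    using ring_map_zero[OF assms]
    by (simp add: mpol_subst_superset[where A = ?A] lookup_add ring_map_add[OF assms]
        sum.distrib distrib_right)
qed

text \<open>Both sides of the product rule are biadditive, so two inductions over sums of single
  terms leave only a product of two monomials.\<close>

lemma ring_map_mpol_subst:
  assumes "ring_map h"
  shows "ring_map (mpol_subst h g)"
proof (rule ring_mapI)
  note z = ring_map_zero[OF assms] and o = ring_map_one[OF assms]
  show "mpol_subst h g 1 = 1"
    using mpol_subst_single[of h g 0 1] z o by simp
  show "mpol_subst h g (f1 + f2) = mpol_subst h g f1 + mpol_subst h g f2" for f1 f2
    by (rule mpol_subst_add[OF assms])
  show "mpol_subst h g (f1 * f2) = mpol_subst h g f1 * mpol_subst h g f2" for f1 f2
  proof (induction f1 rule: poly_mapping_single_add_induct)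
    case (single k c)
    show ?case
    proof (induction f2 rule: poly_mapping_single_add_induct)
      case (single k' c')
      then show ?case
        by (simp add: mult_single mpol_subst_single z ring_map_mult[OF assms] mon_eval_add
            algebra_simps)
    next
      case (add f g)
      then show ?case by (simp add: distrib_left mpol_subst_add[OF assms])
    qed
  next
    case (add f g)
    then show ?case by (simp add: distrib_right mpol_subst_add[OF assms])
  qed
qed

lemma mpol_subst_const:
  assumes "ring_map h"
  shows "mpol_subst h g (const c) = h c"
  using ring_map_zero[OF assms] by (simp add: const_def mpol_subst_single)

lemma mpol_subst_X:
  assumes "ring_map h"
  shows "mpol_subst h g (X i) = g i"
  using ring_map_zero[OF assms] ring_map_one[OF assms] by (simp add: X_def mpol_subst_single)

lemma mpol_induct [case_names const X add mult]:
  assumes const: "\<And>c. P (const c)" and X: "\<And>i. P (X i)"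
    and add: "\<And>f g. P f \<Longrightarrow> P g \<Longrightarrow> P (f + g)"
    and mult: "\<And>f g. P f \<Longrightarrow> P g \<Longrightarrow> P (f * g)"
  shows "P f"
proof (induction f rule: poly_mapping_single_add_induct)
  case (single k c)
  have pow: "P (X i ^ n)" for i n
    by (induction n) (use const[of 1] in \<open>auto intro: mult X\<close>)
  have "P (xmon k)"
  proof (induction k rule: poly_mapping_single_add_induct)
    case (single k c)
    then show ?case using pow by (simp add: X_power)
  next
    case (add f g)
    then show ?case by (simp add: xmon_add mult)
  qed
  then show ?case by (simp add: single_eq_const_mult[of k c] mult const)
qed (rule add)

text \<open>Exchanges, shifts and the specialization are all substitutions, so identities between
  them reduce to comparing indices of variables.\<close>

lemma ring_map_eqI:
  assumes "ring_map \<phi>" "ring_map \<psi>" "\<And>c. \<phi> (const c) = \<psi> (const c)" "\<And>i. \<phi> (X i) = \<psi> (X i)"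
  shows "\<phi> f = \<psi> f"
  by (induction f rule: mpol_induct)
    (use assms in \<open>auto simp: ring_map_add ring_map_mult\<close>)

subsection \<open>The permutation and shift operators\<close>

lemma ring_map_exch: "ring_map (exch i j)"
  and exch_const [simp]: "exch i j (const c) = const c"
  and exch_X [simp]: "exch i j (X k) = X (transpose i j k)"
  unfolding exch_def
  by (simp_all add: ring_map_const ring_map_mpol_subst mpol_subst_const mpol_subst_X)

lemmas exch_hom [simp] = ring_map_add[OF ring_map_exch] ring_map_mult[OF ring_map_exch]
  ring_map_diff[OF ring_map_exch] ring_map_zero[OF ring_map_exch] ring_map_one[OF ring_map_exch]

lemma exch_exch [simp]: "exch i j (exch i j f) = f"
  by (rule ring_map_eqI[of "\<lambda>f. exch i j (exch i j f)"])
    (auto simp: ring_map_def)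

lemma exch_conj: "exch i j (exch k l (exch i j f)) = exch (transpose i j k) (transpose i j l) f"
  by (rule ring_map_eqI[of "\<lambda>f. exch i j (exch k l (exch i j f))"])
    (auto simp: ring_map_def transpose_def)

lemma X_eq_iff [simp]: "X i = X j \<longleftrightarrow> i = j"
proof
  assume "X i = X j"
  then have "single i (1::nat) = single j 1"
    unfolding X_def by (metis lookup_single_eq lookup_single_not_eq zero_neq_one)
  then show "i = j" by (metis lookup_single_eq lookup_single_not_eq zero_neq_one)
qed simp

lemma ring_map_qshift: "ring_map (qshift i)"
  and qshift_const [simp]: "qshift i (const c) = const c"
  and qshift_X [simp]: "qshift i (X k) = (if k = i then const qq * X k else X k)"
  unfolding qshift_def
  by (simp_all add: ring_map_const ring_map_mpol_subst mpol_subst_const mpol_subst_X)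

lemma compose_Nil [simp]: "compose [] = id"
  and compose_Cons [simp]: "compose (f # fs) = f \<circ> compose fs"
  by (simp_all add: compose_def)

lemma compose_append: "compose (fs @ gs) = compose fs \<circ> compose gs"
  by (induction fs) (simp_all add: comp_assoc)

lemma exch_cycle:
  assumes "1 \<le> N"
  defines "\<theta> \<equiv> compose (map (\<lambda>k. exch k (k + 1)) (rev [1..<N]))"
  shows "ring_map \<theta> \<and> (\<forall>c. \<theta> (const c) = const c) \<and>
    (\<forall>k. \<theta> (X k) = X (if k = 1 then N else if 1 < k \<and> k \<le> N then k - 1 else k))"
  using assms(1) unfolding \<theta>_def
proof (induction N rule: dec_induct)
  case base
  then show ?case by (auto simp: ring_map_def)
next
  case (step n)
  have "rev [1..<Suc n] = n # rev [1..<n]" using step.hyps by simp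
  then show ?case using step
    by (auto simp: transpose_def simp del: upt_Suc
        intro: ring_map_comp[OF ring_map_exch, unfolded comp_def])
qed

lemma
  assumes "1 \<le> N"
  shows ring_map_omega: "ring_map (omega N)"
    and omega_const [simp]: "omega N (const c) = const c"
    and omega_X: "omega N (X k) = (if k = 1 then const qq * X N
       else if 1 < k \<and> k \<le> N then X (k - 1) else X k)"
  using exch_cycle[OF assms] unfolding omega_def
  by (auto intro: ring_map_comp ring_map_qshift simp: ring_map_mult)

lemma exch_omega:
  assumes "1 \<le> i" "i + 2 \<le> N"
  shows "omega N (exch (i + 1) (i + 2) f) = exch i (i + 1) (omega N f)"
proof -
  have N: "1 \<le> N" using assms by simp
  note rm = ring_map_omega[OF N]
  show ?thesis
  proof (rule ring_map_eqI[of "\<lambda>f. omega N (exch (i + 1) (i + 2) f)"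
        "\<lambda>f. exch i (i + 1) (omega N f)"])
    show "ring_map (\<lambda>f. omega N (exch (i + 1) (i + 2) f))"
      using ring_map_comp[OF rm ring_map_exch[of "i + 1" "i + 2"]] by (simp add: comp_def)
    show "ring_map (\<lambda>f. exch i (i + 1) (omega N f))"
      using ring_map_comp[OF ring_map_exch[of i "i + 1"] rm] by (simp add: comp_def)
    show "omega N (exch (i + 1) (i + 2) (const c)) = exch i (i + 1) (omega N (const c))" for c
      using N by simp
    fix k
    consider "k = 1" | "k = i + 1" | "k = i + 2" | "k \<noteq> 1" "k \<noteq> i + 1" "k \<noteq> i + 2" by blast
    then show "omega N (exch (i + 1) (i + 2) (X k)) = exch i (i + 1) (omega N (X k))"
    proof cases
      case 4
      then have "k - 1 \<noteq> i" "k - 1 \<noteq> i + 1" using assms by auto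
      then show ?thesis using 4 assms N by (simp add: omega_X transpose_def)
    qed (use assms N in \<open>simp_all add: omega_X transpose_def\<close>)
  qed
qed

text \<open>A single \<omega> sends the pair x_1, x_2 to q x_N, x_1, which is not an adjacent pair
  in this order. A second \<omega> gives q x_{N-1}, q x_N: adjacent again and with the same factor
  q, as \<open>hecke_intertwine\<close> asks for.\<close>

lemma exch_omega_omega:
  assumes "2 \<le> N"
  shows "omega N (omega N (exch 1 2 f)) = exch (N - 1) N (omega N (omega N f))"
proof -
  have N: "1 \<le> N" using assms by simp
  note rm = ring_map_omega[OF N]
  show ?thesis
  proof (rule ring_map_eqI[of "\<lambda>f. omega N (omega N (exch 1 2 f))"
        "\<lambda>f. exch (N - 1) N (omega N (omega N f))"])
    show "ring_map (\<lambda>f. omega N (omega N (exch 1 2 f)))"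
      using ring_map_comp[OF rm ring_map_comp[OF rm ring_map_exch[of 1 2]]] by (simp add: comp_def)
    show "ring_map (\<lambda>f. exch (N - 1) N (omega N (omega N f)))"
      using ring_map_comp[OF ring_map_exch[of "N - 1" N] ring_map_comp[OF rm rm]]
      by (simp add: comp_def)
    show "omega N (omega N (exch 1 2 (const c))) = exch (N - 1) N (omega N (omega N (const c)))" for c
      using N by simp
    fix k :: nat
    have X1: "omega N (X 1) = const qq * X N" and X2: "omega N (X 2) = X 1"
      and XN: "omega N (X N) = X (N - 1)"
      using assms by (simp_all add: omega_X)
    have e: "exch (N - 1) N (X N) = X (N - 1)" "exch (N - 1) N (X (N - 1)) = X N"
      "exch 1 2 (X 1) = X 2" "exch 1 2 (X 2) = X 1"
      by (simp_all add: transpose_def)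
    consider "k = 1" | "k = 2" | "k \<noteq> 1" "k \<noteq> 2" by blast
    then show "omega N (omega N (exch 1 2 (X k))) = exch (N - 1) N (omega N (omega N (X k)))"
    proof cases
      case 1
      show ?thesis
        unfolding 1 by (simp only: e X1 X2 XN ring_map_mult[OF rm] omega_const[OF N] exch_hom exch_const)
    next
      case 2
      show ?thesis
        unfolding 2 by (simp only: e X1 X2 XN ring_map_mult[OF rm] omega_const[OF N] exch_hom exch_const)
    next
      case 3
      \<comment> \<open>Two shifts lower every index from 3 to N by two, so the result stays clear
        of N - 1 and N; indices outside 1..N are fixed.\<close>
      define l where "l = (if k = 0 \<or> k > N then k else k - 2)"
      have "omega N (omega N (X k)) = X l"
        using 3 by (cases "k = 0 \<or> k > N") (auto simp: omega_X[OF N] l_def numeral_2_eq_2)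
      moreover have "transpose (N - 1) N l = l" "transpose 1 2 k = k"
        using 3 assms by (auto simp: transpose_def l_def)
      ultimately show ?thesis by (simp only: exch_X)
    qed
  qed
qed

subsection \<open>Hecke operators\<close>

text \<open>Twisted Leibniz rule: with K the exchange, the difference for f g is K f (K g - g) + (K
  f - f) g, so divisibility passes from constants and variables to all polynomials.\<close>

lemma exch_diff_dvd: "X i - X j dvd exch i j f - f"
proof (induction f rule: mpol_induct)
  case (const c)
  then show ?case by simp
next
  case (X k)
  have "X i - X j dvd X j - X i" by (metis dvd_refl dvd_minus_iff minus_diff_eq)
  then show ?case by (auto simp: transpose_def)
next
  case (add f g)
  have "exch i j (f + g) - (f + g) = (exch i j f - f) + (exch i j g - g)" by simp
  then show ?case using add by (metis dvd_add)
next
  case (mult f g)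
  have "exch i j (f * g) - f * g = exch i j f * (exch i j g - g) + (exch i j f - f) * g"
    by (simp add: algebra_simps)
  then show ?case using mult by (metis dvd_add dvd_mult dvd_mult2)
qed

lemma exact_quot_mult:
  assumes "g dvd f" "g \<noteq> 0"
  shows "exact_quot f g * g = f"
proof -
  obtain h where h: "f = g * h" using assms(1) by (elim dvdE)
  have "(THE h. h * g = f) = h"
    by (rule the_equality) (use h assms(2) in \<open>auto simp: mult.commute\<close>)
  then show ?thesis by (simp add: exact_quot_def h mult.commute)
qed

text \<open>With the denominator cleared the exact quotient disappears. Identities for
  \<open>hecke\<close> are checked in this form and then cancelled by
  \<open>hecke_eqI\<close>.\<close>

lemma hecke_eq:
  "(X i - X (i + 1)) * hecke i f
     = const (1 - tt) * X (i + 1) * f + (const tt * X i - X (i + 1)) * exch i (i + 1) f"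
proof -
  have "X i - X (i + 1) \<noteq> 0" by simp
  then obtain Q where Q: "Q = exact_quot (exch i (i + 1) f - f) (X i - X (i + 1))"
    "Q * (X i - X (i + 1)) = exch i (i + 1) f - f"
    using exact_quot_mult exch_diff_dvd by blast
  have "(X i - X (i + 1)) * hecke i f = const tt * (X i - X (i + 1)) * f
      + (const tt * X i - X (i + 1)) * (Q * (X i - X (i + 1)))"
    unfolding hecke_def Q(1)[symmetric] by (simp add: algebra_simps)
  also have "\<dots> = const (1 - tt) * X (i + 1) * f + (const tt * X i - X (i + 1)) * exch i (i + 1) f"
    unfolding Q(2) by (simp add: algebra_simps const_diff)
  finally show ?thesis .
qed

lemma hecke_eqI:
  assumes "(X i - X (i + 1)) * g
     = const (1 - tt) * X (i + 1) * f + (const tt * X i - X (i + 1)) * exch i (i + 1) f"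
  shows "hecke i f = g"
proof -
  have "X i - X (i + 1) \<noteq> 0" by simp
  then show ?thesis using assms hecke_eq[of i f] by (metis mult_left_cancel)
qed

lemma hecke_add: "hecke i (f + g) = hecke i f + hecke i g"
  by (rule hecke_eqI) (simp only: distrib_left hecke_eq exch_hom, simp add: algebra_simps)

lemma hecke_mult_symmetric:
  assumes "exch i (i + 1) p = p"
  shows "hecke i (p * f) = p * hecke i f"
proof (rule hecke_eqI)
  have "(X i - X (i + 1)) * (p * hecke i f) = p * ((X i - X (i + 1)) * hecke i f)"
    by (simp add: algebra_simps)
  also have "\<dots> = p * (const (1 - tt) * X (i + 1) * f + (const tt * X i - X (i + 1)) * exch i (i + 1) f)"
    by (simp only: hecke_eq)
  finally show "(X i - X (i + 1)) * (p * hecke i f) = const (1 - tt) * X (i + 1) * (p * f)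
      + (const tt * X i - X (i + 1)) * exch i (i + 1) (p * f)"
    by (simp only: assms exch_hom) (simp add: algebra_simps)
qed

lemma hecke_const_mult: "hecke i (const c * f) = const c * hecke i f"
  by (rule hecke_mult_symmetric) simp

lemma hecke_diff: "hecke i (f - g) = hecke i f - hecke i g"
  using hecke_add[of i "f - g" g] by (simp add: algebra_simps)

lemma hecke_exch:
  "(X i - X (i + 1)) * exch i (i + 1) (hecke i f)
     = (X i - const tt * X (i + 1)) * f - const (1 - tt) * X i * exch i (i + 1) f"
  using arg_cong[OF hecke_eq[of i f], of "exch i (i + 1)"]
  by (simp add: algebra_simps const_diff)

text \<open>T, s and S stand for T_i f, K f and K T_i f with K the exchange. \<open>one\<close> is a
  variable because \<open>const_diff\<close> produces \<open>const 1\<close> where the identity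
  needs 1.\<close>

lemma quadratic_relation_identity:
  fixes x y t f s T S one :: "'a::idom"
  assumes T: "(x - y) * T = (one - t) * y * f + (t * x - y) * s"
    and S: "(x - y) * S = (x - t * y) * f - (one - t) * x * s" and one: "one = 1"
  shows "(x - y) * ((x - y) * ((t - one) * T + t * f))
    = (x - y) * ((one - t) * y * T + (t * x - y) * S)"
proof -
  have "(x - y) * ((x - y) * ((t - one) * T + t * f))
      = (t - one) * (x - y) * ((x - y) * T) + (x - y) * (x - y) * t * f"
    by (simp add: algebra_simps)
  also have "\<dots> = (one - t) * y * ((x - y) * T) + (t * x - y) * ((x - y) * S)"
    unfolding T S one by (simp add: algebra_simps)
  also have "\<dots> = (x - y) * ((one - t) * y * T + (t * x - y) * S)"
    by (simp add: algebra_simps)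
  finally show ?thesis .
qed

lemma hecke_quadratic: "hecke i (hecke i f) = const (tt - 1) * hecke i f + const tt * f"
proof (rule hecke_eqI)
  let ?D = "X i - X (i + 1)"
  let ?T = "hecke i f" and ?K = "exch i (i + 1) f"
  have D: "?D \<noteq> 0" by simp
  note e = hecke_eq[of i f] and e' = hecke_exch[of i f]
  have "?D * (?D * (const (tt - 1) * ?T + const tt * f)) = ?D * (const (1 - tt) * X (i + 1) * ?T
      + (const tt * X i - X (i + 1)) * exch i (i + 1) ?T)"
    using quadratic_relation_identity[OF e[unfolded const_diff] e'[unfolded const_diff] const_simps(2)]
    by (simp only: const_diff const_simps)
  then show "?D * (const (tt - 1) * ?T + const tt * f) = const (1 - tt) * X (i + 1) * ?T
      + (const tt * X i - X (i + 1)) * exch i (i + 1) ?T"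
    using D by (metis mult_left_cancel)
qed

lemma tt_nonzero [simp]: "tt \<noteq> 0"
  by (simp add: tt_def Zero_fract_def eq_fract)

text \<open>Read off from T_i^2 = (t - 1) T_i + t.\<close>

definition hecke_inv :: "nat \<Rightarrow> mpol \<Rightarrow> mpol" where
  "hecke_inv i f = const (inverse tt) * (hecke i f - const (tt - 1) * f)"

lemma const_inverse_mult: "c \<noteq> 0 \<Longrightarrow> const (inverse c) * (const c * f) = f"
  by (simp add: mult.assoc[symmetric] const_mult[symmetric])

lemma hecke_inv_hecke [simp]: "hecke_inv i (hecke i f) = f"
  unfolding hecke_inv_def hecke_quadratic by (simp add: const_inverse_mult)

lemma hecke_hecke_inv [simp]: "hecke i (hecke_inv i f) = f"
proof -
  have "hecke i (hecke i f - const (tt - 1) * f) = const tt * f"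
    by (simp add: hecke_diff hecke_const_mult hecke_quadratic)
  then show ?thesis
    by (simp add: hecke_inv_def hecke_const_mult const_inverse_mult)
qed

lemma inv_hecke: "inv (hecke i) = hecke_inv i"
  by (rule inv_unique_comp) auto

text \<open>The Hecke operator is homogeneous of degree 0 in x_i and x_{i+1}, so a ring map may
  scale both variables by a common a. This a is q in \<open>omega_omega_hecke\<close> and 1
  elsewhere.\<close>

lemma hecke_intertwine:
  assumes "ring_map \<theta>" "\<And>c. \<theta> (const c) = const c" "a \<noteq> 0"
    and "\<theta> (X i) = const a * X j" "\<theta> (X (i + 1)) = const a * X (j + 1)"
    and "\<theta> (exch i (i + 1) f) = exch j (j + 1) (\<theta> f)"
  shows "\<theta> (hecke i f) = hecke j (\<theta> f)"
proof (rule hecke_eqI[symmetric])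
  have "const a * ((X j - X (j + 1)) * \<theta> (hecke i f)) = const a * (const (1 - tt) * X (j + 1) * \<theta> f
     + (const tt * X j - X (j + 1)) * exch j (j + 1) (\<theta> f))"
    using arg_cong[OF hecke_eq[of i f], of \<theta>] assms
    by (simp add: ring_map_add ring_map_mult ring_map_diff algebra_simps)
  then show "(X j - X (j + 1)) * \<theta> (hecke i f) = const (1 - tt) * X (j + 1) * \<theta> f
     + (const tt * X j - X (j + 1)) * exch j (j + 1) (\<theta> f)"
    using assms(3) by simp
qed

section \<open>Commutation and braid relations\<close>

lemma hecke_far_commute:
  assumes "i + 2 \<le> j \<or> j + 2 \<le> i"
  shows "hecke i (hecke j f) = hecke j (hecke i f)"
proof (rule hecke_eqI)
  have K: "exch i (i + 1) (hecke j f) = hecke j (exch i (i + 1) f)"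
  proof (rule hecke_intertwine[where a = 1])
    show "exch i (i + 1) (exch j (j + 1) f) = exch j (j + 1) (exch i (i + 1) f)"
      using exch_conj[of i "i + 1" j "j + 1" "exch i (i + 1) f"] assms
      by (simp add: transpose_def split: if_splits)
  qed (use assms ring_map_exch in \<open>auto simp: transpose_def\<close>)
  have sym: "exch j (j + 1) p = p" if "p \<in> {X i - X (i + 1), const (1 - tt) * X (i + 1),
      const tt * X i - X (i + 1)}" for p
    using that assms by (auto simp: transpose_def)
  have "(X i - X (i + 1)) * hecke j (hecke i f) = hecke j ((X i - X (i + 1)) * hecke i f)"
    by (rule hecke_mult_symmetric[symmetric]) (use sym in blast)
  also have "\<dots> = const (1 - tt) * X (i + 1) * hecke j f
     + (const tt * X i - X (i + 1)) * hecke j (exch i (i + 1) f)"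
    unfolding hecke_eq hecke_add using sym
    by (simp only: hecke_mult_symmetric[OF sym] insert_iff simp_thms)
  finally show "(X i - X (i + 1)) * hecke j (hecke i f) = const (1 - tt) * X (i + 1) * hecke j f
     + (const tt * X i - X (i + 1)) * exch i (i + 1) (hecke j f)"
    by (simp only: K)
qed


text \<open>T is a triple product such as T_1 T_2 T_1 f, U and V are the double product and its
  exchanged image, and P, Q, R, S the images of the single product; D1, D2, D3 are the differences
  of variables met on the way. The same pattern serves T_2 T_1 T_2 f.\<close>

lemma braid_expand:
  fixes D1 D2 D3 :: "'a::idom"
  assumes "D1 * T = a1 * U + b1 * V"
    and "D2 * U = a2 * P + b2 * R" and "D3 * V = a3 * Q + b3 * S"
    and "D1 * P = p" and "D1 * Q = q" and "D3 * R = r" and "D2 * S = w"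
  shows "D1 * D3 * D2 * D1 * T = a1 * D3 * a2 * p + a1 * b2 * D1 * r + b1 * a3 * D2 * q + b1 * b3 * D1 * w"
proof -
  have "D1 * D3 * D2 * D1 * T = D1 * D3 * D2 * (D1 * T)" by (simp only: mult.assoc)
  also have "\<dots> = a1 * D1 * D3 * (D2 * U) + b1 * D1 * D2 * (D3 * V)"
    unfolding assms(1) by (simp add: algebra_simps)
  also have "\<dots> = a1 * D3 * a2 * (D1 * P) + a1 * b2 * D1 * (D3 * R)
      + b1 * a3 * D2 * (D1 * Q) + b1 * b3 * D1 * (D2 * S)"
    unfolding assms(2,3) by (simp add: algebra_simps)
  finally show ?thesis unfolding assms(4-7) .
qed

text \<open>The six images of f under permuting x, y, z are independent unknowns: f1 = s f, f2 = r
  f, f12 = s r f, f21 = r s f, f121 = s r s f. The coefficients of the last three agree at sight;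
  those of f, f1 and f2 use the polynomial identities isolated in the proof.\<close>

lemma braid_identity:
  fixes x y z t c f f1 f2 f12 f21 f121 :: "'a::idom"
  assumes c: "c = 1 - t"
  shows "(y - z) * (
      (c * y) * (x - z) * (c * z) * (c * y * f + (t * x - y) * f1)
    + (c * y) * (t * y - z) * (x - y) * (c * z * f2 + (t * x - z) * f21)
    + (t * x - y) * (c * z) * (y - z) * ((x - t * y) * f - c * x * f1)
    + (t * x - y) * (t * x - z) * (x - y) * (c * z * f12 + (t * y - z) * f121)) =
   (x - y) * (
      (c * z) * (x - z) * (c * y) * (c * z * f + (t * y - z) * f2)
    + (c * z) * (t * x - y) * (y - z) * (c * z * f1 + (t * x - z) * f12)
    + (t * y - z) * (c * z) * (x - y) * ((y - t * z) * f - c * y * f2)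
    + (t * y - z) * (t * x - z) * (y - z) * (c * y * f21 + (t * x - y) * f121))"
proof -
  define u v w a b d where "u = y - z" and "v = x - y" and "w = x - z"
    and "a = t * x - y" and "b = t * y - z" and "d = t * x - z"
  have 0: "u * (c * y * w * c * y + a * u * (x - t * y)) = v * (c * y * w * c * z + b * v * (y - t * z))"
    unfolding c u_def v_def w_def a_def b_def by (simp add: algebra_simps)
  have "u * (c * y * w * (c * z) * (c * y * f + a * f1) + c * y * b * v * (c * z * f2 + d * f21)
    + a * (c * z) * u * ((x - t * y) * f - c * x * f1) + a * d * v * (c * z * f12 + b * f121))
    = c * z * f * (u * (c * y * w * c * y + a * u * (x - t * y)))
      + c * c * z * a * u * f1 * (y * w - x * u - z * v) + c * c * z * a * u * f1 * z * v
      + u * v * (c * y * b * c * z * f2 + c * y * b * d * f21 + a * d * c * z * f12 + a * d * b * f121)"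
    by (simp add: algebra_simps)
  also have "\<dots> = v * (c * z * w * (c * y) * (c * z * f + b * f2) + c * z * a * u * (c * z * f1 + d * f12)
    + b * (c * z) * v * ((y - t * z) * f - c * y * f2) + b * d * u * (c * y * f21 + a * f121))
    + c * c * z * a * u * f1 * (y * w - x * u - z * v)
    + v * c * c * z * b * f2 * (y * u + y * v - y * w)"
    unfolding 0 by (simp add: algebra_simps)
  also have "y * u + y * v - y * w = 0" by (simp add: algebra_simps u_def v_def w_def)
  also have "y * w - x * u - z * v = 0" by (simp add: algebra_simps u_def v_def w_def)
  finally show ?thesis by (simp add: u_def v_def w_def a_def b_def d_def)
qed
lemma hecke_braid: "hecke i (hecke (i + 1) (hecke i f)) = hecke (i + 1) (hecke i (hecke (i + 1) f))"
proof -
  define x y z t where "x = X i" and "y = X (i + 1)" and "z = X (i + 2)" and "t = const tt"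
  define c where "c = 1 - t"
  define s where "s = exch i (i + 1)"
  define r where "r = exch (i + 1) (i + 2)"
  define T1 where "T1 = hecke i"
  define T2 where "T2 = hecke (i + 1)"
  have i2: "i + 1 + 1 = i + 2" by simp
  have c': "const (1 - tt) = c" by (simp add: c_def t_def const_diff)
  have e1: "(x - y) * T1 g = c * y * g + (t * x - y) * s g" for g
    using hecke_eq[of i g] by (simp add: x_def y_def t_def s_def T1_def c')
  have e2: "(y - z) * T2 g = c * z * g + (t * y - z) * r g" for g
    using hecke_eq[of "i + 1" g] unfolding i2 by (simp add: z_def y_def t_def r_def T2_def c')
  have sr [simp]: "s x = y" "s y = x" "s z = z" "s t = t" "s c = c" "r x = x" "r y = z" "r z = y" "r t = t" "r c = c"
    by (auto simp: s_def r_def x_def y_def z_def t_def transpose_def c_def)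
  have hom: "s (a + b) = s a + s b" "s (a * b) = s a * s b" "s (a - b) = s a - s b"
    "r (a + b) = r a + r b" "r (a * b) = r a * r b" "r (a - b) = r a - r b" for a b
    by (simp_all add: s_def r_def)
  have inv: "s (s g) = g" "r (r g) = g" for g by (simp_all add: s_def r_def)
  have br: "s (r (s g)) = r (s (r g))" for g
    using exch_conj[of i "i+1" "i+1" "i+2" g] exch_conj[of "i+1" "i+2" i "i+1" g]
    by (simp add: s_def r_def transpose_def exch_def insert_commute)
  note S = arg_cong[where f = s] and R = arg_cong[where f = r]
  have A: "(x - y) * (x - z) * (y - z) * (x - y) * T1 (T2 (T1 f)) =
      (c * y) * (x - z) * (c * z) * (c * y * f + (t * x - y) * s f)
    + (c * y) * (t * y - z) * (x - y) * (c * z * r f + (t * x - z) * r (s f))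
    + (t * x - y) * (c * z) * (y - z) * ((x - t * y) * f - c * x * s f)
    + (t * x - y) * (t * x - z) * (x - y) * (c * z * s (r f) + (t * y - z) * s (r (s f)))"
  proof (rule braid_expand)
    show "(x - z) * s (T2 (T1 f)) = c * z * s (T1 f) + (t * x - z) * s (r (T1 f))"
      using S[OF e2[of "T1 f"]] by (simp add: hom)
    show "(x - y) * s (T1 f) = (x - t * y) * f - c * x * s f"
      using S[OF e1[of f]] by (simp add: hom inv) (simp add: algebra_simps)
    show "(x - z) * r (T1 f) = c * z * r f + (t * x - z) * r (s f)"
      using R[OF e1[of f]] by (simp add: hom)
    show "(y - z) * s (r (T1 f)) = c * z * s (r f) + (t * y - z) * s (r (s f))"
      using S[OF R[OF e1[of f]]] by (simp add: hom)
  qed (use e1 e2 in auto)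
  have B: "(y - z) * (x - z) * (x - y) * (y - z) * T2 (T1 (T2 f)) =
      (c * z) * (x - z) * (c * y) * (c * z * f + (t * y - z) * r f)
    + (c * z) * (t * x - y) * (y - z) * (c * z * s f + (t * x - z) * s (r f))
    + (t * y - z) * (c * z) * (x - y) * ((y - t * z) * f - c * y * r f)
    + (t * y - z) * (t * x - z) * (y - z) * (c * y * r (s f) + (t * x - y) * r (s (r f)))"
  proof (rule braid_expand)
    show "(x - z) * r (T1 (T2 f)) = c * z * r (T2 f) + (t * x - z) * r (s (T2 f))"
      using R[OF e1[of "T2 f"]] by (simp add: hom)
    show "(y - z) * r (T2 f) = (y - t * z) * f - c * y * r f"
      using R[OF e2[of f]] by (simp add: hom inv) (simp add: algebra_simps)
    show "(x - z) * s (T2 f) = c * z * s f + (t * x - z) * s (r f)"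
      using S[OF e2[of f]] by (simp add: hom)
    show "(x - y) * r (s (T2 f)) = c * y * r (s f) + (t * x - y) * r (s (r f))"
      using R[OF S[OF e2[of f]]] by (simp add: hom)
  qed (use e1 e2 in auto)
  \<comment> \<open>The two expansions carry the denominators (x - y)^2 (x - z) (y - z) and (y -
    z)^2 (x - z) (x - y); the extra factor on each side makes them equal.\<close>
  have "(y - z) * ((x - y) * (x - z) * (y - z) * (x - y) * T1 (T2 (T1 f)))
      = (x - y) * ((y - z) * (x - z) * (x - y) * (y - z) * T2 (T1 (T2 f)))"
    unfolding A B br by (rule braid_identity[OF c_def])
  moreover have "x - y \<noteq> 0" "x - z \<noteq> 0" "y - z \<noteq> 0"
    by (simp_all add: x_def y_def z_def)
  ultimately show ?thesis by (simp add: T1_def T2_def ac_simps)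
qed

text \<open>A cross relation of the affine Hecke algebra. Rewritten as T_i^{-1} x_{i+1} = t^{-1} x_i
  T_i, it carries a variable through a string of inverse Hecke operators.\<close>

lemma hecke_X_hecke: "hecke i (X i * hecke i f) = const tt * X (i + 1) * f"
proof (rule hecke_eqI)
  define D where "D = X i - X (i + 1)"
  define T where "T = hecke i f"
  define S where "S = exch i (i + 1) (hecke i f)"
  define W where "W = const (1 - tt) * X i * T + (const tt * X i - X (i + 1)) * S"
  have "D * W = const (1 - tt) * X i * (D * T) + (const tt * X i - X (i + 1)) * (D * S)"
    by (simp add: W_def algebra_simps)
  also have "\<dots> = D * (D * const tt * f)"
    unfolding D_def T_def S_def hecke_eq hecke_exch by (simp add: algebra_simps const_diff)
  finally have W: "W = D * const tt * f"
    by (simp add: D_def)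
  have "const (1 - tt) * X (i + 1) * (X i * T) + (const tt * X i - X (i + 1)) * exch i (i + 1) (X i * T)
      = X (i + 1) * W"
    by (simp add: W_def S_def T_def algebra_simps)
  then show "(X i - X (i + 1)) * (const tt * X (i + 1) * f) = const (1 - tt) * X (i + 1) * (X i * hecke i f)
     + (const tt * X i - X (i + 1)) * exch i (i + 1) (X i * hecke i f)"
    unfolding W by (simp add: D_def T_def algebra_simps)
qed

lemma omega_hecke:
  assumes "1 \<le> i" "i + 2 \<le> N"
  shows "omega N (hecke (i + 1) f) = hecke i (omega N f)"
proof -
  have N: "1 \<le> N" using assms by simp
  show ?thesis
    by (rule hecke_intertwine[where a = 1])
      (use assms exch_omega[OF assms, of f] in \<open>auto simp: omega_X omega_const[OF N] ring_map_omega\<close>)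
qed

lemma omega_omega_hecke:
  assumes "2 \<le> N"
  shows "omega N (omega N (hecke 1 f)) = hecke (N - 1) (omega N (omega N f))"
proof -
  have N: "1 \<le> N" using assms by simp
  note rm = ring_map_omega[OF N]
  note e = exch_omega_omega[OF assms, of f]
  have X: "omega N (X N) = X (N - 1)" using assms by (simp add: omega_X)
  have s: "Suc (N - Suc 0) = N" using assms by simp
  show ?thesis
  proof (rule hecke_intertwine[of "\<lambda>f. omega N (omega N f)" qq])
    show "ring_map (\<lambda>f. omega N (omega N f))"
      using ring_map_comp[OF rm rm] by (simp add: comp_def)
    have "omega N (X 1) = const qq * X N" using N by (simp add: omega_X)
    then show "omega N (omega N (X 1)) = const qq * X (N - 1)"
      using N by (simp add: ring_map_mult[OF rm] X)
    show "omega N (omega N (X (1 + 1))) = const qq * X (N - 1 + 1)"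
      using assms N by (simp add: omega_X[OF N])
    show "omega N (omega N (exch 1 (1 + 1) f)) = exch (N - 1) (N - 1 + 1) (omega N (omega N f))"
      using e s by (simp add: numeral_2_eq_2)
  qed (use assms in \<open>auto simp: qq_def Zero_fract_def eq_fract\<close>)
qed

subsection \<open>Relations between Cherednik and Hecke operators\<close>

definition linear_op :: "(mpol \<Rightarrow> mpol) \<Rightarrow> bool" where
  "linear_op A \<longleftrightarrow> (\<forall>f g. A (f + g) = A f + A g) \<and> (\<forall>c f. A (const c * f) = const c * A f)"

lemma
  assumes "linear_op A"
  shows linear_op_add: "A (f + g) = A f + A g"
    and linear_op_const_mult: "A (const c * f) = const c * A f"
    and linear_op_zero: "A 0 = 0"
proof -
  show "A (const c * f) = const c * A f" for c f using assms by (simp add: linear_op_def)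
  from this[of 0] show "A 0 = 0" by simp
qed (use assms in \<open>simp add: linear_op_def\<close>)

lemma linear_op_comp: "linear_op A \<Longrightarrow> linear_op B \<Longrightarrow> linear_op (A \<circ> B)"
  by (simp add: linear_op_def)

lemma linear_op_compose: "(\<And>A. A \<in> set As \<Longrightarrow> linear_op A) \<Longrightarrow> linear_op (compose As)"
  by (induction As) (simp_all add: linear_op_comp, simp add: linear_op_def)

lemma linear_op_hecke: "linear_op (hecke i)"
  unfolding linear_op_def using hecke_add hecke_const_mult by blast

lemma linear_op_hecke_inv: "linear_op (hecke_inv i)"
  by (simp only: linear_op_def hecke_inv_def hecke_add hecke_const_mult) (simp add: algebra_simps)

lemma linear_op_omega: "1 \<le> N \<Longrightarrow> linear_op (omega N)"
  by (simp add: linear_op_def ring_map_add[OF ring_map_omega] ring_map_mult[OF ring_map_omega])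

lemma hecke_inv_mult_symmetric:
  assumes "exch i (i + 1) p = p"
  shows "hecke_inv i (p * f) = p * hecke_inv i f"
  by (simp only: hecke_inv_def hecke_mult_symmetric[OF assms]) (simp add: algebra_simps)

lemma hecke_inv_commute: "(\<And>f. hecke i (A f) = A (hecke j f)) \<Longrightarrow> hecke_inv i (A f) = A (hecke_inv j f)"
  by (metis hecke_hecke_inv hecke_inv_hecke)

lemma compose_commute:
  "(\<And>g f. g \<in> set gs \<Longrightarrow> a (g f) = g (a f)) \<Longrightarrow> a (compose gs f) = compose gs (a f)"
  by (induction gs arbitrary: f) auto

section \<open>Strings of consecutive Hecke operators\<close>

definition hecke_chain :: "nat \<Rightarrow> nat \<Rightarrow> mpol \<Rightarrow> mpol" where
  "hecke_chain i j = compose (map hecke [i..<j])"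

definition hecke_inv_chain :: "nat \<Rightarrow> nat \<Rightarrow> mpol \<Rightarrow> mpol" where
  "hecke_inv_chain i j = compose (map hecke_inv [i..<j])"

lemma cherednik_alt:
  "cherednik N i f = const (tt powi (int i - int N)) *
     hecke_chain i N (omega N (hecke_inv_chain 1 i f))"
  unfolding cherednik_def hecke_chain_def hecke_inv_chain_def inv_hecke by simp

lemma hecke_chain_refl [simp]: "hecke_chain i i = id" "hecke_inv_chain i i = id"
  by (simp_all add: hecke_chain_def hecke_inv_chain_def)

lemma
  assumes "i < j"
  shows hecke_chain_Cons: "hecke_chain i j f = hecke i (hecke_chain (i + 1) j f)"
    and hecke_inv_chain_Cons: "hecke_inv_chain i j f = hecke_inv i (hecke_inv_chain (i + 1) j f)"
  using assms by (simp_all add: hecke_chain_def hecke_inv_chain_def upt_conv_Cons)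

lemma
  assumes "i \<le> k" "k \<le> j"
  shows hecke_chain_append: "hecke_chain i j f = hecke_chain i k (hecke_chain k j f)"
    and hecke_inv_chain_append: "hecke_inv_chain i j f = hecke_inv_chain i k (hecke_inv_chain k j f)"
proof -
  have "[i..<j] = [i..<k] @ [k..<j]" using assms by (metis le_Suc_ex upt_add_eq_append)
  then show "hecke_chain i j f = hecke_chain i k (hecke_chain k j f)"
    "hecke_inv_chain i j f = hecke_inv_chain i k (hecke_inv_chain k j f)"
    by (simp_all add: hecke_chain_def hecke_inv_chain_def compose_append)
qed

lemma
  assumes "i \<le> j"
  shows hecke_chain_snoc: "hecke_chain i (j + 1) f = hecke_chain i j (hecke j f)"
    and hecke_inv_chain_snoc: "hecke_inv_chain i (j + 1) f = hecke_inv_chain i j (hecke_inv j f)"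
  using assms hecke_chain_append[of i j "j + 1" f] hecke_inv_chain_append[of i j "j + 1" f]
  by (simp_all add: hecke_chain_Cons[of j "j + 1"] hecke_inv_chain_Cons[of j "j + 1"]
      del: add_Suc_right One_nat_def)

lemma linear_op_hecke_chain: "linear_op (hecke_chain i j)"
  and linear_op_hecke_inv_chain: "linear_op (hecke_inv_chain i j)"
  unfolding hecke_chain_def hecke_inv_chain_def
  by (auto intro!: linear_op_compose simp: linear_op_hecke linear_op_hecke_inv)

lemma linear_op_cherednik: "1 \<le> N \<Longrightarrow> linear_op (cherednik N i)"
  unfolding linear_op_def cherednik_alt
  by (simp only: linear_op_add[OF linear_op_hecke_chain] linear_op_add[OF linear_op_omega]
      linear_op_add[OF linear_op_hecke_inv_chain] linear_op_const_mult[OF linear_op_hecke_chain]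
      linear_op_const_mult[OF linear_op_omega] linear_op_const_mult[OF linear_op_hecke_inv_chain])
    (simp add: algebra_simps)

lemma hecke_chain_far:
  assumes "k + 2 \<le> i \<or> j + 1 \<le> k"
  shows "hecke k (hecke_chain i j f) = hecke_chain i j (hecke k f)"
  unfolding hecke_chain_def
  by (rule compose_commute) (use assms in \<open>auto intro: hecke_far_commute\<close>)

lemma hecke_inv_chain_far:
  assumes "k + 2 \<le> i \<or> j + 1 \<le> k"
  shows "hecke k (hecke_inv_chain i j f) = hecke_inv_chain i j (hecke k f)"
  unfolding hecke_inv_chain_def
proof (rule compose_commute)
  fix g h assume "g \<in> set (map hecke_inv [i..<j])"
  then obtain l where "g = hecke_inv l" "i \<le> l" "l < j" by auto
  then show "hecke k (g h) = g (hecke k h)"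
    using assms hecke_inv_commute[of l "hecke k" l h] hecke_far_commute[of k l] by auto
qed

text \<open>T_i commutes with the factors beyond T_{i+1}, becomes T_{i+1} through the braid relation
  with T_i T_{i+1}, and then commutes with the factors before T_i.\<close>

lemma hecke_chain_braid:
  assumes "j \<le> i" "i + 1 < n"
  shows "hecke_chain j n (hecke i f) = hecke (i + 1) (hecke_chain j n f)"
proof -
  have e: "hecke_chain j n g = hecke_chain j i (hecke i (hecke (i + 1) (hecke_chain (i + 2) n g)))" for g
    using assms hecke_chain_append[of j i n g] by (simp add: hecke_chain_Cons)
  have "hecke_chain j n (hecke i f) = hecke_chain j i (hecke i (hecke (i + 1) (hecke i (hecke_chain (i + 2) n f))))"
    unfolding e by (subst hecke_chain_far[of i "i + 2" n f, symmetric]) auto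
  also have "\<dots> = hecke_chain j i (hecke (i + 1) (hecke i (hecke (i + 1) (hecke_chain (i + 2) n f))))"
    by (simp only: hecke_braid)
  also have "\<dots> = hecke (i + 1) (hecke_chain j n f)"
    unfolding e by (subst hecke_chain_far[of "i + 1" j i]) auto
  finally show ?thesis .
qed

lemma hecke_inv_braid:
  "hecke_inv i (hecke_inv (i + 1) (hecke i f)) = hecke (i + 1) (hecke_inv i (hecke_inv (i + 1) f))"
proof -
  define g where "g = hecke_inv i (hecke_inv (i + 1) f)"
  have "f = hecke (i + 1) (hecke i g)" by (simp add: g_def)
  then have "hecke i f = hecke (i + 1) (hecke i (hecke (i + 1) g))" by (simp only: hecke_braid)
  then show ?thesis by (simp only: hecke_inv_hecke g_def)
qed

lemma hecke_inv_chain_braid: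
  assumes "1 \<le> i" "i + 1 < j"
  shows "hecke_inv_chain 1 j (hecke i f) = hecke (i + 1) (hecke_inv_chain 1 j f)"
proof -
  have e: "hecke_inv_chain 1 j g
      = hecke_inv_chain 1 i (hecke_inv i (hecke_inv (i + 1) (hecke_inv_chain (i + 2) j g)))" for g
    using assms hecke_inv_chain_append[of 1 i j g] by (simp add: hecke_inv_chain_Cons)
  have "hecke_inv_chain 1 j (hecke i f)
      = hecke_inv_chain 1 i (hecke_inv i (hecke_inv (i + 1) (hecke i (hecke_inv_chain (i + 2) j f))))"
    unfolding e by (subst hecke_inv_chain_far[of i "i + 2" j f, symmetric]) auto
  also have "\<dots> = hecke_inv_chain 1 i (hecke (i + 1) (hecke_inv i (hecke_inv (i + 1) (hecke_inv_chain (i + 2) j f))))"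
    by (simp only: hecke_inv_braid)
  also have "\<dots> = hecke (i + 1) (hecke_inv_chain 1 j f)"
    unfolding e by (subst hecke_inv_chain_far[of "i + 1" 1 i]) auto
  finally show ?thesis .
qed

text \<open>Y_{i+1} has one Hecke factor less on the left and one inverse more on the right than
  Y_i. The left T_i extends the string, the right one cancels T_i^{-1}; the t is the quotient of the
  scalars.\<close>

lemma hecke_cherednik_hecke:
  assumes "1 \<le> i" "i < N"
  shows "hecke i (cherednik N (i + 1) (hecke i f)) = const tt * cherednik N i f"
proof -
  have "tt powi (int (i + 1) - int N) = tt * tt powi (int i - int N)"
    by (subst power_int_add_1'[symmetric]) (auto simp: algebra_simps)
  then show ?thesis using assms
    by (simp only: cherednik_alt hecke_inv_chain_snoc hecke_inv_hecke hecke_const_mult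
        hecke_chain_Cons[of i N] const_mult mult.assoc)
qed

text \<open>T_i travels through the three pieces of Y_j from right to left. For j < i its index runs
  i, i, i - 1, i; for j > i + 1 it runs i, i + 1, i, i.\<close>

lemma cherednik_hecke_commute:
  assumes "1 \<le> i" "i < N" "1 \<le> j" "j \<le> N" "j \<noteq> i" "j \<noteq> i + 1"
  shows "cherednik N j (hecke i f) = hecke i (cherednik N j f)"
proof (cases "j < i")
  case True
  have "hecke_inv_chain 1 j (hecke i f) = hecke i (hecke_inv_chain 1 j f)"
    by (rule hecke_inv_chain_far[symmetric]) (use True in auto)
  moreover have "omega N (hecke i g) = hecke (i - 1) (omega N g)" for g
    using omega_hecke[of "i - 1" N g] assms True by simp
  moreover have "hecke_chain j N (hecke (i - 1) g) = hecke i (hecke_chain j N g)" for g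
    using hecke_chain_braid[of j "i - 1" N g] assms True by simp
  ultimately show ?thesis by (simp only: cherednik_alt hecke_const_mult)
next
  case False
  then have *: "i + 2 \<le> j" using assms by simp
  then have "hecke_inv_chain 1 j (hecke i f) = hecke (i + 1) (hecke_inv_chain 1 j f)"
    using hecke_inv_chain_braid assms by simp
  moreover have "omega N (hecke (i + 1) g) = hecke i (omega N g)" for g
    using omega_hecke[of i N g] assms * by simp
  moreover have "hecke_chain j N (hecke i g) = hecke i (hecke_chain j N g)" for g
    by (rule hecke_chain_far[symmetric]) (use * in auto)
  ultimately show ?thesis by (simp only: cherednik_alt hecke_const_mult)
qed

section \<open>Cherednik operators and raising\<close>

definition raise_op :: "nat \<Rightarrow> mpol \<Rightarrow> mpol" where
  "raise_op N f = X N * omega N f"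

lemma hecke_inv_X: "hecke_inv i (X (i + 1) * f) = const (inverse tt) * (X i * hecke i f)"
proof -
  have "hecke i (const (inverse tt) * (X i * hecke i f)) = X (i + 1) * f"
    by (simp add: hecke_const_mult hecke_X_hecke const_inverse_mult mult.assoc)
  then show ?thesis by (metis hecke_inv_hecke)
qed

text \<open>x_k walks down to x_1, and each T_i^{-1} that it passes becomes t^{-1} T_i.\<close>

lemma hecke_inv_chain_X:
  "1 \<le> k \<Longrightarrow> hecke_inv_chain 1 k (X k * f) = const (inverse tt ^ (k - 1)) * (X 1 * hecke_chain 1 k f)"
proof (induction k arbitrary: f rule: dec_induct)
  case base
  then show ?case by simp
next
  case (step k)
  have "hecke_inv_chain 1 (k + 1) (X (k + 1) * f)
      = const (inverse tt) * hecke_inv_chain 1 k (X k * hecke k f)"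
    using step.hyps
    by (simp only: hecke_inv_chain_snoc hecke_inv_X linear_op_const_mult[OF linear_op_hecke_inv_chain])
  also have "\<dots> = const (inverse tt * inverse tt ^ (k - 1)) * (X 1 * hecke_chain 1 k (hecke k f))"
    by (simp only: step.IH const_mult mult.assoc)
  also have "inverse tt * inverse tt ^ (k - 1) = inverse tt ^ (k + 1 - 1)"
    using step.hyps by (cases k) auto
  also have "hecke_chain 1 k (hecke k f) = hecke_chain 1 (k + 1) f"
    using step.hyps by (simp only: hecke_chain_snoc)
  finally show ?case by simp
qed

text \<open>Y_N has no Hecke factor left of \<omega>. Its inverses turn x_N into x_1 followed by T_1
  ... T_{N-1}, the string of Y_1, and \<omega> sends x_1 to q x_N. The collected t^{1-N} is the
  scalar of Y_1.\<close>

lemma cherednik_raise_last: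
  assumes "1 \<le> N"
  shows "cherednik N N (raise_op N f) = const qq * raise_op N (cherednik N 1 f)"
proof -
  have p: "inverse tt ^ (N - 1) = tt powi (int 1 - int N)"
    using assms by (simp add: power_int_def nat_diff_distrib)
  show ?thesis
    unfolding cherednik_alt raise_op_def hecke_inv_chain_X[OF assms]
      ring_map_mult[OF ring_map_omega[OF assms]] omega_const[OF assms] p
    by (simp add: omega_X[OF assms] ac_simps)
qed

lemma omega_hecke_chain:
  assumes "1 \<le> i" "j < N"
  shows "omega N (hecke_chain (i + 1) (j + 1) f) = hecke_chain i j (omega N f)"
proof (cases "i \<le> j")
  case True
  then show ?thesis using assms(2)
  proof (induction j arbitrary: f rule: dec_induct)
    case (step k)
    then have "omega N (hecke_chain (i + 1) (k + 1 + 1) f) = hecke_chain i k (omega N (hecke (k + 1) f))"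
      by (simp only: hecke_chain_snoc add_le_mono1)
    also have "omega N (hecke (k + 1) f) = hecke k (omega N f)"
      by (rule omega_hecke) (use step assms in auto)
    also have "hecke_chain i k (hecke k (omega N f)) = hecke_chain i (k + 1) (omega N f)"
      using step by (simp only: hecke_chain_snoc)
    finally show ?case by simp
  qed simp
qed (simp add: hecke_chain_def)

lemma omega_hecke_inv_chain:
  assumes "1 \<le> i" "j < N"
  shows "omega N (hecke_inv_chain (i + 1) (j + 1) f) = hecke_inv_chain i j (omega N f)"
proof (cases "i \<le> j")
  case True
  then show ?thesis using assms(2)
  proof (induction j arbitrary: f rule: dec_induct)
    case (step k)
    then have "omega N (hecke_inv_chain (i + 1) (k + 1 + 1) f)
        = hecke_inv_chain i k (omega N (hecke_inv (k + 1) f))"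
      by (simp only: hecke_inv_chain_snoc add_le_mono1)
    also have "omega N (hecke_inv (k + 1) f) = hecke_inv k (omega N f)"
      by (rule hecke_inv_commute[symmetric], rule omega_hecke[symmetric]) (use step assms in auto)
    also have "hecke_inv_chain i k (hecke_inv k (omega N f)) = hecke_inv_chain i (k + 1) (omega N f)"
      using step by (simp only: hecke_inv_chain_snoc)
    finally show ?case by simp
  qed simp
qed (simp add: hecke_inv_chain_def)

text \<open>The last Hecke factor of Y_i meets x_{N-1} and leaves t x_N T_{N-1}^{-1}. Moved through
  two shifts, T_{N-1}^{-1} is the factor T_1^{-1} by which the inverse string of Y_{i+1} is longer;
  the t is the quotient of the two scalars.\<close>

lemma cherednik_raise:
  assumes "1 \<le> i" "i < N"
  shows "cherednik N i (raise_op N f) = raise_op N (cherednik N (i + 1) f)"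
proof -
  have N: "1 \<le> N" "2 \<le> N" using assms by auto
  note om = ring_map_mult[OF ring_map_omega[OF N(1)]]
  define G where "G = hecke_inv_chain (1 + 1) (i + 1) f"
  define h where "h = omega N (omega N G)"
  have XN: "omega N (X N) = X (N - 1)" using N by (simp add: omega_X)
  have 1: "hecke_inv_chain 1 i (X N * g) = X N * hecke_inv_chain 1 i g" for g
    unfolding hecke_inv_chain_def
    by (rule compose_commute[symmetric])
      (use assms in \<open>auto intro!: hecke_inv_mult_symmetric[symmetric] simp: transpose_def\<close>)
  have 2: "hecke_chain i (N - 1) (X N * g) = X N * hecke_chain i (N - 1) g" for g
    unfolding hecke_chain_def
    by (rule compose_commute[symmetric])
      (use assms in \<open>auto intro!: hecke_mult_symmetric[symmetric] simp: transpose_def\<close>)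
  have G: "hecke_inv_chain 1 i (omega N f) = omega N G"
    unfolding G_def by (rule omega_hecke_inv_chain[symmetric]) (use assms in auto)
  have inv1: "hecke_inv 1 G = hecke_inv_chain 1 (i + 1) f"
    using hecke_inv_chain_Cons[of 1 "i + 1" f] assms by (simp add: G_def)
  have h: "hecke_inv (N - 1) h = omega N (omega N (hecke_inv 1 G))"
    unfolding h_def
    using hecke_inv_commute[of "N - 1" "\<lambda>g. omega N (omega N g)" 1 G] omega_omega_hecke[OF N(2)]
    by simp
  have last: "hecke (N - 1) (X (N - 1) * h) = const tt * X N * hecke_inv (N - 1) h"
    using hecke_X_hecke[of "N - 1" "hecke_inv (N - 1) h"] N by simp
  have snoc: "hecke_chain i N g = hecke_chain i (N - 1) (hecke (N - 1) g)" for g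
    using hecke_chain_snoc[of i "N - 1" g] assms by simp
  have pw: "tt powi (int (i + 1) - int N) = tt powi (int i - int N) * tt"
    by (subst power_int_add_1[symmetric]) (auto simp: algebra_simps)
  have "cherednik N i (raise_op N f) = const (tt powi (int i - int N)) * hecke_chain i N (X (N - 1) * h)"
    unfolding cherednik_alt raise_op_def 1 G om XN h_def ..
  also have "\<dots> = const (tt powi (int (i + 1) - int N)) * (X N * hecke_chain i (N - 1) (hecke_inv (N - 1) h))"
    unfolding snoc last mult.assoc linear_op_const_mult[OF linear_op_hecke_chain] 2
    by (simp only: pw const_mult mult.assoc)
  also have "hecke_chain i (N - 1) (hecke_inv (N - 1) h)
      = omega N (hecke_chain (i + 1) N (omega N (hecke_inv_chain 1 (i + 1) f)))"
    unfolding h inv1 using omega_hecke_chain[of i "N - 1" N "omega N (hecke_inv_chain 1 (i + 1) f)"]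
      assms N by simp
  finally show ?thesis
    unfolding cherednik_alt[of N "i + 1"] raise_op_def om omega_const[OF N(1)]
    by (simp only: ac_simps)
qed

text \<open>Put T_i f for f in T_i Y_{i+1} T_i = t Y_i and expand T_i^2, respectively apply T_i^{-1}
  to it.\<close>

lemma cherednik_intertwine:
  assumes "1 \<le> i" "i < N"
  shows "cherednik N i (hecke i f) = hecke i (cherednik N (i + 1) f) + const (tt - 1) * cherednik N i f"
    and "cherednik N (i + 1) (hecke i f) = hecke i (cherednik N i f) - const (tt - 1) * cherednik N i f"
proof -
  have N: "1 \<le> N" using assms by simp
  note lin = linear_op_add[OF linear_op_cherednik[OF N]] linear_op_const_mult[OF linear_op_cherednik[OF N]]
  note h = hecke_cherednik_hecke[OF assms]
  have "const tt * cherednik N i (hecke i f)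
      = const (tt - 1) * hecke i (cherednik N (i + 1) (hecke i f)) + const tt * hecke i (cherednik N (i + 1) f)"
    unfolding h[of "hecke i f", symmetric] hecke_quadratic lin hecke_add hecke_const_mult ..
  also have "\<dots> = const tt * (hecke i (cherednik N (i + 1) f) + const (tt - 1) * cherednik N i f)"
    unfolding h by (simp add: algebra_simps)
  finally show "cherednik N i (hecke i f) = hecke i (cherednik N (i + 1) f) + const (tt - 1) * cherednik N i f"
    by simp
  have "cherednik N (i + 1) (hecke i f) = hecke_inv i (const tt * cherednik N i f)"
    unfolding h[of f, symmetric] by simp
  also have "\<dots> = hecke i (cherednik N i f) - const (tt - 1) * cherednik N i f"
    unfolding linear_op_const_mult[OF linear_op_hecke_inv]
    by (simp add: hecke_inv_def mult.assoc[symmetric] const_mult[symmetric])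
  finally show "cherednik N (i + 1) (hecke i f) = hecke i (cherednik N i f) - const (tt - 1) * cherednik N i f" .
qed

subsection \<open>Action on monomials\<close>

text \<open>\<open>map_key\<close> precomposes: the entry at p k is moved to k. Hence the reversed
  order of the permutations in \<open>permute_expo_comp\<close>.\<close>

abbreviation permute_expo :: "(nat \<Rightarrow> nat) \<Rightarrow> expo \<Rightarrow> expo" where
  "permute_expo \<equiv> Poly_Mapping.map_key"

lemma lookup_permute_expo: "inj p \<Longrightarrow> lookup (permute_expo p \<nu>) k = lookup \<nu> (p k)"
  by (simp add: map_key.rep_eq)

lemma permute_expo_comp:
  assumes "inj p" "inj r"
  shows "permute_expo r (permute_expo p \<nu>) = permute_expo (p \<circ> r) \<nu>"
  using assms by (auto intro!: poly_mapping_eqI simp: lookup_permute_expo inj_compose)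

lemma permute_expo_single: "bij p \<Longrightarrow> permute_expo p (single k c) = single (inv p k) c"
  by (auto intro!: poly_mapping_eqI simp: lookup_permute_expo bij_is_inj lookup_single when_def
      bij_inv_eq_iff surj_f_inv_f bij_is_surj)

lemma permute_expo_id [simp]: "permute_expo id \<nu> = \<nu>"
  by (auto intro!: poly_mapping_eqI simp: lookup_permute_expo)

lemma permute_expo_inv:
  assumes "bij p"
  shows "permute_expo p (permute_expo (inv p) \<nu>) = \<nu>" "permute_expo (inv p) (permute_expo p \<nu>) = \<nu>"
  using assms by (auto intro!: poly_mapping_eqI simp: lookup_permute_expo bij_is_inj bij_imp_bij_inv
      bij_inv_eq_iff surj_f_inv_f bij_is_surj)

lemma exch_xmon: "exch i j (xmon \<nu>) = xmon (permute_expo (transpose i j) \<nu>)"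
proof (induction \<nu> rule: poly_mapping_single_add_induct)
  case (single k c)
  have "exch i j (X k ^ c) = X (transpose i j k) ^ c"
    by (simp add: ring_map_power[OF ring_map_exch])
  then show ?case by (simp add: X_power permute_expo_single)
next
  case (add f g)
  then show ?case by (simp add: xmon_add map_key_plus[OF inj_transpose])
qed

text \<open>\<omega> lowers the indices of variables, so the new exponent at k is the old one at k +
  1: on exponents the inverse cycle acts.\<close>

definition cyclic_shift :: "nat \<Rightarrow> nat \<Rightarrow> nat" where
  "cyclic_shift N k = (if k = N then 1 else if 1 \<le> k \<and> k < N then k + 1 else k)"

definition cyclic_unshift :: "nat \<Rightarrow> nat \<Rightarrow> nat" where
  "cyclic_unshift N k = (if k = 1 then N else if 1 < k \<and> k \<le> N then k - 1 else k)"

lemma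
  assumes "1 \<le> N"
  shows cyclic_shift_permutes: "cyclic_shift N permutes {1..N}"
    and inv_cyclic_shift: "inv (cyclic_shift N) = cyclic_unshift N"
proof -
  have 1: "cyclic_shift N \<circ> cyclic_unshift N = id" "cyclic_unshift N \<circ> cyclic_shift N = id"
    using assms by (auto simp: cyclic_shift_def cyclic_unshift_def fun_eq_iff)
  then show "inv (cyclic_shift N) = cyclic_unshift N" by (rule inv_unique_comp)
  have "bij (cyclic_shift N)" using 1 o_bij by blast
  moreover have "cyclic_shift N k = k" if "k \<notin> {1..N}" for k
    using that assms by (auto simp: cyclic_shift_def)
  ultimately show "cyclic_shift N permutes {1..N}" by (auto simp: permutes_def bij_iff)
qed

lemma omega_xmon:
  assumes "1 \<le> N"
  shows "omega N (xmon \<nu>) = const (qq ^ lookup \<nu> 1) * xmon (permute_expo (cyclic_shift N) \<nu>)"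
proof (induction \<nu> rule: poly_mapping_single_add_induct)
  case (single k c)
  have "omega N (X k ^ c) = (if k = 1 then const qq * X N else X (cyclic_unshift N k)) ^ c"
    using assms by (simp add: ring_map_power[OF ring_map_omega] omega_X cyclic_unshift_def)
  also have "\<dots> = const (qq ^ lookup (single k c) 1) * X (cyclic_unshift N k) ^ c"
    by (auto simp: const_power power_mult_distrib cyclic_unshift_def lookup_single when_def)
  finally show ?case
    using cyclic_shift_permutes[OF assms]
    by (simp add: X_power permute_expo_single permutes_bij inv_cyclic_shift[OF assms])
next
  case (add f g)
  then show ?case using cyclic_shift_permutes[OF assms]
    by (simp add: xmon_add map_key_plus permutes_inj ring_map_mult[OF ring_map_omega[OF assms]]
        lookup_add power_add const_mult ac_simps)
qed

section \<open>Hecke operators on monomials\<close>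

definition set_pair :: "nat \<Rightarrow> nat \<Rightarrow> nat \<Rightarrow> expo \<Rightarrow> expo" where
  "set_pair i c d \<nu> = Poly_Mapping.update i c (Poly_Mapping.update (i + 1) d \<nu>)"

lemma lookup_set_pair:
  "lookup (set_pair i c d \<nu>) k
    = (if k = i then c else if k = i + 1 then d else lookup \<nu> k)"
  by (simp add: set_pair_def lookup_update)

lemma xmon_set_pair: "xmon (set_pair i c d \<nu>) = xmon (set_pair i 0 0 \<nu>) * X i ^ c * X (i + 1) ^ d"
proof -
  have "set_pair i c d \<nu> = set_pair i 0 0 \<nu> + single i c + single (i + 1) d"
    by (rule poly_mapping_eqI) (auto simp: lookup_set_pair lookup_add lookup_single when_def)
  then show ?thesis by (simp add: xmon_add X_power)
qed

lemma set_pair_same: "set_pair i (lookup \<nu> i) (lookup \<nu> (i + 1)) \<nu> = \<nu>"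
  by (rule poly_mapping_eqI) (auto simp: lookup_set_pair)

lemma set_pair_transpose:
  "set_pair i (lookup \<nu> (i + 1)) (lookup \<nu> i) \<nu> = permute_expo (transpose i (i + 1)) \<nu>"
  by (rule poly_mapping_eqI) (auto simp: lookup_set_pair lookup_permute_expo transpose_def)

text \<open>Up to the factor x y this is a geometric sum: it collects the terms strictly between x^k
  and y^k, which become the lower monomials of T_i x^\<nu>.\<close>

lemma interior_sum:
  fixes x y :: "'a::comm_ring_1"
  assumes "1 \<le> k"
  shows "(x - y) * (\<Sum>j\<in>{1..<k}. x ^ j * y ^ (k - j)) = x ^ k * y - x * y ^ k"
  using assms
proof (induction k rule: dec_induct)
  case (step k)
  have "(\<Sum>j\<in>{1..<Suc k}. x ^ j * y ^ (Suc k - j)) = y * (\<Sum>j\<in>{1..<k}. x ^ j * y ^ (k - j)) + x ^ k * y"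
  proof -
    have "(\<Sum>j\<in>{1..<k}. x ^ j * y ^ (Suc k - j)) = y * (\<Sum>j\<in>{1..<k}. x ^ j * y ^ (k - j))"
      unfolding sum_distrib_left by (rule sum.cong) (auto simp: Suc_diff_le)
    then show ?thesis using step.hyps by simp
  qed
  then have "(x - y) * (\<Sum>j\<in>{1..<Suc k}. x ^ j * y ^ (Suc k - j))
      = y * ((x - y) * (\<Sum>j\<in>{1..<k}. x ^ j * y ^ (k - j))) + (x - y) * x ^ k * y"
    by (simp add: algebra_simps)
  then show ?case unfolding step.IH by (simp add: algebra_simps)
qed simp

lemma hecke_xmon_eq:
  assumes "lookup \<nu> i = lookup \<nu> (i + 1)"
  shows "hecke i (xmon \<nu>) = const tt * xmon \<nu>"
proof -
  have "permute_expo (transpose i (i + 1)) \<nu> = \<nu>"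
    by (rule poly_mapping_eqI) (use assms in \<open>auto simp: lookup_permute_expo transpose_def\<close>)
  then have e: "exch i (i + 1) (xmon \<nu>) = xmon \<nu>" by (simp only: exch_xmon)
  show ?thesis
    by (rule hecke_eqI) (simp only: e, simp add: algebra_simps const_diff)
qed

lemma hecke_xmon_gt:
  assumes "lookup \<nu> i = b + k" "lookup \<nu> (i + 1) = b" "1 \<le> k"
  shows "hecke i (xmon \<nu>) = xmon (permute_expo (transpose i (i + 1)) \<nu>)
      + const (1 - tt) * (\<Sum>j\<in>{1..<k}. xmon (set_pair i (b + j) (b + (k - j)) \<nu>))"
proof (rule hecke_eqI)
  \<comment> \<open>M is the part of the monomial symmetric in x_i and x_{i+1}; what remains is x^k
    against y^k.\<close>
  define x y M where "x = X i" and "y = X (i + 1)" and "M = xmon (set_pair i 0 0 \<nu>) * x ^ b * y ^ b"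
  have sp: "xmon (set_pair i (b + c) (b + d) \<nu>) = M * (x ^ c * y ^ d)" for c d
    by (subst xmon_set_pair) (simp add: M_def x_def y_def power_add ac_simps)
  have 1: "xmon \<nu> = M * x ^ k" using sp[of k 0] set_pair_same[of i \<nu>] assms by simp
  have 2: "xmon (permute_expo (transpose i (i + 1)) \<nu>) = M * y ^ k"
    using sp[of 0 k] set_pair_transpose[of i \<nu>] assms by simp
  have "(x - y) * (M * y ^ k + const (1 - tt) * (\<Sum>j\<in>{1..<k}. M * (x ^ j * y ^ (k - j))))
      = M * ((x - y) * y ^ k + const (1 - tt) * ((x - y) * (\<Sum>j\<in>{1..<k}. x ^ j * y ^ (k - j))))"
    unfolding sum_distrib_left[symmetric] by (simp add: algebra_simps)
  also have "\<dots> = const (1 - tt) * y * (M * x ^ k) + (const tt * x - y) * (M * y ^ k)"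
    unfolding interior_sum[OF assms(3)] by (simp add: algebra_simps const_diff)
  finally show "(X i - X (i + 1)) * (xmon (permute_expo (transpose i (i + 1)) \<nu>)
      + const (1 - tt) * (\<Sum>j\<in>{1..<k}. xmon (set_pair i (b + j) (b + (k - j)) \<nu>)))
    = const (1 - tt) * X (i + 1) * xmon \<nu> + (const tt * X i - X (i + 1)) * exch i (i + 1) (xmon \<nu>)"
    unfolding exch_xmon 2 sp by (simp only: 1 x_def y_def)
qed

lemma hecke_xmon_lt:
  assumes "lookup \<nu> i = a" "lookup \<nu> (i + 1) = a + k" "1 \<le> k"
  shows "hecke i (xmon \<nu>) = const tt * xmon (permute_expo (transpose i (i + 1)) \<nu>)
      + const (tt - 1) * (xmon \<nu> + (\<Sum>j\<in>{1..<k}. xmon (set_pair i (a + j) (a + (k - j)) \<nu>)))"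
proof (rule hecke_eqI)
  define x y M where "x = X i" and "y = X (i + 1)" and "M = xmon (set_pair i 0 0 \<nu>) * x ^ a * y ^ a"
  have sp: "xmon (set_pair i (a + c) (a + d) \<nu>) = M * (x ^ c * y ^ d)" for c d
    by (subst xmon_set_pair) (simp add: M_def x_def y_def power_add ac_simps)
  have 1: "xmon \<nu> = M * y ^ k" using sp[of 0 k] set_pair_same[of i \<nu>] assms by simp
  have 2: "xmon (permute_expo (transpose i (i + 1)) \<nu>) = M * x ^ k"
    using sp[of k 0] set_pair_transpose[of i \<nu>] assms by simp
  have "(x - y) * (const tt * (M * x ^ k) + const (tt - 1) * (M * y ^ k + (\<Sum>j\<in>{1..<k}. M * (x ^ j * y ^ (k - j)))))
      = M * ((x - y) * (const tt * x ^ k + const (tt - 1) * y ^ k)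
        + const (tt - 1) * ((x - y) * (\<Sum>j\<in>{1..<k}. x ^ j * y ^ (k - j))))"
    unfolding sum_distrib_left[symmetric] by (simp add: algebra_simps)
  also have "\<dots> = const (1 - tt) * y * (M * y ^ k) + (const tt * x - y) * (M * x ^ k)"
    unfolding interior_sum[OF assms(3)] by (simp add: algebra_simps const_diff)
  finally show "(X i - X (i + 1)) * (const tt * xmon (permute_expo (transpose i (i + 1)) \<nu>)
      + const (tt - 1) * (xmon \<nu> + (\<Sum>j\<in>{1..<k}. xmon (set_pair i (a + j) (a + (k - j)) \<nu>))))
    = const (1 - tt) * X (i + 1) * xmon \<nu> + (const tt * X i - X (i + 1)) * exch i (i + 1) (xmon \<nu>)"
    unfolding exch_xmon 2 sp by (simp only: 1 x_def y_def)
qed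

subsection \<open>An order on compositions\<close>

definition composition :: "nat \<Rightarrow> expo \<Rightarrow> bool" where
  "composition N \<nu> \<longleftrightarrow> keys \<nu> \<subseteq> {1..N}"

definition excess :: "nat \<Rightarrow> nat \<Rightarrow> expo \<Rightarrow> nat" where
  "excess N c \<nu> = (\<Sum>j\<in>{1..N}. lookup \<nu> j - c)"

text \<open>On decreasing rearrangements this is strict dominance order: the sum of the \<open>k\<close> largest entries
  is the minimum over \<open>c\<close> of \<open>k c + excess N c \<nu>\<close>.\<close>

definition dominated :: "nat \<Rightarrow> expo \<Rightarrow> expo \<Rightarrow> bool" where
  "dominated N \<kappa> \<nu> \<longleftrightarrow> excess N 0 \<kappa> = excess N 0 \<nu> \<and> (\<forall>c. excess N c \<kappa> \<le> excess N c \<nu>) \<and>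
     (\<exists>c. excess N c \<kappa> < excess N c \<nu>)"

definition swap_step :: "nat \<Rightarrow> expo \<Rightarrow> expo \<Rightarrow> bool" where
  "swap_step N \<kappa> \<eta> \<longleftrightarrow> (\<exists>a b. 1 \<le> a \<and> a < b \<and> b \<le> N \<and>
     lookup \<eta> b < lookup \<eta> a \<and> \<kappa> = permute_expo (transpose a b) \<eta>)"

text \<open>Dominance compares compositions with different rearrangements, chains of swaps those
  with the same one. Both parts are contained in \<open>expo_prec\<close>, see
  \<open>below_expo_prec\<close>.\<close>

definition below :: "nat \<Rightarrow> expo \<Rightarrow> expo \<Rightarrow> bool" where
  "below N \<kappa> \<eta> \<longleftrightarrow> dominated N \<kappa> \<eta> \<or> (swap_step N)\<^sup>+\<^sup>+ \<kappa> \<eta>"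

lemma excess_permute:
  assumes "p permutes {1..N}"
  shows "excess N c (permute_expo p \<nu>) = excess N c \<nu>"
  unfolding excess_def
  using sum.permute[OF assms, of "\<lambda>j. lookup \<nu> j - c"]
  by (simp add: lookup_permute_expo permutes_inj[OF assms] comp_def)

lemma composition_permute:
  assumes "p permutes {1..N}" "composition N \<nu>"
  shows "composition N (permute_expo p \<nu>)"
  unfolding composition_def
proof
  fix k assume "k \<in> keys (permute_expo p \<nu>)"
  then have "p k \<in> keys \<nu>"
    by (simp add: in_keys_iff lookup_permute_expo permutes_inj[OF assms(1)])
  then show "k \<in> {1..N}"
    using assms permutes_in_image[OF assms(1), of k] by (auto simp: composition_def)
qed

lemma excess_swap_step: "swap_step N \<kappa> \<eta> \<Longrightarrow> excess N c \<kappa> = excess N c \<eta>"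
  unfolding swap_step_def by (auto intro!: excess_permute permutes_swap_id)

lemma excess_swap_steps: "(swap_step N)\<^sup>+\<^sup>+ \<kappa> \<eta> \<Longrightarrow> excess N c \<kappa> = excess N c \<eta>"
  by (induction rule: tranclp_induct) (simp_all add: excess_swap_step)

text \<open>Swaps preserve every excess, so a dominance step absorbs chains of swaps on either
  side.\<close>

lemma below_trans: "below N \<kappa> \<mu> \<Longrightarrow> below N \<mu> \<eta> \<Longrightarrow> below N \<kappa> \<eta>"
  unfolding below_def
proof (elim disjE)
  assume "dominated N \<kappa> \<mu>" "dominated N \<mu> \<eta>"
  then show "dominated N \<kappa> \<eta> \<or> (swap_step N)\<^sup>+\<^sup>+ \<kappa> \<eta>"
    unfolding dominated_def by (metis le_less_trans order_trans)
qed (auto simp: dominated_def excess_swap_steps)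

text \<open>Moving a larger entry right increases this sum. It excludes cycles of swaps and later
  measures progress in \<open>composition_induct\<close>.\<close>

definition weight :: "nat \<Rightarrow> expo \<Rightarrow> nat" where
  "weight N \<nu> = (\<Sum>j\<in>{1..N}. j * lookup \<nu> j)"

lemma sum_split_pair:
  fixes f :: "nat \<Rightarrow> 'a::comm_monoid_add"
  assumes "1 \<le> a" "a < b" "b \<le> N"
  shows "sum f {1..N} = f a + f b + sum f ({1..N} - {a, b})"
proof -
  have "{1..N} = insert a (insert b ({1..N} - {a, b}))" using assms by auto
  then have "sum f {1..N} = sum f (insert a (insert b ({1..N} - {a, b})))" by simp
  also have "\<dots> = f a + f b + sum f ({1..N} - {a, b})" using assms by (simp add: add.assoc)
  finally show ?thesis .
qed

lemma weight_swap_step: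
  assumes "swap_step N \<kappa> \<eta>"
  shows "weight N \<eta> < weight N \<kappa>"
proof -
  from assms obtain a b where ab: "1 \<le> a" "a < b" "b \<le> N"
    and l: "lookup \<eta> b < lookup \<eta> a" and k: "\<kappa> = permute_expo (transpose a b) \<eta>"
    by (auto simp: swap_step_def)
  obtain d where d: "lookup \<eta> a = lookup \<eta> b + d" "0 < d"
    using less_imp_add_positive[OF l] by metis
  have "a * d < b * d" using ab(2) d(2) by (rule mult_strict_right_mono)
  then have "a * lookup \<eta> a + b * lookup \<eta> b
      < a * lookup \<eta> b + b * lookup \<eta> a"
    unfolding d(1) distrib_left by linarith
  moreover have "(\<Sum>j\<in>{1..N} - {a, b}. j * lookup \<kappa> j) = (\<Sum>j\<in>{1..N} - {a, b}. j * lookup \<eta> j)"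
    by (rule sum.cong) (auto simp: k lookup_permute_expo transpose_def)
  ultimately show ?thesis
    unfolding weight_def sum_split_pair[OF ab] by (simp add: k lookup_permute_expo add.assoc)
qed

lemma weight_swap_steps: "(swap_step N)\<^sup>+\<^sup>+ \<kappa> \<eta> \<Longrightarrow> weight N \<eta> < weight N \<kappa>"
  by (induction rule: tranclp_induct) (auto dest: weight_swap_step)

lemma below_irrefl: "\<not> below N \<eta> \<eta>"
  using weight_swap_steps[of N \<eta> \<eta>] by (auto simp: below_def dominated_def)

lemma dominated_permute:
  assumes "p permutes {1..N}" "dominated N \<kappa> \<nu>"
  shows "dominated N (permute_expo p \<kappa>) \<nu>" "dominated N \<kappa> (permute_expo p \<nu>)"
  using assms by (simp_all add: dominated_def excess_permute)

lemma dominated_set_pair: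
  assumes "1 \<le> i" "i < N" "c + d = lookup \<nu> i + lookup \<nu> (i + 1)"
    and "max c d < max (lookup \<nu> i) (lookup \<nu> (i + 1))"
  shows "dominated N (set_pair i c d \<nu>) \<nu>"
proof -
  let ?a = "lookup \<nu> i" and ?b = "lookup \<nu> (i + 1)"
  have i: "1 \<le> i" "i < i + 1" "i + 1 \<le> N" using assms by auto
  have rest: "(\<Sum>j\<in>{1..N} - {i, i + 1}. lookup (set_pair i c d \<nu>) j - e)
      = (\<Sum>j\<in>{1..N} - {i, i + 1}. lookup \<nu> j - e)" for e
    by (rule sum.cong) (auto simp: lookup_set_pair)
  have ex: "excess N e (set_pair i c d \<nu>) + ((?a - e) + (?b - e)) = excess N e \<nu> + ((c - e) + (d - e))" for e
    unfolding excess_def sum_split_pair[OF i] rest by (simp add: lookup_set_pair)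
  have le: "excess N e (set_pair i c d \<nu>) \<le> excess N e \<nu>" for e
  proof -
    have "(c - e) + (d - e) \<le> (?a - e) + (?b - e)"
      using assms(3,4) by (auto simp: max_def split: if_splits)
    then show ?thesis using ex[of e] by linarith
  qed
  moreover have "excess N 0 (set_pair i c d \<nu>) = excess N 0 \<nu>" using ex[of 0] assms(3) by simp
  \<comment> \<open>At the threshold one below the old maximum the new pair contributes nothing,
    while the old pair does.\<close>
  moreover have "excess N (max ?a ?b - 1) (set_pair i c d \<nu>) < excess N (max ?a ?b - 1) \<nu>"
    using ex[of "max ?a ?b - 1"] assms(4) by (auto simp: max_def split: if_splits)
  ultimately show ?thesis unfolding dominated_def by blast
qed

lemma composition_set_pair:
  assumes "composition N \<nu>" "1 \<le> i" "i < N"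
  shows "composition N (set_pair i c d \<nu>)"
  unfolding composition_def
proof
  fix k assume k: "k \<in> keys (set_pair i c d \<nu>)"
  show "k \<in> {1..N}"
  proof (cases "k = i \<or> k = i + 1")
    case False
    then have "k \<in> keys \<nu>" using k by (simp add: in_keys_iff lookup_set_pair)
    then show ?thesis using assms(1) by (auto simp: composition_def)
  qed (use assms in auto)
qed

subsection \<open>Triangularity\<close>

definition below_eq :: "nat \<Rightarrow> expo \<Rightarrow> expo \<Rightarrow> bool" where
  "below_eq N \<kappa> \<eta> \<longleftrightarrow> \<kappa> = \<eta> \<or> below N \<kappa> \<eta>"

lemma below_eq_trans: "below_eq N \<kappa> \<mu> \<Longrightarrow> below_eq N \<mu> \<eta> \<Longrightarrow> below_eq N \<kappa> \<eta>"
  unfolding below_eq_def using below_trans by blast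

lemma below_eq_refl [simp]: "below_eq N \<eta> \<eta>"
  by (simp add: below_eq_def)

lemma below_eq_antisym: "below_eq N \<kappa> \<eta> \<Longrightarrow> below_eq N \<eta> \<kappa> \<Longrightarrow> \<kappa> = \<eta>"
  unfolding below_eq_def using below_trans below_irrefl by blast

lemma dominated_below_eq: "dominated N \<kappa> \<eta> \<Longrightarrow> below_eq N \<kappa> \<eta>"
  by (simp add: below_eq_def below_def)

definition lower_set :: "nat \<Rightarrow> (nat \<Rightarrow> nat) \<Rightarrow> expo \<Rightarrow> expo set" where
  "lower_set N p \<eta> = {permute_expo p \<kappa> | \<kappa>. composition N \<kappa> \<and> below_eq N \<kappa> \<eta>}"

text \<open>The operators making up a Cherednik operator are triangular only after relabelling the
  positions: \<open>A\<close> maps monomials indexed through \<open>p\<close> to monomials indexed through \<open>p'\<close>.\<close>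

definition triangular :: "nat \<Rightarrow> (nat \<Rightarrow> nat) \<Rightarrow> (nat \<Rightarrow> nat) \<Rightarrow> (mpol \<Rightarrow> mpol) \<Rightarrow> (expo \<Rightarrow> qt) \<Rightarrow> bool" where
  "triangular N p p' A \<alpha> \<longleftrightarrow> linear_op A \<and> p permutes {1..N} \<and> p' permutes {1..N} \<and>
     (\<forall>\<kappa>. composition N \<kappa> \<longrightarrow> keys (A (xmon (permute_expo p \<kappa>))) \<subseteq> lower_set N p' \<kappa> \<and>
        lookup (A (xmon (permute_expo p \<kappa>))) (permute_expo p' \<kappa>) = \<alpha> \<kappa>)"

lemma triangularD:
  assumes "triangular N p p' A \<alpha>"
  shows "linear_op A" "p permutes {1..N}" "p' permutes {1..N}"
    and "composition N \<kappa> \<Longrightarrow> keys (A (xmon (permute_expo p \<kappa>))) \<subseteq> lower_set N p' \<kappa>"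
    and "composition N \<kappa> \<Longrightarrow> lookup (A (xmon (permute_expo p \<kappa>))) (permute_expo p' \<kappa>) = \<alpha> \<kappa>"
  using assms unfolding triangular_def by blast+

lemma in_lower_setE:
  assumes "\<mu> \<in> lower_set N p \<eta>"
  obtains \<kappa> where "\<mu> = permute_expo p \<kappa>" "composition N \<kappa>" "below_eq N \<kappa> \<eta>"
  using assms unfolding lower_set_def by blast

lemma in_lower_setI:
  "\<mu> = permute_expo p \<kappa> \<Longrightarrow> composition N \<kappa> \<Longrightarrow> below_eq N \<kappa> \<eta> \<Longrightarrow> \<mu> \<in> lower_set N p \<eta>"
  unfolding lower_set_def by blast

lemma keys_const_mult_subset: "keys (const c * f) \<subseteq> keys f"
  by (auto simp: in_keys_iff lookup_const_mult)

lemma linear_op_sum: "linear_op A \<Longrightarrow> A (sum f I) = (\<Sum>i\<in>I. A (f i))"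
  by (induction I rule: infinite_finite_induct) (simp_all add: linear_op_zero linear_op_add)

lemma linear_op_expand:
  assumes "linear_op A"
  shows "A f = (\<Sum>\<nu>\<in>keys f. const (lookup f \<nu>) * A (xmon \<nu>))"
proof -
  have "A f = A (\<Sum>\<nu>\<in>keys f. const (lookup f \<nu>) * xmon \<nu>)"
    using poly_mapping_sum_single[of f] by (simp flip: single_eq_const_mult)
  then show ?thesis by (simp add: linear_op_sum[OF assms] linear_op_const_mult[OF assms])
qed

lemma inj_permute_expo: "bij p \<Longrightarrow> inj (permute_expo p)"
  by (metis injI permute_expo_inv(2))

text \<open>A term of A f at the relabelled \<eta> would have to come from a monomial that is below
  \<eta> and whose image reaches up to \<eta>; antisymmetry leaves only \<eta> itself.\<close>

lemma triangular_apply: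
  assumes A: "triangular N p p' A \<alpha>" and f: "keys f \<subseteq> lower_set N p \<eta>"
    and \<eta>: "composition N \<eta>"
  shows "keys (A f) \<subseteq> lower_set N p' \<eta>"
    and "lookup (A f) (permute_expo p' \<eta>) = \<alpha> \<eta> * lookup f (permute_expo p \<eta>)"
proof -
  have lin: "linear_op A" and bij: "bij p" "bij p'" using triangularD(1-3)[OF A] permutes_bij by blast+
  note exp = linear_op_expand[OF lin, of f]
  show "keys (A f) \<subseteq> lower_set N p' \<eta>"
  proof
    fix \<mu> assume "\<mu> \<in> keys (A f)"
    then have "\<mu> \<in> (\<Union>\<nu>\<in>keys f. keys (const (lookup f \<nu>) * A (xmon \<nu>)))"
      unfolding exp by (rule subsetD[OF keys_sum])
    then obtain \<nu> where \<nu>: "\<nu> \<in> keys f" "\<mu> \<in> keys (A (xmon \<nu>))"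
      using subsetD[OF keys_const_mult_subset] by blast
    then obtain \<kappa> where \<kappa>: "\<nu> = permute_expo p \<kappa>" "composition N \<kappa>" "below_eq N \<kappa> \<eta>"
      using subsetD[OF f] in_lower_setE by metis
    then have "\<mu> \<in> lower_set N p' \<kappa>" using triangularD(4)[OF A \<kappa>(2)] \<nu>(2) by blast
    then show "\<mu> \<in> lower_set N p' \<eta>"
      using below_eq_trans[OF _ \<kappa>(3)] by (metis in_lower_setE in_lower_setI)
  qed
  have z: "lookup (A (xmon \<nu>)) (permute_expo p' \<eta>) = 0"
    if \<nu>: "\<nu> \<in> keys f" "\<nu> \<noteq> permute_expo p \<eta>" for \<nu>
  proof (rule ccontr)
    assume "lookup (A (xmon \<nu>)) (permute_expo p' \<eta>) \<noteq> 0"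
    then have k: "permute_expo p' \<eta> \<in> keys (A (xmon \<nu>))" by (simp add: in_keys_iff)
    obtain \<kappa> where \<kappa>: "\<nu> = permute_expo p \<kappa>" "composition N \<kappa>" "below_eq N \<kappa> \<eta>"
      using subsetD[OF f \<nu>(1)] in_lower_setE by metis
    then have "permute_expo p' \<eta> \<in> lower_set N p' \<kappa>" using triangularD(4)[OF A \<kappa>(2)] k by blast
    then have "below_eq N \<eta> \<kappa>"
      using injD[OF inj_permute_expo[OF bij(2)]] by (metis in_lower_setE)
    then have "\<kappa> = \<eta>" using \<kappa> below_eq_antisym by blast
    then show False using \<kappa>(1) \<nu>(2) by simp
  qed
  have "lookup (A f) (permute_expo p' \<eta>)
      = (\<Sum>\<nu>\<in>keys f. lookup f \<nu> * lookup (A (xmon \<nu>)) (permute_expo p' \<eta>))"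
    by (subst exp) (simp add: lookup_sum lookup_const_mult)
  also have "\<dots> = (\<Sum>\<nu>\<in>{permute_expo p \<eta>}. lookup f \<nu> * lookup (A (xmon \<nu>)) (permute_expo p' \<eta>))"
    by (rule sum.mono_neutral_cong) (use z in \<open>auto simp: in_keys_iff\<close>)
  also have "\<dots> = \<alpha> \<eta> * lookup f (permute_expo p \<eta>)"
    using triangularD(5)[OF A \<eta>] by (auto simp: mult.commute)
  finally show "lookup (A f) (permute_expo p' \<eta>) = \<alpha> \<eta> * lookup f (permute_expo p \<eta>)" .
qed

lemma triangular_comp:
  assumes A: "triangular N p p' A \<alpha>" and B: "triangular N p' p'' B \<beta>"
  shows "triangular N p p'' (B \<circ> A) (\<lambda>\<kappa>. \<beta> \<kappa> * \<alpha> \<kappa>)"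
proof -
  have "keys (B (A (xmon (permute_expo p \<kappa>)))) \<subseteq> lower_set N p'' \<kappa> \<and>
        lookup (B (A (xmon (permute_expo p \<kappa>)))) (permute_expo p'' \<kappa>) = \<beta> \<kappa> * \<alpha> \<kappa>"
    if "composition N \<kappa>" for \<kappa>
    using triangular_apply[OF B triangularD(4)[OF A that] that] triangularD(5)[OF A that] by simp
  then show ?thesis
    using triangularD(1-3)[OF A] triangularD(1-3)[OF B] unfolding triangular_def by (simp add: linear_op_comp)
qed

lemma triangular_cong: "triangular N p p' A \<alpha> \<Longrightarrow> (\<And>\<kappa>. \<alpha> \<kappa> = \<beta> \<kappa>) \<Longrightarrow> triangular N p p' A \<beta>"
  by (simp add: triangular_def)

lemma triangular_id: "triangular N (id :: nat \<Rightarrow> nat) (id :: nat \<Rightarrow> nat) id (\<lambda>_. 1)"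
  by (auto simp: triangular_def linear_op_def permutes_id lower_set_def)

definition interior :: "nat \<Rightarrow> expo \<Rightarrow> expo set" where
  "interior i \<nu> = {set_pair i c d \<nu> | c d. c + d = lookup \<nu> i + lookup \<nu> (i + 1) \<and>
     max c d < max (lookup \<nu> i) (lookup \<nu> (i + 1))}"

lemma interiorI:
  "c + d = lookup \<nu> i + lookup \<nu> (i + 1) \<Longrightarrow>
     max c d < max (lookup \<nu> i) (lookup \<nu> (i + 1)) \<Longrightarrow> set_pair i c d \<nu> \<in> interior i \<nu>"
  unfolding interior_def by blast

lemma keys_const_mult_sum_xmon:
  assumes "\<And>j. j \<in> J \<Longrightarrow> e j \<in> S"
  shows "keys (const c * (\<Sum>j\<in>J. xmon (e j))) \<subseteq> S"
proof -
  have "keys (\<Sum>j\<in>J. xmon (e j)) \<subseteq> (\<Union>j\<in>J. keys (xmon (e j)))"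
    by (rule keys_sum)
  also have "\<dots> \<subseteq> S" using assms by auto
  finally show ?thesis using keys_const_mult_subset by blast
qed

text \<open>One formula for three cases. For equal entries the transposed exponent is \<nu> itself,
  so the coefficient t covers a = b as well as a < b.\<close>

lemma hecke_xmon_interior:
  fixes \<nu> i
  defines "a \<equiv> lookup \<nu> i" and "b \<equiv> lookup \<nu> (i + 1)"
  obtains r where "keys r \<subseteq> interior i \<nu>"
    "hecke i (xmon \<nu>) = const (if b < a then 1 else tt) * xmon (permute_expo (transpose i (i + 1)) \<nu>)
        + const (if a < b then tt - 1 else 0) * xmon \<nu> + r"
proof -
  consider "a = b" | k where "a = b + k" "1 \<le> k" | k where "b = a + k" "1 \<le> k"
  proof (cases a b rule: linorder_cases)
    case less
    then show thesis using that(3)[of "b - a"] by simp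
  next
    case greater
    then show thesis using that(2)[of "a - b"] by simp
  qed (rule that(1))
  then show thesis
  proof cases
    case 1
    then have "permute_expo (transpose i (i + 1)) \<nu> = \<nu>"
      unfolding a_def b_def by (intro poly_mapping_eqI) (auto simp: lookup_permute_expo transpose_def)
    then show thesis using hecke_xmon_eq[of \<nu> i] 1 by (intro that[of 0]) (auto simp: a_def b_def)
  next
    case 2
    let ?r = "const (1 - tt) * (\<Sum>j\<in>{1..<k}. xmon (set_pair i (b + j) (b + (k - j)) \<nu>))"
    have "keys ?r \<subseteq> interior i \<nu>"
      by (rule keys_const_mult_sum_xmon, rule interiorI) (use 2 in \<open>auto simp: a_def b_def max_def\<close>)
    then show thesis using hecke_xmon_gt[of \<nu> i b k] 2 by (intro that[of ?r]) (auto simp: a_def b_def)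
  next
    case 3
    let ?r = "const (tt - 1) * (\<Sum>j\<in>{1..<k}. xmon (set_pair i (a + j) (a + (k - j)) \<nu>))"
    have "keys ?r \<subseteq> interior i \<nu>"
      by (rule keys_const_mult_sum_xmon, rule interiorI) (use 3 in \<open>auto simp: a_def b_def max_def\<close>)
    then show thesis using hecke_xmon_lt[of \<nu> i a k] 3
      by (intro that[of ?r]) (auto simp: a_def b_def distrib_left add.assoc)
  qed
qed

lemma interior_dominated: "1 \<le> i \<Longrightarrow> i < N \<Longrightarrow> \<mu> \<in> interior i \<nu> \<Longrightarrow> dominated N \<mu> \<nu>"
  unfolding interior_def using dominated_set_pair by blast

lemma interior_composition: "1 \<le> i \<Longrightarrow> i < N \<Longrightarrow> composition N \<nu> \<Longrightarrow> \<mu> \<in> interior i \<nu> \<Longrightarrow> composition N \<mu>"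
  unfolding interior_def using composition_set_pair by blast

lemma interior_not_transpose: "permute_expo (transpose i (i + 1)) \<nu> \<notin> interior i \<nu>"
proof
  assume "permute_expo (transpose i (i + 1)) \<nu> \<in> interior i \<nu>"
  then obtain c d where cd: "permute_expo (transpose i (i + 1)) \<nu> = set_pair i c d \<nu>"
    "max c d < max (lookup \<nu> i) (lookup \<nu> (i + 1))"
    by (auto simp: interior_def)
  have "c = lookup \<nu> (i + 1)" "d = lookup \<nu> i"
    using arg_cong[OF cd(1), of "\<lambda>e. lookup e i"] arg_cong[OF cd(1), of "\<lambda>e. lookup e (i + 1)"]
    by (simp_all add: lookup_set_pair lookup_permute_expo)
  then show False using cd(2) by (simp add: max_def split: if_splits)
qed

text \<open>Dominance is invariant under permuting either argument, so these terms are lower for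
  every labelling before and after the operator.\<close>

lemma interior_lower_set:
  assumes "1 \<le> i" "i < N" "p permutes {1..N}" "p' permutes {1..N}" "composition N \<kappa>"
    "\<mu> \<in> interior i (permute_expo p \<kappa>)"
  shows "\<mu> \<in> lower_set N p' \<kappa>"
proof -
  have "permute_expo (inv p') \<mu> = permute_expo (inv p') \<mu> \<and> composition N (permute_expo (inv p') \<mu>)"
    using assms interior_composition[of i N "permute_expo p \<kappa>" \<mu>] composition_permute permutes_inv by blast
  moreover have "dominated N (permute_expo (inv p') \<mu>) \<kappa>"
  proof -
    have d: "dominated N \<mu> (permute_expo p \<kappa>)" using assms interior_dominated by blast
    have "dominated N \<mu> (permute_expo (inv p) (permute_expo p \<kappa>))"
      using dominated_permute(2)[OF permutes_inv[OF assms(3)] d] .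
    then show ?thesis
      using dominated_permute(1)[OF permutes_inv[OF assms(4)]] permute_expo_inv(2)[OF permutes_bij[OF assms(3)]]
      by simp
  qed
  ultimately show ?thesis
    unfolding lower_set_def using permute_expo_inv(1)[OF permutes_bij[OF assms(4)], of \<mu>] dominated_below_eq
    by (intro CollectI exI[of _ "permute_expo (inv p') \<mu>"]) simp
qed

text \<open>A transposed pair of entries goes down in the order when the larger entry moves right.\<close>

lemma transposed_in_lower_set:
  assumes p: "p permutes {1..N}" and j: "1 \<le> j" "j < N" and c: "composition N \<kappa>"
    and ord: "p (j + 1) < p j \<and> lookup \<kappa> (p j) < lookup \<kappa> (p (j + 1)) \<or>
      p j < p (j + 1) \<and> lookup \<kappa> (p (j + 1)) < lookup \<kappa> (p j)"
  shows "permute_expo p \<kappa> \<in> lower_set N (p \<circ> transpose j (j + 1)) \<kappa>"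
proof -
  have in1: "p j \<in> {1..N}" "p (j + 1) \<in> {1..N}"
    using permutes_in_image[OF p, of j] permutes_in_image[OF p, of "j + 1"] j by auto
  let ?t = "transpose (p j) (p (j + 1))"
  have t: "?t permutes {1..N}" using in1 by (rule permutes_swap_id)
  have "?t \<circ> (p \<circ> transpose j (j + 1)) = p"
    using permutes_inj[OF p] by (auto simp: fun_eq_iff transpose_def dest: injD)
  then have e: "permute_expo p \<kappa> = permute_expo (p \<circ> transpose j (j + 1)) (permute_expo ?t \<kappa>)"
    by (subst permute_expo_comp) (auto intro: inj_compose permutes_inj[OF p])
  have "swap_step N (permute_expo ?t \<kappa>) \<kappa>"
    unfolding swap_step_def using ord in1 by (metis atLeastAtMost_iff transpose_commute)
  then have "below_eq N (permute_expo ?t \<kappa>) \<kappa>" by (auto simp: below_eq_def below_def)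
  then show ?thesis unfolding lower_set_def using e composition_permute[OF t c] by blast
qed

lemma transposed_eq_iff:
  assumes "inj p"
  shows "permute_expo (p \<circ> transpose j (j + 1)) \<kappa> = permute_expo p \<kappa>
    \<longleftrightarrow> lookup \<kappa> (p j) = lookup \<kappa> (p (j + 1))"
proof
  assume "permute_expo (p \<circ> transpose j (j + 1)) \<kappa> = permute_expo p \<kappa>"
  from arg_cong[OF this, of "\<lambda>e. lookup e j"]
  show "lookup \<kappa> (p j) = lookup \<kappa> (p (j + 1))"
    using inj_compose[OF assms inj_transpose] assms by (simp add: lookup_permute_expo)
next
  assume "lookup \<kappa> (p j) = lookup \<kappa> (p (j + 1))"
  then show "permute_expo (p \<circ> transpose j (j + 1)) \<kappa> = permute_expo p \<kappa>"
    using inj_compose[OF assms inj_transpose] assms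
    by (intro poly_mapping_eqI) (simp add: lookup_permute_expo transpose_def)
qed

text \<open>Besides the transposed monomial, T_j leaves the monomial itself when its entry at j is
  the smaller one, and T_j^{-1} when it is the larger one. The condition on p places this remaining
  term below the leading one.\<close>

lemma
  assumes p: "p permutes {1..N}" and j: "1 \<le> j" "j < N"
  defines "p' \<equiv> p \<circ> transpose j (j + 1)"
  shows triangular_hecke: "p (j + 1) < p j \<Longrightarrow> triangular N p p' (hecke j)
      (\<lambda>\<kappa>. if lookup \<kappa> (p (j + 1)) < lookup \<kappa> (p j) then 1 else tt)"
    and triangular_hecke_inv: "p j < p (j + 1) \<Longrightarrow> triangular N p p' (hecke_inv j)
      (\<lambda>\<kappa>. if lookup \<kappa> (p j) < lookup \<kappa> (p (j + 1)) then 1 else inverse tt)"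
proof -
  have p': "p' permutes {1..N}"
    unfolding p'_def using p j by (intro permutes_compose permutes_swap_id) auto
  have inj: "inj p" "inj p'" using p p' permutes_inj by auto
  have own: "permute_expo p' \<kappa> \<in> lower_set N p' \<kappa>" if "composition N \<kappa>" for \<kappa>
    using that by (auto simp: lower_set_def)
  \<comment> \<open>Both operators have the form \<beta> (T_j - \<gamma>): \<beta> = 1 and \<gamma>
    = 0 for T_j, \<beta> = t^{-1} and \<gamma> = t - 1 for its inverse.\<close>
  have main: "keys (const \<beta> * (hecke j (xmon (permute_expo p \<kappa>)) - const \<gamma> * xmon (permute_expo p \<kappa>)))
        \<subseteq> lower_set N p' \<kappa> \<and>
      lookup (const \<beta> * (hecke j (xmon (permute_expo p \<kappa>)) - const \<gamma> * xmon (permute_expo p \<kappa>)))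
        (permute_expo p' \<kappa>) = \<beta> * ((if b < a then 1 else tt) - (if a = b then \<gamma> else 0))"
    if c: "composition N \<kappa>" and ab: "a = lookup \<kappa> (p j)" "b = lookup \<kappa> (p (j + 1))"
      and ok: "(p (j + 1) < p j \<and> \<gamma> = 0) \<or> (p j < p (j + 1) \<and> \<gamma> = tt - 1)" for \<kappa> \<beta> \<gamma> a b
  proof -
    let ?\<nu> = "permute_expo p \<kappa>"
    have l: "lookup ?\<nu> j = a" "lookup ?\<nu> (j + 1) = b"
      using inj by (simp_all add: lookup_permute_expo ab)
    have s: "permute_expo (transpose j (j + 1)) ?\<nu> = permute_expo p' \<kappa>"
      unfolding p'_def by (rule permute_expo_comp) (use inj in auto)
    obtain r where r: "keys r \<subseteq> interior j ?\<nu>"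
      "hecke j (xmon ?\<nu>) = const (if b < a then 1 else tt) * xmon (permute_expo p' \<kappa>)
        + const (if a < b then tt - 1 else 0) * xmon ?\<nu> + r"
      using hecke_xmon_interior[of j ?\<nu>] unfolding l s by blast
    have eqn: "permute_expo p' \<kappa> = ?\<nu> \<longleftrightarrow> a = b"
      unfolding p'_def ab by (rule transposed_eq_iff[OF inj(1)])
    have r0: "lookup r (permute_expo p' \<kappa>) = 0"
      using interior_not_transpose[of j ?\<nu>] r(1) unfolding s by (auto simp: in_keys_iff)
    let ?f = "const \<beta> * (hecke j (xmon ?\<nu>) - const \<gamma> * xmon ?\<nu>)"
    have lk: "lookup ?f \<mu> = \<beta> * ((if b < a then 1 else tt) * (1 when permute_expo p' \<kappa> = \<mu>)
        + ((if a < b then tt - 1 else 0) - \<gamma>) * (1 when ?\<nu> = \<mu>) + lookup r \<mu>)" for \<mu>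
      unfolding r(2) lookup_const_mult lookup_minus lookup_add lookup_single
      by (simp add: algebra_simps)
    have "\<mu> \<in> lower_set N p' \<kappa>" if \<mu>: "\<mu> \<in> keys ?f" for \<mu>
    proof -
      have "\<mu> = permute_expo p' \<kappa> \<or> (\<mu> = ?\<nu> \<and> (if a < b then tt - 1 else 0) \<noteq> \<gamma>) \<or> \<mu> \<in> keys r"
        using \<mu> unfolding in_keys_iff lk by (auto simp: when_def split: if_splits)
      moreover have "?\<nu> \<in> lower_set N p' \<kappa>" if "(if a < b then tt - 1 else 0) \<noteq> \<gamma>"
      proof (cases "a = b")
        case True
        then show ?thesis using eqn own[OF c] by simp
      next
        case False
        then show ?thesis unfolding p'_def
          by (intro transposed_in_lower_set[OF p j c]) (use ok that ab in \<open>auto split: if_splits\<close>)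
      qed
      moreover have "\<mu> \<in> lower_set N p' \<kappa>" if "\<mu> \<in> keys r"
        using interior_lower_set[OF j p p' c] r(1) that by blast
      ultimately show ?thesis using own[OF c] by blast
    qed
    moreover have "lookup ?f (permute_expo p' \<kappa>) = \<beta> * ((if b < a then 1 else tt) - (if a = b then \<gamma> else 0))"
      unfolding lk r0 using eqn by (auto simp: when_def)
    ultimately show ?thesis by blast
  qed
  show "triangular N p p' (hecke j)
      (\<lambda>\<kappa>. if lookup \<kappa> (p (j + 1)) < lookup \<kappa> (p j) then 1 else tt)"
    if "p (j + 1) < p j"
    unfolding triangular_def using main[where \<beta> = 1 and \<gamma> = 0] that p p' by (simp add: linear_op_hecke)
  show "triangular N p p' (hecke_inv j)
      (\<lambda>\<kappa>. if lookup \<kappa> (p j) < lookup \<kappa> (p (j + 1)) then 1 else inverse tt)"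
    if "p j < p (j + 1)"
    unfolding triangular_def
    using main[where \<beta> = "inverse tt" and \<gamma> = "tt - 1"] that p p'
    by (auto simp: linear_op_hecke_inv hecke_inv_def[symmetric])
qed

section \<open>From single factors to the Cherednik operators\<close>

lemma triangular_omega:
  assumes N: "1 \<le> N" and p: "p permutes {1..N}"
  shows "triangular N p (p \<circ> cyclic_shift N) (omega N) (\<lambda>\<kappa>. qq ^ lookup \<kappa> (p 1))"
proof -
  note cs = cyclic_shift_permutes[OF N]
  have "omega N (xmon (permute_expo p \<kappa>)) = const (qq ^ lookup \<kappa> (p 1)) * xmon (permute_expo (p \<circ> cyclic_shift N) \<kappa>)" for \<kappa>
    unfolding omega_xmon[OF N] permute_expo_comp[OF permutes_inj[OF p] permutes_inj[OF cs]]
    by (simp add: lookup_permute_expo permutes_inj[OF p])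
  then have e: "omega N (xmon (permute_expo p \<kappa>)) = single (permute_expo (p \<circ> cyclic_shift N) \<kappa>) (qq ^ lookup \<kappa> (p 1))" for \<kappa>
    by (simp flip: single_eq_const_mult)
  show ?thesis
    unfolding triangular_def e
    using linear_op_omega[OF N] p permutes_compose[OF cs p]
    by (auto intro: in_lower_setI split: if_splits)
qed

text \<open>Labellings met along Y_i: under \<open>pull_left i j\<close> and
  \<open>pull_right i j\<close> place j holds the original entry i, brought there from the right and
  from the left respectively, and the entries passed on the way are displaced by one.\<close>

definition pull_left :: "nat \<Rightarrow> nat \<Rightarrow> nat \<Rightarrow> nat" where
  "pull_left i j k = (if k = j then i else if j < k \<and> k \<le> i then k - 1 else k)"

definition pull_right :: "nat \<Rightarrow> nat \<Rightarrow> nat \<Rightarrow> nat" where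
  "pull_right i j k = (if k = j then i else if i \<le> k \<and> k < j then k + 1 else k)"

lemma triangular_hecke_inv_chain:
  assumes "1 \<le> j" "j \<le> i" "i \<le> N"
  shows "triangular N (id :: nat \<Rightarrow> nat) (pull_left i j) (hecke_inv_chain j i)
    (\<lambda>\<kappa>. \<Prod>l\<in>{j..<i}. if lookup \<kappa> l < lookup \<kappa> i then 1 else inverse tt)"
  using assms(2,1)
proof (induction j rule: inc_induct)
  case base
  have "pull_left i i = id" by (auto simp: pull_left_def fun_eq_iff)
  show ?case unfolding \<open>pull_left i i = id\<close> hecke_chain_refl
    by (rule triangular_cong[OF triangular_id]) simp
next
  case (step j)
  have T: "triangular N (id :: nat \<Rightarrow> nat) (pull_left i (Suc j)) (hecke_inv_chain (Suc j) i)
    (\<lambda>\<kappa>. \<Prod>l\<in>{Suc j..<i}. if lookup \<kappa> l < lookup \<kappa> i then 1 else inverse tt)"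
    by (rule step.IH) (use step in auto)
  have 1: "pull_left i (Suc j) j = j" "pull_left i (Suc j) (j + 1) = i" by (auto simp: pull_left_def)
  have 2: "pull_left i (Suc j) \<circ> transpose j (j + 1) = pull_left i j"
    using step.hyps by (auto simp: pull_left_def fun_eq_iff transpose_def)
  have "triangular N (pull_left i (Suc j)) (pull_left i j) (hecke_inv j)
      (\<lambda>\<kappa>. if lookup \<kappa> j < lookup \<kappa> i then 1 else inverse tt)"
    using triangular_hecke_inv[of "pull_left i (Suc j)" N j] T step assms(3)
    unfolding 1 2 by (simp add: triangular_def)
  from triangular_comp[OF T this] have "triangular N (id :: nat \<Rightarrow> nat) (pull_left i j) (hecke_inv j \<circ> hecke_inv_chain (Suc j) i)
    (\<lambda>\<kappa>. \<Prod>l\<in>{j..<i}. if lookup \<kappa> l < lookup \<kappa> i then 1 else inverse tt)"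
    using step.hyps by (simp add: prod.atLeast_Suc_lessThan)
  moreover have "hecke_inv j \<circ> hecke_inv_chain (Suc j) i = hecke_inv_chain j i"
    using step.hyps by (auto simp: fun_eq_iff hecke_inv_chain_Cons)
  ultimately show ?case by (simp add: id_def)
qed

lemma triangular_hecke_chain:
  assumes "1 \<le> i" "i \<le> j" "j \<le> N" "pull_right i N permutes {1..N}"
  shows "triangular N (pull_right i N) (pull_right i j) (hecke_chain j N)
    (\<lambda>\<kappa>. \<Prod>l\<in>{j<..N}. if lookup \<kappa> i < lookup \<kappa> l then 1 else tt)"
  using assms(3,2)
proof (induction j rule: inc_induct)
  case base
  then show ?case using assms(4) by (auto simp: triangular_def linear_op_def lower_set_def)
next
  case (step j)
  have T: "triangular N (pull_right i N) (pull_right i (Suc j)) (hecke_chain (Suc j) N)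
    (\<lambda>\<kappa>. \<Prod>l\<in>{Suc j<..N}. if lookup \<kappa> i < lookup \<kappa> l then 1 else tt)"
    by (rule step.IH) (use step in auto)
  have 1: "pull_right i (Suc j) j = Suc j" "pull_right i (Suc j) (j + 1) = i"
    using step by (auto simp: pull_right_def)
  have 2: "pull_right i (Suc j) \<circ> transpose j (j + 1) = pull_right i j"
    using step by (auto simp: pull_right_def fun_eq_iff transpose_def)
  have "triangular N (pull_right i (Suc j)) (pull_right i j) (hecke j)
      (\<lambda>\<kappa>. if lookup \<kappa> i < lookup \<kappa> (Suc j) then 1 else tt)"
    using triangular_hecke[of "pull_right i (Suc j)" N j] T step assms(1)
    unfolding 1 2 by (simp add: triangular_def)
  note C = triangular_comp[OF T this]
  have "{j<..N} = insert (Suc j) {Suc j<..N}" using step.hyps by auto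
  then have "triangular N (pull_right i N) (pull_right i j) (hecke j \<circ> hecke_chain (Suc j) N)
    (\<lambda>\<kappa>. \<Prod>l\<in>{j<..N}. if lookup \<kappa> i < lookup \<kappa> l then 1 else tt)"
    using C by simp
  moreover have "hecke j \<circ> hecke_chain (Suc j) N = hecke_chain j N"
    using step.hyps by (auto simp: fun_eq_iff hecke_chain_Cons)
  ultimately show ?case by (simp add: id_def)
qed

definition spectrum :: "nat \<Rightarrow> expo \<Rightarrow> nat \<Rightarrow> qt" where
  "spectrum N \<eta> i = qq ^ lookup \<eta> i * tt powi (1 - int (rank N \<eta> i))"

lemma prod_if_one: "finite A \<Longrightarrow> (\<Prod>l\<in>A. if P l then 1 else c) = (c::'a::comm_monoid_mult) ^ card {l\<in>A. \<not> P l}"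
proof -
  assume "finite A"
  moreover have "A \<inter> - {x. P x} = {l\<in>A. \<not> P l}" by auto
  ultimately show ?thesis by (simp add: prod.If_cases)
qed

text \<open>t^{i-N} removes one t for each place right of i, the first product restores those whose
  entry is not larger, and the second removes one for each place left of i whose entry is not
  smaller. The exponent is thus minus the number of places ranked before i.\<close>

lemma spectrum_factor:
  assumes "1 \<le> i" "i \<le> N"
  shows "tt powi (int i - int N) *
     ((\<Prod>l\<in>{i<..N}. if lookup \<kappa> i < lookup \<kappa> l then 1 else tt) *
      (qq ^ lookup \<kappa> i *
       (\<Prod>l\<in>{1..<i}. if lookup \<kappa> l < lookup \<kappa> i then 1 else inverse tt)))
    = spectrum N \<kappa> i"
proof -
  let ?k = "lookup \<kappa>"
  define A where "A = card {l\<in>{i<..N}. \<not> ?k i < ?k l}"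
  define B where "B = card {l\<in>{1..<i}. \<not> ?k l < ?k i}"
  have "{i<..N} = {l\<in>{i<..N}. \<not> ?k i < ?k l} \<union> {l\<in>{i<..N}. ?k i < ?k l}" by blast
  then have "card {i<..N} = card ({l\<in>{i<..N}. \<not> ?k i < ?k l} \<union> {l\<in>{i<..N}. ?k i < ?k l})"
    by (rule arg_cong)
  also have "\<dots> = A + card {l\<in>{i<..N}. ?k i < ?k l}"
    unfolding A_def by (rule card_Un_disjoint) auto
  finally have c1: "N - i = A + card {l\<in>{i<..N}. ?k i < ?k l}" by simp
  have "rank N \<kappa> i = card ({l\<in>{1..<i}. ?k i < ?k l} \<union> {l\<in>{i<..N}. ?k i < ?k l})
      + card (insert i {l\<in>{1..<i}. ?k l = ?k i})"
    unfolding rank_def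
  proof (intro arg_cong2[where f = "(+)"] arg_cong[where f = card])
    have "j < i \<or> i < j" if "?k i < ?k j" for j using that by (metis less_irrefl linorder_neqE_nat)
    then show "{j \<in> {1..N}. ?k i < ?k j} = {l\<in>{1..<i}. ?k i < ?k l} \<union> {l\<in>{i<..N}. ?k i < ?k l}"
      using assms by auto
  qed (use assms in auto)
  also have "\<dots> = card {l\<in>{1..<i}. ?k i < ?k l} + card {l\<in>{i<..N}. ?k i < ?k l} + card {l\<in>{1..<i}. ?k l = ?k i} + 1"
    by (subst card_Un_disjoint) auto
  finally have r0: "rank N \<kappa> i = card {l\<in>{1..<i}. ?k i < ?k l} + card {l\<in>{i<..N}. ?k i < ?k l}
      + card {l\<in>{1..<i}. ?k l = ?k i} + 1" .
  have "{l\<in>{1..<i}. \<not> ?k l < ?k i} = {l\<in>{1..<i}. ?k i < ?k l} \<union> {l\<in>{1..<i}. ?k l = ?k i}" by auto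
  then have "B = card ({l\<in>{1..<i}. ?k i < ?k l} \<union> {l\<in>{1..<i}. ?k l = ?k i})"
    unfolding B_def by (rule arg_cong)
  also have "\<dots> = card {l\<in>{1..<i}. ?k i < ?k l} + card {l\<in>{1..<i}. ?k l = ?k i}"
    by (rule card_Un_disjoint) auto
  finally have r: "rank N \<kappa> i = B + card {l\<in>{i<..N}. ?k i < ?k l} + 1"
    using r0 by linarith
  have "tt powi (int i - int N) * (tt ^ A * inverse tt ^ B) = tt powi (1 - int (rank N \<kappa> i))"
  proof -
    have "1 - int (rank N \<kappa> i) = (int i - int N) + (int A + - int B)" using r c1 assms by linarith
    then show ?thesis by (simp add: power_int_add power_int_diff power_inverse divide_inverse)
  qed
  then show ?thesis
    unfolding spectrum_def by (simp add: prod_if_one A_def B_def mult.left_commute)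
qed

text \<open>Entry i is carried to the first place by the inverse Hecke operators, to the last by
  \<omega>, and back to place i by the Hecke operators, so the labelling returns to the
  identity.\<close>

lemma triangular_cherednik:
  assumes i: "1 \<le> i" "i \<le> N"
  shows "triangular N (id :: nat \<Rightarrow> nat) (id :: nat \<Rightarrow> nat) (cherednik N i) (\<lambda>\<kappa>. spectrum N \<kappa> i)"
proof -
  have N: "1 \<le> N" using i by simp
  note L = triangular_hecke_inv_chain[OF order_refl i]
  have p1: "pull_left i 1 permutes {1..N}" using L by (simp add: triangular_def)
  have e: "pull_left i 1 \<circ> cyclic_shift N = pull_right i N" "pull_left i 1 1 = i" "pull_right i i = id"
    using i by (auto simp: pull_left_def pull_right_def cyclic_shift_def fun_eq_iff)
  note W = triangular_omega[OF N p1, unfolded e]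
  have R: "triangular N (pull_right i N) (id :: nat \<Rightarrow> nat) (hecke_chain i N)
    (\<lambda>\<kappa>. \<Prod>l\<in>{i<..N}. if lookup \<kappa> i < lookup \<kappa> l then 1 else tt)"
    using triangular_hecke_chain[OF i(1) order_refl i(2)] W unfolding e by (simp add: triangular_def)
  let ?c = "tt powi (int i - int N)"
  have S: "triangular N (id :: nat \<Rightarrow> nat) (id :: nat \<Rightarrow> nat) (\<lambda>f. const ?c * f) (\<lambda>_. ?c)"
    by (auto simp: triangular_def linear_op_def distrib_left mult.left_commute permutes_id
        lower_set_def lookup_const_mult simp flip: single_eq_const_mult)
  have "cherednik N i = (\<lambda>f. const ?c * f) \<circ> (hecke_chain i N \<circ> (omega N \<circ> hecke_inv_chain 1 i))"
    by (auto simp: cherednik_alt fun_eq_iff)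
  then show ?thesis
    using triangular_cong[OF triangular_comp[OF triangular_comp[OF triangular_comp[OF L W] R] S] spectrum_factor[OF i]]
    by simp
qed

subsection \<open>Joint eigenvectors\<close>

lemma qq_tt_power: "qq ^ a * tt ^ b = Fract (monom (monom 1 a) b) 1"
proof -
  have "qq ^ a = Fract [:monom 1 a:] 1"
  proof (induction a)
    case (Suc a)
    have "[:0, 1:] = monom (1::rat) 1" by (simp add: monom_altdef)
    then show ?case using Suc by (simp add: qq_def mult_monom)
  qed (simp add: One_fract_def monom_0 one_pCons)
  moreover have "tt ^ b = Fract (monom 1 b) 1"
  proof (induction b)
    case (Suc b)
    have "[:0, 1:] = monom (1::rat poly) 1" by (simp add: monom_altdef)
    then show ?case using Suc by (simp add: tt_def mult_monom)
  qed (simp add: One_fract_def monom_eq_1)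
  ultimately show ?thesis by (simp add: smult_monom)
qed

lemma qq_tt_power_eq_iff: "qq ^ a * tt ^ b = qq ^ c * tt ^ d \<longleftrightarrow> a = c \<and> b = d"
proof
  assume "qq ^ a * tt ^ b = qq ^ c * tt ^ d"
  then have e: "monom (monom (1::rat) a) b = monom (monom 1 c) d"
    by (simp add: qq_tt_power eq_fract)
  from arg_cong[OF e, of degree] have "b = d" by (simp add: degree_monom_eq)
  with e have "monom (1::rat) a = monom 1 c" by simp
  from arg_cong[OF this, of degree] show "a = c \<and> b = d" using \<open>b = d\<close> by (simp add: degree_monom_eq)
qed simp

lemma qq_tt_powi_eq_iff: "qq ^ a * tt powi b = qq ^ c * tt powi d \<longleftrightarrow> a = c \<and> b = d"
proof
  assume e: "qq ^ a * tt powi b = qq ^ c * tt powi d"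
  \<comment> \<open>A common shift that makes both exponents nonnegative.\<close>
  define K where "K = \<bar>b\<bar> + \<bar>d\<bar>"
  have p: "tt powi b * tt powi K = tt ^ nat (b + K)" "tt powi d * tt powi K = tt ^ nat (d + K)"
  proof -
    have "tt powi x * tt powi K = tt ^ nat (x + K)" if "0 \<le> x + K" for x
      using that power_int_add[of tt x K] by (simp add: power_int_def[of tt "x + K"])
    then show "tt powi b * tt powi K = tt ^ nat (b + K)" "tt powi d * tt powi K = tt ^ nat (d + K)"
      by (simp_all add: K_def)
  qed
  have "qq ^ a * (tt powi b * tt powi K) = qq ^ c * (tt powi d * tt powi K)"
    using e by (simp only: mult.assoc[symmetric])
  then have "a = c \<and> nat (b + K) = nat (d + K)" unfolding p qq_tt_power_eq_iff .
  then show "a = c \<and> b = d" by (auto simp: K_def)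
qed simp

lemma qq_nonzero [simp]: "qq \<noteq> 0"
  by (simp add: qq_def Zero_fract_def eq_fract)

lemma one_minus_nonzero: "a \<noteq> 0 \<or> b \<noteq> 0 \<Longrightarrow> 1 - qq ^ a * tt ^ b \<noteq> 0"
  using qq_tt_power_eq_iff[of 0 0 a b] by auto

text \<open>The reflexive total order on positions whose initial segments \<open>rank\<close>
  counts.\<close>

definition before :: "expo \<Rightarrow> nat \<Rightarrow> nat \<Rightarrow> bool" where
  "before \<eta> j i \<longleftrightarrow> lookup \<eta> i < lookup \<eta> j \<or>
     lookup \<eta> j = lookup \<eta> i \<and> j \<le> i"

lemma rank_before:
  assumes "i \<in> {1..N}"
  shows "rank N \<eta> i = card {j\<in>{1..N}. before \<eta> j i}"
proof -
  let ?A = "{j \<in> {1..N}. lookup \<eta> j > lookup \<eta> i}"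
  let ?B = "{j \<in> {1..i}. lookup \<eta> j = lookup \<eta> i}"
  have "{j\<in>{1..N}. before \<eta> j i} = ?A \<union> ?B" using assms by (auto simp: before_def)
  moreover have "card (?A \<union> ?B) = card ?A + card ?B" by (rule card_Un_disjoint) auto
  ultimately show ?thesis unfolding rank_def by (simp only:)
qed

lemma rank_bounds:
  assumes "i \<in> {1..N}"
  shows "1 \<le> rank N \<eta> i" "rank N \<eta> i \<le> N"
proof -
  have "{j\<in>{1..N}. before \<eta> j i} \<subseteq> {1..N}" by auto
  from card_mono[OF _ this] show "rank N \<eta> i \<le> N" using rank_before[OF assms] by simp
  have "{i} \<subseteq> {j\<in>{1..N}. before \<eta> j i}" using assms by (simp add: before_def)
  then have "card {i} \<le> card {j\<in>{1..N}. before \<eta> j i}" by (rule card_mono[rotated]) simp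
  then show "1 \<le> rank N \<eta> i" unfolding rank_before[OF assms] by simp
qed

lemma before_trans: "before \<eta> k j \<Longrightarrow> before \<eta> j i \<Longrightarrow> before \<eta> k i"
  by (auto simp: before_def)

lemma before_antisym: "before \<eta> i j \<Longrightarrow> before \<eta> j i \<Longrightarrow> i = j"
  by (auto simp: before_def)

lemma before_total: "before \<eta> i j \<or> before \<eta> j i"
  by (auto simp: before_def)

lemma rank_less:
  assumes "i \<in> {1..N}" "j \<in> {1..N}" "before \<eta> j i" "j \<noteq> i"
  shows "rank N \<eta> j < rank N \<eta> i"
  unfolding rank_before[OF assms(1)] rank_before[OF assms(2)]
proof (rule psubset_card_mono)
  have "i \<in> {k\<in>{1..N}. before \<eta> k i}" "i \<notin> {k\<in>{1..N}. before \<eta> k j}"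
    using assms(1) before_antisym[OF assms(3)] assms(4) before_total[of \<eta> i i] by blast+
  then show "{k\<in>{1..N}. before \<eta> k j} \<subset> {k\<in>{1..N}. before \<eta> k i}"
    using before_trans[OF _ assms(3)] by blast
qed simp

lemma rank_permute:
  assumes p: "p permutes {1..N}" and i: "i \<in> {1..N}"
    and "\<And>j. j \<in> {1..N} \<Longrightarrow> before \<kappa> j i \<longleftrightarrow> before \<eta> (p j) (p i)"
  shows "rank N \<kappa> i = rank N \<eta> (p i)"
proof -
  have pi: "p i \<in> {1..N}" using i permutes_in_image[OF p] by blast
  have "p ` {j\<in>{1..N}. before \<kappa> j i} = {j\<in>{1..N}. before \<eta> j (p i)}"
  proof (intro equalityI subsetI)
    fix j assume "j \<in> p ` {j\<in>{1..N}. before \<kappa> j i}"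
    then obtain l where "j = p l" "l \<in> {1..N}" "before \<kappa> l i" by blast
    then show "j \<in> {j\<in>{1..N}. before \<eta> j (p i)}"
      using assms(3)[of l] permutes_in_image[OF p, of l] by simp
  next
    fix j assume j: "j \<in> {j\<in>{1..N}. before \<eta> j (p i)}"
    then obtain l where l: "j = p l" "l \<in> {1..N}" using permutes_image[OF p] by blast
    then show "j \<in> p ` {j\<in>{1..N}. before \<kappa> j i}" using assms(3)[OF l(2)] j by simp
  qed
  then show ?thesis
    unfolding rank_before[OF i] rank_before[OF pi]
    using card_image[OF inj_on_subset[OF permutes_inj[OF p]], of "{j\<in>{1..N}. before \<kappa> j i}"] by simp
qed

text \<open>The power of q in the eigenvalue of Y_i is the entry at i, and the monomials q^a t^b are
  pairwise distinct.\<close>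

lemma spectrum_inject:
  assumes "composition N \<eta>" "composition N \<nu>" "\<And>i. i \<in> {1..N} \<Longrightarrow> spectrum N \<eta> i = spectrum N \<nu> i"
  shows "\<eta> = \<nu>"
proof (rule poly_mapping_eqI)
  fix i
  show "lookup \<eta> i = lookup \<nu> i"
  proof (cases "i \<in> {1..N}")
    case True
    then show ?thesis using assms(3)[OF True] unfolding spectrum_def qq_tt_powi_eq_iff by simp
  next
    case False
    then have "i \<notin> keys \<eta>" "i \<notin> keys \<nu>"
      using assms(1,2) by (auto simp: composition_def)
    then show ?thesis by (simp add: in_keys_iff)
  qed
qed

text \<open>The zero polynomial is allowed, so that the difference of two joint eigenvectors is one
  again.\<close>

definition joint_eigenvector :: "nat \<Rightarrow> expo \<Rightarrow> mpol \<Rightarrow> bool" where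
  "joint_eigenvector N \<eta> E \<longleftrightarrow> (\<forall>\<kappa>\<in>keys E. composition N \<kappa>) \<and>
     (\<forall>i\<in>{1..N}. cherednik N i E = const (spectrum N \<eta> i) * E)"

lemma finite_maximal:
  assumes "finite A" "a \<in> A" and irr: "\<And>x. \<not> R x x" and tr: "\<And>x y z. R x y \<Longrightarrow> R y z \<Longrightarrow> R x z"
  shows "\<exists>m\<in>A. (a = m \<or> R a m) \<and> (\<forall>x\<in>A. \<not> R m x)"
  using assms(2)
proof (induction "card {x\<in>A. R a x}" arbitrary: a rule: less_induct)
  case less
  show ?case
  proof (cases "\<exists>x\<in>A. R a x")
    case True
    then obtain b where b: "b \<in> A" "R a b" by blast
    have "{x\<in>A. R b x} \<subset> {x\<in>A. R a x}" using b tr[OF b(2)] irr[of b] by blast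
    then have "card {x\<in>A. R b x} < card {x\<in>A. R a x}"
      using assms(1) by (intro psubset_card_mono) auto
    from less.hyps[OF this b(1)] obtain m where m: "m \<in> A" "b = m \<or> R b m" "\<forall>x\<in>A. \<not> R m x"
      by blast
    then have "R a m" using b(2) tr[OF b(2)] by blast
    then show ?thesis using m by blast
  qed (use less.prems in blast)
qed

text \<open>By triangularity, a maximal exponent \<open>\<nu>\<close> of a joint eigenvector carries the eigenvalues of
  \<open>\<nu>\<close>; as the spectrum separates compositions, \<open>\<eta>\<close> is the only maximal exponent.\<close>

lemma joint_eigenvector_keys:
  assumes E: "joint_eigenvector N \<eta> E" and \<eta>: "composition N \<eta>" and \<kappa>: "\<kappa> \<in> keys E"
  shows "below_eq N \<kappa> \<eta>" "\<eta> \<in> keys E"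
proof -
  have "\<exists>m\<in>keys E. (\<kappa> = m \<or> below N \<kappa> m) \<and> (\<forall>x\<in>keys E. \<not> below N m x)"
    by (rule finite_maximal[OF finite_keys \<kappa>]) (rule below_irrefl, erule below_trans, assumption)
  then obtain \<nu> where \<nu>: "\<nu> \<in> keys E" "\<kappa> = \<nu> \<or> below N \<kappa> \<nu>"
    and max: "\<And>\<mu>. \<mu> \<in> keys E \<Longrightarrow> \<not> below N \<nu> \<mu>"
    by blast
  have c: "composition N \<mu>" if "\<mu> \<in> keys E" for \<mu>
    using E that by (simp add: joint_eigenvector_def)
  have "spectrum N \<eta> i = spectrum N \<nu> i" if i: "i \<in> {1..N}" for i
  proof -
    have T: "triangular N (id::nat \<Rightarrow> nat) (id::nat \<Rightarrow> nat) (cherednik N i) (\<lambda>\<kappa>. spectrum N \<kappa> i)"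
      using triangular_cherednik i by simp
    note TD = triangularD(4,5)[OF T, unfolded permute_expo_id]
    have z: "lookup (cherednik N i (xmon \<mu>)) \<nu> = 0"
      if "\<mu> \<in> keys E" "\<mu> \<noteq> \<nu>" for \<mu>
    proof (rule ccontr)
      assume "lookup (cherednik N i (xmon \<mu>)) \<nu> \<noteq> 0"
      then have "\<nu> \<in> lower_set N id \<mu>" using TD(1)[OF c[OF that(1)]] by (auto simp: in_keys_iff)
      then have "below_eq N \<nu> \<mu>" by (auto elim!: in_lower_setE)
      then show False using max[OF that(1)] that(2) by (auto simp: below_eq_def)
    qed
    have "spectrum N \<eta> i * lookup E \<nu> = lookup (cherednik N i E) \<nu>"
      using E i by (simp add: joint_eigenvector_def lookup_const_mult)
    also have "\<dots> = (\<Sum>\<mu>\<in>keys E. lookup E \<mu> * lookup (cherednik N i (xmon \<mu>)) \<nu>)"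
      using i by (subst linear_op_expand[OF triangularD(1)[OF T]]) (simp add: lookup_sum lookup_const_mult)
    also have "\<dots> = (\<Sum>\<mu>\<in>{\<nu>}. lookup E \<mu> * lookup (cherednik N i (xmon \<mu>)) \<nu>)"
      by (rule sum.mono_neutral_right) (use \<nu> z in auto)
    also have "\<dots> = spectrum N \<nu> i * lookup E \<nu>" using TD(2)[OF c[OF \<nu>(1)]] by simp
    finally show ?thesis using \<nu>(1) by (simp add: in_keys_iff)
  qed
  then have "\<eta> = \<nu>" using spectrum_inject[OF \<eta> c[OF \<nu>(1)]] by blast
  then show "below_eq N \<kappa> \<eta>" "\<eta> \<in> keys E" using \<nu> by (auto simp: below_eq_def)
qed

text \<open>The difference has no term at \<eta>, but a nonzero joint eigenvector must have
  one.\<close>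

lemma joint_eigenvector_unique:
  assumes E: "joint_eigenvector N \<eta> E" "joint_eigenvector N \<eta> E'" and \<eta>: "composition N \<eta>"
    and lead: "lookup E \<eta> = lookup E' \<eta>" and N: "1 \<le> N"
  shows "E = E'"
proof (rule ccontr)
  assume "E \<noteq> E'"
  then have "keys (E - E') \<noteq> {}" by simp
  then obtain \<kappa> where \<kappa>: "\<kappa> \<in> keys (E - E')" by blast
  have "cherednik N i (E - E') = cherednik N i E - cherednik N i E'" for i
    using linear_op_add[OF linear_op_cherednik[OF N], of i "E - E'" E'] by (simp add: algebra_simps)
  moreover have "keys (E - E') \<subseteq> keys E \<union> keys E'"
    by (auto simp: in_keys_iff lookup_minus)
  ultimately have "joint_eigenvector N \<eta> (E - E')"
    using E by (auto simp: joint_eigenvector_def right_diff_distrib)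
  from joint_eigenvector_keys(2)[OF this \<eta> \<kappa>] show False using lead by (simp add: in_keys_iff lookup_minus)
qed

subsection \<open>Raising and swapping\<close>

definition raise_expo :: "nat \<Rightarrow> expo \<Rightarrow> expo" where
  "raise_expo N \<eta> = permute_expo (cyclic_shift N) \<eta> + single N 1"

lemma lookup_raise_expo:
  assumes "1 \<le> N"
  shows "lookup (raise_expo N \<eta>) k = lookup \<eta> (cyclic_shift N k) + (if k = N then 1 else 0)"
  using permutes_inj[OF cyclic_shift_permutes[OF assms]]
  by (simp add: raise_expo_def lookup_add lookup_permute_expo lookup_single when_def)

text \<open>The first entry wins all ties. At the last place it would lose them, but the added 1
  puts it strictly ahead of the entries it was tied with and still behind those that were
  larger.\<close>

lemma before_raise:
  assumes "i \<in> {1..N}" "j \<in> {1..N}"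
  shows "before (raise_expo N \<eta>) j i \<longleftrightarrow> before \<eta> (cyclic_shift N j) (cyclic_shift N i)"
proof -
  have "1 \<le> N" using assms by simp
  then show ?thesis using assms
    by (auto simp: before_def lookup_raise_expo cyclic_shift_def)
qed

lemma rank_raise: "i \<in> {1..N} \<Longrightarrow> rank N (raise_expo N \<eta>) i = rank N \<eta> (cyclic_shift N i)"
  by (rule rank_permute[OF cyclic_shift_permutes]) (auto simp: before_raise)

lemma spectrum_raise:
  "i \<in> {1..N} \<Longrightarrow> spectrum N (raise_expo N \<eta>) i = (if i = N then qq * spectrum N \<eta> 1 else spectrum N \<eta> (i + 1))"
  by (auto simp: spectrum_def rank_raise lookup_raise_expo) (auto simp: cyclic_shift_def)

lemma raise_op_xmon:
  assumes "1 \<le> N"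
  shows "raise_op N (xmon \<nu>) = const (qq ^ lookup \<nu> 1) * xmon (raise_expo N \<nu>)"
  by (simp add: raise_op_def omega_xmon[OF assms] raise_expo_def xmon_add X_def ac_simps)

lemma linear_op_raise: "1 \<le> N \<Longrightarrow> linear_op (raise_op N)"
  by (simp only: linear_op_def raise_op_def linear_op_add[OF linear_op_omega]
      linear_op_const_mult[OF linear_op_omega]) (simp add: algebra_simps)

lemma inj_raise_expo: "1 \<le> N \<Longrightarrow> raise_expo N \<nu> = raise_expo N \<eta> \<longleftrightarrow> \<nu> = \<eta>"
  unfolding raise_expo_def
  using injD[OF inj_permute_expo[OF permutes_bij[OF cyclic_shift_permutes]]] by auto

lemma composition_raise:
  assumes "1 \<le> N" "composition N \<eta>"
  shows "composition N (raise_expo N \<eta>)"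
  using composition_permute[OF cyclic_shift_permutes[OF assms(1)] assms(2)] assms(1)
    keys_add[of "permute_expo (cyclic_shift N) \<eta>" "single N 1"]
  by (fastforce simp: composition_def raise_expo_def)

lemma lookup_raise_op:
  assumes "1 \<le> N"
  shows "lookup (raise_op N f) (raise_expo N \<eta>) = qq ^ lookup \<eta> 1 * lookup f \<eta>"
proof -
  have "lookup (raise_op N f) (raise_expo N \<eta>)
     = (\<Sum>\<nu>\<in>keys f. if \<nu> = \<eta> then lookup f \<eta> * qq ^ lookup \<eta> 1 else 0)"
    unfolding linear_op_expand[OF linear_op_raise[OF assms], of f] lookup_sum
    by (rule sum.cong) (auto simp: lookup_const_mult raise_op_xmon[OF assms] lookup_single when_def
        inj_raise_expo[OF assms])
  then show ?thesis by (simp add: in_keys_iff)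
qed

lemma keys_raise_op:
  assumes "1 \<le> N" "\<forall>\<kappa>\<in>keys f. composition N \<kappa>"
  shows "\<forall>\<kappa>\<in>keys (raise_op N f). composition N \<kappa>"
proof
  fix \<kappa> assume "\<kappa> \<in> keys (raise_op N f)"
  then have "\<kappa> \<in> (\<Union>\<nu>\<in>keys f. keys (const (lookup f \<nu>) * raise_op N (xmon \<nu>)))"
    by (subst (asm) linear_op_expand[OF linear_op_raise[OF assms(1)]]) (rule subsetD[OF keys_sum])
  then obtain \<nu> where \<nu>: "\<nu> \<in> keys f" "\<kappa> \<in> keys (raise_op N (xmon \<nu>))"
    using subsetD[OF keys_const_mult_subset] by blast
  have "\<kappa> \<in> keys (xmon (raise_expo N \<nu>))"
    using \<nu>(2) unfolding raise_op_xmon[OF assms(1)] by (rule subsetD[OF keys_const_mult_subset])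
  then have "\<kappa> = raise_expo N \<nu>" by simp
  then show "composition N \<kappa>" using composition_raise assms \<nu>(1) by blast
qed

lemma joint_eigenvector_raise:
  assumes N: "1 \<le> N" and E: "joint_eigenvector N \<eta> E"
  shows "joint_eigenvector N (raise_expo N \<eta>) (raise_op N E)"
  unfolding joint_eigenvector_def
proof (intro conjI ballI)
  fix i assume i: "i \<in> {1..N}"
  note lin = linear_op_const_mult[OF linear_op_raise[OF N]]
  show "cherednik N i (raise_op N E) = const (spectrum N (raise_expo N \<eta>) i) * raise_op N E"
  proof (cases "i = N")
    case True
    then show ?thesis using cherednik_raise_last[OF N, of E] E i
      by (simp add: joint_eigenvector_def lin spectrum_raise const_mult mult.assoc)
  next
    case False
    then show ?thesis using cherednik_raise[of i N E] E i
      by (simp add: joint_eigenvector_def lin spectrum_raise)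
  qed
qed (use keys_raise_op[OF N] E in \<open>auto simp: joint_eigenvector_def\<close>)

section \<open>Intertwiners\<close>

lemma keys_hecke:
  assumes "\<mu> \<in> keys (hecke i f)"
  obtains \<nu> where "\<nu> \<in> keys f" "\<mu> \<in> {\<nu>, permute_expo (transpose i (i + 1)) \<nu>} \<union> interior i \<nu>"
proof -
  have "\<mu> \<in> (\<Union>\<nu>\<in>keys f. keys (const (lookup f \<nu>) * hecke i (xmon \<nu>)))"
    using assms by (subst (asm) linear_op_expand[OF linear_op_hecke]) (rule subsetD[OF keys_sum])
  then obtain \<nu> where \<nu>: "\<nu> \<in> keys f" "\<mu> \<in> keys (hecke i (xmon \<nu>))"
    using subsetD[OF keys_const_mult_subset] by blast
  obtain r c d where r: "keys r \<subseteq> interior i \<nu>"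
    "hecke i (xmon \<nu>) = const c * xmon (permute_expo (transpose i (i + 1)) \<nu>) + const d * xmon \<nu> + r"
    using hecke_xmon_interior[of i \<nu>] by metis
  have "\<mu> \<in> {\<nu>, permute_expo (transpose i (i + 1)) \<nu>} \<union> interior i \<nu>"
  proof (rule ccontr)
    assume n: "\<mu> \<notin> {\<nu>, permute_expo (transpose i (i + 1)) \<nu>} \<union> interior i \<nu>"
    then have "lookup r \<mu> = 0" using r(1) by (auto simp: in_keys_iff)
    then have "lookup (hecke i (xmon \<nu>)) \<mu> = 0"
      unfolding r(2) using n by (auto simp: lookup_add lookup_const_mult lookup_single when_def)
    then show False using \<nu>(2) by (simp add: in_keys_iff)
  qed
  then show thesis using that \<nu>(1) by blast
qed

lemma keys_hecke_composition:
  assumes i: "1 \<le> i" "i < N" and f: "\<forall>\<kappa>\<in>keys f. composition N \<kappa>"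
  shows "\<forall>\<kappa>\<in>keys (hecke i f). composition N \<kappa>"
proof
  fix \<kappa> assume "\<kappa> \<in> keys (hecke i f)"
  then obtain \<nu> where \<nu>: "\<nu> \<in> keys f" "\<kappa> \<in> {\<nu>, permute_expo (transpose i (i + 1)) \<nu>} \<union> interior i \<nu>"
    by (rule keys_hecke)
  have "transpose i (i + 1) permutes {1..N}" using i by (intro permutes_swap_id) auto
  then show "composition N \<kappa>"
    using \<nu> f composition_permute interior_composition[OF i] by blast
qed

abbreviation swap_expo :: "nat \<Rightarrow> expo \<Rightarrow> expo" where
  "swap_expo i \<equiv> permute_expo (transpose i (i + 1))"

lemma lookup_swap_expo: "lookup (swap_expo i \<eta>) k = lookup \<eta> (transpose i (i + 1) k)"
  by (simp add: lookup_permute_expo)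

lemma before_swap:
  assumes "lookup \<eta> i \<noteq> lookup \<eta> (i + 1)"
  shows "before (swap_expo i \<eta>) j k \<longleftrightarrow> before \<eta> (transpose i (i + 1) j) (transpose i (i + 1) k)"
  using assms unfolding before_def lookup_swap_expo by (auto simp: transpose_def)

lemma rank_swap:
  assumes "1 \<le> i" "i < N" "lookup \<eta> i \<noteq> lookup \<eta> (i + 1)" "k \<in> {1..N}"
  shows "rank N (swap_expo i \<eta>) k = rank N \<eta> (transpose i (i + 1) k)"
  by (rule rank_permute) (use assms before_swap in \<open>auto intro!: permutes_swap_id\<close>)

lemma spectrum_swap:
  assumes "1 \<le> i" "i < N" "lookup \<eta> i \<noteq> lookup \<eta> (i + 1)" "k \<in> {1..N}"
  shows "spectrum N (swap_expo i \<eta>) k = spectrum N \<eta> (transpose i (i + 1) k)"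
  unfolding spectrum_def rank_swap[OF assms] lookup_swap_expo ..

text \<open>The quotient of the eigenvalues of Y_{i+1} and Y_i in the case of an ascent at i; there
  both subtractions are exact, because the larger entry has the smaller rank.\<close>

definition swap_ratio :: "nat \<Rightarrow> nat \<Rightarrow> expo \<Rightarrow> qt" where
  "swap_ratio N i \<eta> = qq ^ (lookup \<eta> (i + 1) - lookup \<eta> i) *
     tt ^ (rank N \<eta> i - rank N \<eta> (i + 1))"

lemma
  assumes i: "1 \<le> i" "i < N" and lt: "lookup \<eta> i < lookup \<eta> (i + 1)"
  shows spectrum_swap_ratio: "spectrum N \<eta> (i + 1) = swap_ratio N i \<eta> * spectrum N \<eta> i"
    and swap_ratio_neq_1: "1 - swap_ratio N i \<eta> \<noteq> 0"
proof -
  have "rank N \<eta> (i + 1) < rank N \<eta> i"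
    by (rule rank_less) (use i lt in \<open>auto simp: before_def\<close>)
  then have "1 - int (rank N \<eta> (i + 1)) = int (rank N \<eta> i - rank N \<eta> (i + 1)) + (1 - int (rank N \<eta> i))"
    by simp
  then have "tt powi (1 - int (rank N \<eta> (i + 1))) = tt ^ (rank N \<eta> i - rank N \<eta> (i + 1)) * tt powi (1 - int (rank N \<eta> i))"
    by (simp only: power_int_add[OF disjI1[OF tt_nonzero]] power_int_of_nat)
  moreover have "qq ^ lookup \<eta> (i + 1) = qq ^ (lookup \<eta> (i + 1) - lookup \<eta> i) * qq ^ lookup \<eta> i"
    using lt by (simp flip: power_add)
  ultimately show "spectrum N \<eta> (i + 1) = swap_ratio N i \<eta> * spectrum N \<eta> i"
    by (simp add: spectrum_def swap_ratio_def)
  show "1 - swap_ratio N i \<eta> \<noteq> 0" unfolding swap_ratio_def by (rule one_minus_nonzero) (use lt in simp)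
qed

text \<open>The constant c solves c (y' - y) = (t - 1) y for the eigenvalues y, y' of Y_i, Y_{i+1}:
  exactly this makes y' the eigenvalue of Y_i on T_i E + c E.\<close>

definition swap_op :: "nat \<Rightarrow> nat \<Rightarrow> expo \<Rightarrow> mpol \<Rightarrow> mpol" where
  "swap_op N i \<eta> f = hecke i f + const ((1 - tt) / (1 - swap_ratio N i \<eta>)) * f"

lemma joint_eigenvector_swap:
  assumes i: "1 \<le> i" "i < N" and lt: "lookup \<eta> i < lookup \<eta> (i + 1)"
    and E: "joint_eigenvector N \<eta> E"
  shows "joint_eigenvector N (swap_expo i \<eta>) (swap_op N i \<eta> E)"
  unfolding joint_eigenvector_def
proof (intro conjI ballI)
  have N: "1 \<le> N" using i by simp
  note lin = linear_op_add[OF linear_op_cherednik[OF N]] linear_op_const_mult[OF linear_op_cherednik[OF N]]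
  define c where "c = (1 - tt) / (1 - swap_ratio N i \<eta>)"
  define y where "y = spectrum N \<eta> i"
  define y' where "y' = spectrum N \<eta> (i + 1)"
  have "c * (1 - swap_ratio N i \<eta>) = 1 - tt"
    using swap_ratio_neq_1[OF i lt] by (simp add: c_def)
  then have "c * (1 - swap_ratio N i \<eta>) * y = (1 - tt) * y" by simp
  then have cy: "(tt - 1) * y = c * y' - c * y"
    unfolding y'_def spectrum_swap_ratio[OF i lt] y_def[symmetric] by (simp add: algebra_simps)
  fix k assume k: "k \<in> {1..N}"
  have Y: "cherednik N j E = const (spectrum N \<eta> j) * E" if "j \<in> {1..N}" for j
    using E that by (simp add: joint_eigenvector_def)
  have Yi: "cherednik N i E = const y * E" "cherednik N (i + 1) E = const y' * E"
    using Y[of i] Y[of "i + 1"] i by (simp_all add: y_def y'_def)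
  have sp: "spectrum N (swap_expo i \<eta>) k = spectrum N \<eta> (transpose i (i + 1) k)"
    using spectrum_swap i lt k by simp
  consider "k = i" | "k = i + 1" | "k \<noteq> i" "k \<noteq> i + 1" by blast
  then have "cherednik N k (hecke i E + const c * E) = const (spectrum N (swap_expo i \<eta>) k) * (hecke i E + const c * E)"
  proof cases
    case 1
    have "cherednik N k (hecke i E + const c * E) = const y' * hecke i E + (const ((tt - 1) * y) + const (c * y)) * E"
      unfolding 1 lin cherednik_intertwine(1)[OF i] Yi hecke_const_mult
      by (simp only: const_mult distrib_left distrib_right) (simp only: ac_simps)
    moreover have "const ((tt - 1) * y) + const (c * y) = const y' * const c"
      unfolding const_add[symmetric] const_mult[symmetric] cy by (simp add: algebra_simps)
    ultimately show ?thesis unfolding sp unfolding 1 transpose_apply_first y'_def[symmetric]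
      by (simp only: distrib_left mult.assoc)
  next
    case 2
    have "cherednik N k (hecke i E + const c * E) = const y * hecke i E + (const (c * y') - const ((tt - 1) * y)) * E"
      unfolding 2 lin cherednik_intertwine(2)[OF i] Yi hecke_const_mult
      unfolding const_mult by (simp add: algebra_simps)
    moreover have "const (c * y') - const ((tt - 1) * y) = const y * const c"
      unfolding const_diff[symmetric] const_mult[symmetric] cy by (simp add: algebra_simps)
    ultimately show ?thesis unfolding sp unfolding 2 transpose_apply_second y_def[symmetric]
      by (simp only: distrib_left mult.assoc)
  next
    case 3
    then have t: "transpose i (i + 1) k = k" by (simp add: transpose_def)
    have "cherednik N k (hecke i E) = hecke i (cherednik N k E)"
      by (rule cherednik_hecke_commute) (use 3 k i in auto)
    then show ?thesis unfolding sp t lin Y[OF k] hecke_const_mult by (simp add: algebra_simps)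
  qed
  then show "cherednik N k (swap_op N i \<eta> E) = const (spectrum N (swap_expo i \<eta>) k) * swap_op N i \<eta> E"
    by (simp only: swap_op_def c_def)
next
  fix \<kappa> assume "\<kappa> \<in> keys (swap_op N i \<eta> E)"
  then have "\<kappa> \<in> keys (hecke i E) \<or> \<kappa> \<in> keys E"
    unfolding swap_op_def
    using subsetD[OF keys_add] subsetD[OF keys_const_mult_subset[of _ E]] by fast
  moreover have "\<forall>\<kappa>\<in>keys E. composition N \<kappa>" using E by (simp add: joint_eigenvector_def)
  ultimately show "composition N \<kappa>" using keys_hecke_composition[OF i] by blast
qed

text \<open>E has no term at the swapped exponent, which lies strictly above \<eta>. In T_i E it can
  only arise from x^\<eta>, whose transposed monomial carries the coefficient t.\<close>

lemma lookup_swap_op: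
  assumes i: "1 \<le> i" "i < N" and lt: "lookup \<eta> i < lookup \<eta> (i + 1)"
    and E: "joint_eigenvector N \<eta> E" and \<eta>: "composition N \<eta>"
  shows "lookup (swap_op N i \<eta> E) (swap_expo i \<eta>) = tt * lookup E \<eta>"
proof -
  let ?s = "swap_expo i"
  have ss: "?s (?s \<nu>) = \<nu>" for \<nu> by (rule poly_mapping_eqI) (simp only: lookup_swap_expo transpose_involutory)
  have "swap_step N \<eta> (?s \<eta>)"
    unfolding swap_step_def using i lt
    by (intro exI[of _ i] exI[of _ "i + 1"]) (simp add: ss[unfolded Suc_eq_plus1[symmetric]] lookup_permute_expo)
  then have b: "below N \<eta> (?s \<eta>)" by (auto simp: below_def)
  have keys: "below_eq N \<nu> \<eta>" if "\<nu> \<in> keys E" for \<nu>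
    using joint_eigenvector_keys(1)[OF E \<eta> that] .
  have nb: "\<not> below N \<eta> \<nu>" if "\<nu> \<in> keys E" for \<nu>
  proof
    assume "below N \<eta> \<nu>"
    with keys[OF that] have "below N \<eta> \<eta>" unfolding below_eq_def by (auto intro: below_trans)
    then show False using below_irrefl by blast
  qed
  have z: "lookup E (?s \<eta>) = 0"
    using nb[of "?s \<eta>"] b by (auto simp: in_keys_iff)
  have d: "dominated N (?s \<eta>) \<nu> \<Longrightarrow> dominated N \<eta> \<nu>" for \<nu>
    using dominated_permute(1)[of "transpose i (i + 1)" N "?s \<eta>" \<nu>] i unfolding ss
    by (simp add: permutes_swap_id)
  have zero: "lookup (hecke i (xmon \<nu>)) (?s \<eta>) = 0" if \<nu>: "\<nu> \<in> keys E" "\<nu> \<noteq> \<eta>" for \<nu>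
  proof (rule ccontr)
    assume "lookup (hecke i (xmon \<nu>)) (?s \<eta>) \<noteq> 0"
    then have "?s \<eta> \<in> keys (hecke i (xmon \<nu>))" by (simp add: in_keys_iff)
    then have "?s \<eta> \<in> {\<nu>, ?s \<nu>} \<union> interior i \<nu>" by (rule keys_hecke) simp
    moreover have "?s \<eta> \<noteq> \<nu>" using nb[OF \<nu>(1)] b by auto
    moreover have "?s \<eta> \<noteq> ?s \<nu>" using ss[of \<eta>] ss[of \<nu>] \<nu>(2) by auto
    moreover have "?s \<eta> \<notin> interior i \<nu>"
      using interior_dominated[OF i] d nb[OF \<nu>(1)] unfolding below_def by blast
    ultimately show False by blast
  qed
  obtain r where "keys r \<subseteq> interior i \<eta>"
    "hecke i (xmon \<eta>) = const (if lookup \<eta> (i + 1) < lookup \<eta> i then 1 else tt) * xmon (?s \<eta>)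
      + const (if lookup \<eta> i < lookup \<eta> (i + 1) then tt - 1 else 0) * xmon \<eta> + r"
    by (rule hecke_xmon_interior)
  then have r: "keys r \<subseteq> interior i \<eta>"
    "hecke i (xmon \<eta>) = const tt * xmon (?s \<eta>) + const (tt - 1) * xmon \<eta> + r"
    using lt by simp_all
  have "lookup r (?s \<eta>) = 0" using r(1) interior_not_transpose[of i \<eta>] by (auto simp: in_keys_iff)
  moreover have "\<eta> \<noteq> ?s \<eta>" using b below_irrefl[of N \<eta>] by auto
  ultimately have T: "lookup (hecke i (xmon \<eta>)) (?s \<eta>) = tt"
    unfolding r(2) by (simp add: lookup_add lookup_const_mult lookup_single when_def)
  have "lookup (hecke i E) (?s \<eta>)
      = (\<Sum>\<nu>\<in>keys E. lookup E \<nu> * lookup (hecke i (xmon \<nu>)) (?s \<eta>))"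
    by (subst linear_op_expand[OF linear_op_hecke]) (simp only: lookup_sum lookup_const_mult)
  also have "\<dots> = (\<Sum>\<nu>\<in>{\<eta>}. lookup E \<nu> * lookup (hecke i (xmon \<nu>)) (?s \<eta>))"
    by (rule sum.mono_neutral_cong) (use zero in \<open>auto simp: in_keys_iff\<close>)
  finally show ?thesis using T z by (simp add: swap_op_def lookup_add lookup_const_mult)
qed

subsection \<open>Principal specialization of eigenvectors\<close>

lemma ring_map_principal_spec: "ring_map principal_spec"
  and principal_spec_const [simp]: "principal_spec (const c) = c"
  and principal_spec_X [simp]: "principal_spec (X i) = tt ^ (i - 1)"
proof -
  have e: "principal_spec = mpol_subst (\<lambda>c. c) (\<lambda>i. tt ^ (i - 1))"
    by (rule ext) (simp add: principal_spec_def)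
  show "ring_map principal_spec" unfolding e by (rule ring_map_mpol_subst[OF ring_map_id])
  show "principal_spec (const c) = c" unfolding e by (rule mpol_subst_const[OF ring_map_id])
  show "principal_spec (X i) = tt ^ (i - 1)" unfolding e by (rule mpol_subst_X[OF ring_map_id])
qed

lemmas principal_spec_hom [simp] = ring_map_add[OF ring_map_principal_spec]
  ring_map_mult[OF ring_map_principal_spec] ring_map_diff[OF ring_map_principal_spec]
  ring_map_one[OF ring_map_principal_spec] ring_map_zero[OF ring_map_principal_spec]

lemma one_minus_tt_nonzero [simp]: "1 - tt \<noteq> 0" "tt \<noteq> 1"
  using one_minus_nonzero[of 0 1] by auto

text \<open>The coefficient \<open>t x\<^sub>i - x\<^sub>i\<^sub>+\<^sub>1\<close> of the exchange term vanishes at the evaluation point.\<close>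

lemma principal_spec_hecke:
  assumes "1 \<le> i"
  shows "principal_spec (hecke i f) = tt * principal_spec f"
proof -
  obtain k where k: "i = Suc k" using assms by (cases i) auto
  have "tt ^ k * (1 - tt) * principal_spec (hecke i f) = tt ^ k * (1 - tt) * (tt * principal_spec f)"
    using arg_cong[OF hecke_eq[of i f], of principal_spec] unfolding k by (simp add: algebra_simps)
  then show ?thesis by simp
qed

lemma principal_spec_hecke_chain:
  assumes "1 \<le> i" "i \<le> j"
  shows "principal_spec (hecke_chain i j f) = tt ^ (j - i) * principal_spec f"
  using assms(2)
proof (induction j arbitrary: f rule: dec_induct)
  case (step j)
  have "principal_spec (hecke_chain i (j + 1) f) = tt ^ (j - i) * (tt * principal_spec f)"
    using step assms(1) by (simp only: hecke_chain_snoc) (simp add: principal_spec_hecke)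
  then show ?case using step.hyps by (simp add: Suc_diff_le)
qed simp

text \<open>At the evaluation point Y_1 = t^{1-N} T_1 ... T_{N-1} \<omega> has the same value as
  \<omega>, so the eigenvalue equation for Y_1 yields the value of \<omega> E; x_N adds
  t^{N-1}.\<close>

lemma principal_spec_raise:
  assumes N: "1 \<le> N" and E: "joint_eigenvector N \<eta> E"
  shows "principal_spec (raise_op N E) = qq ^ lookup \<eta> 1 * tt ^ (N - rank N \<eta> 1) * principal_spec E"
proof -
  have r: "1 \<le> rank N \<eta> 1" "rank N \<eta> 1 \<le> N" using rank_bounds[of 1 N \<eta>] N by auto
  have "tt powi (1 - int N) * tt ^ (N - 1) = tt powi ((1 - int N) + int (N - 1))"
    by (subst power_int_add) auto
  also have "(1 - int N) + int (N - 1) = 0" using N by simp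
  finally have t: "tt powi (1 - int N) * tt ^ (N - 1) = 1" by simp
  have "spectrum N \<eta> 1 * principal_spec E = principal_spec (cherednik N 1 E)"
    using E N by (simp add: joint_eigenvector_def)
  also have "\<dots> = (tt powi (1 - int N) * tt ^ (N - 1)) * principal_spec (omega N E)"
    using N by (simp add: cherednik_alt principal_spec_hecke_chain del: One_nat_def) 
  finally have w: "principal_spec (omega N E) = spectrum N \<eta> 1 * principal_spec E" unfolding t by simp
  have "tt ^ (N - 1) * tt powi (1 - int (rank N \<eta> 1)) = tt powi (int (N - 1) + (1 - int (rank N \<eta> 1)))"
    by (subst power_int_add) auto
  also have "int (N - 1) + (1 - int (rank N \<eta> 1)) = int (N - rank N \<eta> 1)" using r by simp
  finally show ?thesis unfolding raise_op_def using w by (simp add: spectrum_def ac_simps)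
qed

lemma principal_spec_swap:
  assumes i: "1 \<le> i" "i < N" and lt: "lookup \<eta> i < lookup \<eta> (i + 1)"
  shows "principal_spec (swap_op N i \<eta> f)
    = (1 - tt * swap_ratio N i \<eta>) / (1 - swap_ratio N i \<eta>) * principal_spec f"
  using swap_ratio_neq_1[OF i lt] i
  by (simp add: swap_op_def principal_spec_hecke field_simps)

subsection \<open>Values of the principal specialization\<close>

definition telescope_factor :: "nat \<Rightarrow> nat \<Rightarrow> qt" where
  "telescope_factor r k = (1 - qq ^ k * tt ^ (r + 1)) / (1 - qq ^ k * tt ^ r)"

text \<open>Here j is the position ranked first, the reverse of the naming in the overview. For i <
  j this forces a strictly larger entry at j, so the subtraction of 1 is exact.\<close>

definition pair_length :: "expo \<Rightarrow> nat \<Rightarrow> nat \<Rightarrow> nat" where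
  "pair_length \<eta> j i = lookup \<eta> j - lookup \<eta> i - (if i < j then 1 else 0)"

definition pair_factor :: "nat \<Rightarrow> expo \<Rightarrow> nat \<Rightarrow> nat \<Rightarrow> qt" where
  "pair_factor N \<eta> j i = (if before \<eta> j i \<and> j \<noteq> i
     then \<Prod>k\<in>{1..pair_length \<eta> j i}. telescope_factor (rank N \<eta> i - rank N \<eta> j) k else 1)"

definition pair_product :: "nat \<Rightarrow> expo \<Rightarrow> qt" where
  "pair_product N \<eta> = (\<Prod>j\<in>{1..N}. \<Prod>i\<in>{1..N}. pair_factor N \<eta> j i)"

text \<open>This turns out to be the length of the minimal sorting permutation, see
  \<open>inversions_rank_perm\<close>.\<close>

definition ascents :: "nat \<Rightarrow> expo \<Rightarrow> nat" where
  "ascents N \<eta> = (\<Sum>j\<in>{1..N}. \<Sum>i\<in>{1..N}. of_bool (i < j \<and> lookup \<eta> i < lookup \<eta> j))"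

text \<open>Fitted to the recursion: raising adds N - r(1), from x_N and the eigenvalue of Y_1, and
  a swap removes 1, from normalizing the leading coefficient t.\<close>

definition t_exponent :: "nat \<Rightarrow> expo \<Rightarrow> nat" where
  "t_exponent N \<eta> = (\<Sum>j\<in>{1..N}. (rank N \<eta> j - 1) * lookup \<eta> j) + ascents N \<eta>"

definition spec_value :: "nat \<Rightarrow> expo \<Rightarrow> qt" where
  "spec_value N \<eta> = tt ^ t_exponent N \<eta> * pair_product N \<eta>"

section \<open>Pair products and exponents under raising\<close>

lemma sum_permute2:
  fixes f :: "nat \<Rightarrow> nat \<Rightarrow> 'a::comm_monoid_add"
  assumes "p permutes {1..N}"
  shows "(\<Sum>j\<in>{1..N}. \<Sum>i\<in>{1..N}. f (p j) (p i)) = (\<Sum>j\<in>{1..N}. \<Sum>i\<in>{1..N}. f j i)"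
proof -
  have "(\<Sum>i\<in>{1..N}. f (p j) (p i)) = (\<Sum>i\<in>{1..N}. f (p j) i)" for j
    using sum.permute[OF assms, of "f (p j)"] by (simp add: comp_def)
  then show ?thesis
    using sum.permute[OF assms, of "\<lambda>j. \<Sum>i\<in>{1..N}. f j i"] by (simp add: comp_def)
qed

lemma prod_permute2:
  fixes f :: "nat \<Rightarrow> nat \<Rightarrow> 'a::comm_monoid_mult"
  assumes "p permutes {1..N}"
  shows "(\<Prod>j\<in>{1..N}. \<Prod>i\<in>{1..N}. f (p j) (p i)) = (\<Prod>j\<in>{1..N}. \<Prod>i\<in>{1..N}. f j i)"
proof -
  have "(\<Prod>i\<in>{1..N}. f (p j) (p i)) = (\<Prod>i\<in>{1..N}. f (p j) i)" for j
    using prod.permute[OF assms, of "f (p j)"] by (simp add: comp_def)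
  then show ?thesis
    using prod.permute[OF assms, of "\<lambda>j. \<Prod>i\<in>{1..N}. f j i"] by (simp add: comp_def)
qed

text \<open>Only pairs with the moved entry need care. Ranked first, its entry grows by 1 while its
  place at the end drops one factor; ranked second, the difference shrinks by 1 while a factor is no
  longer dropped.\<close>

lemma pair_factor_raise:
  assumes i: "i \<in> {1..N}" and j: "j \<in> {1..N}"
  shows "pair_factor N (raise_expo N \<eta>) j i = pair_factor N \<eta> (cyclic_shift N j) (cyclic_shift N i)"
proof -
  have N: "1 \<le> N" using i by simp
  have ne: "j \<noteq> i \<longleftrightarrow> cyclic_shift N j \<noteq> cyclic_shift N i"
    using i j by (auto simp: cyclic_shift_def)
  have "pair_length (raise_expo N \<eta>) j i = pair_length \<eta> (cyclic_shift N j) (cyclic_shift N i)"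
    if "before (raise_expo N \<eta>) j i" "j \<noteq> i"
    using that i j N
    by (cases "i = N"; cases "j = N") (auto simp: pair_length_def lookup_raise_expo cyclic_shift_def)
  then show ?thesis
    unfolding pair_factor_def ne[symmetric] before_raise[OF i j, symmetric] rank_raise[OF i] rank_raise[OF j]
    by simp
qed

lemma pair_product_raise: "1 \<le> N \<Longrightarrow> pair_product N (raise_expo N \<eta>) = pair_product N \<eta>"
  unfolding pair_product_def
  using prod_permute2[OF cyclic_shift_permutes, of N "pair_factor N \<eta>"] by (simp add: pair_factor_raise)

text \<open>The first entry has r(1) - 1 larger entries to its right, all of them ascents; raised
  and at the end, it forms ascents with the N - r(1) other entries that were not larger.\<close>

lemma ascents_raise:
  assumes N: "1 \<le> N"
  shows "ascents N (raise_expo N \<eta>) + (rank N \<eta> 1 - 1) = ascents N \<eta> + (N - rank N \<eta> 1)"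
proof -
  let ?c = "cyclic_shift N" and ?e = "lookup \<eta>" and ?r = "lookup (raise_expo N \<eta>)"
  let ?g = "\<lambda>j. of_bool (?e 1 < ?e j) :: nat"
  let ?h = "\<lambda>j. of_bool (j \<noteq> 1 \<and> ?e j \<le> ?e 1) :: nat"
  \<comment> \<open>Lost and gained ascents are added on opposite sides, so that the comparison
    holds pair by pair in the natural numbers.\<close>
  have pt: "of_bool (i < j \<and> ?r i < ?r j) + (if i = N then ?g (?c j) else 0)
      = of_bool (?c i < ?c j \<and> ?e (?c i) < ?e (?c j)) + (if j = N then ?h (?c i) else (0::nat))"
    if "i \<in> {1..N}" "j \<in> {1..N}" for i j
    using that N by (cases "i = N"; cases "j = N") (auto simp: lookup_raise_expo cyclic_shift_def of_bool_def)
  have "(\<Sum>j\<in>{1..N}. \<Sum>i\<in>{1..N}. of_bool (i < j \<and> ?r i < ?r j) + (if i = N then ?g (?c j) else 0))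
     = (\<Sum>j\<in>{1..N}. \<Sum>i\<in>{1..N}. of_bool (?c i < ?c j \<and> ?e (?c i) < ?e (?c j)) + (if j = N then ?h (?c i) else (0::nat)))"
    by (intro sum.cong refl pt)
  moreover have "(\<Sum>j\<in>{1..N}. \<Sum>i\<in>{1..N}. of_bool (i < j \<and> ?r i < ?r j) + (if i = N then ?g (?c j) else 0))
     = ascents N (raise_expo N \<eta>) + (\<Sum>j\<in>{1..N}. ?g (?c j))"
    using N by (simp add: ascents_def sum.distrib)
  moreover have "(\<Sum>j\<in>{1..N}. ?g (?c j)) = (\<Sum>j\<in>{1..N}. ?g j)"
    using sum.permute[OF cyclic_shift_permutes[OF N], of ?g] by (simp add: comp_def)
  moreover have "(\<Sum>j\<in>{1..N}. \<Sum>i\<in>{1..N}. of_bool (?c i < ?c j \<and> ?e (?c i) < ?e (?c j)) + (if j = N then ?h (?c i) else (0::nat)))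
     = (\<Sum>j\<in>{1..N}. \<Sum>i\<in>{1..N}. of_bool (?c i < ?c j \<and> ?e (?c i) < ?e (?c j))) + (\<Sum>i\<in>{1..N}. ?h (?c i))"
  proof -
    have "(\<Sum>j\<in>{1..N}. \<Sum>i\<in>{1..N}. if j = N then ?h (?c i) else (0::nat)) = (\<Sum>j\<in>{1..N}. if j = N then (\<Sum>i\<in>{1..N}. ?h (?c i)) else 0)"
      by (rule sum.cong) auto
    then show ?thesis using N by (simp only: sum.distrib) simp
  qed
  moreover have "(\<Sum>i\<in>{1..N}. ?h (?c i)) = (\<Sum>i\<in>{1..N}. ?h i)"
    using sum.permute[OF cyclic_shift_permutes[OF N], of ?h] by (simp add: comp_def)
  moreover have "(\<Sum>j\<in>{1..N}. \<Sum>i\<in>{1..N}. of_bool (?c i < ?c j \<and> ?e (?c i) < ?e (?c j))) = ascents N \<eta>"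
    unfolding ascents_def by (rule sum_permute2[OF cyclic_shift_permutes[OF N]])
  ultimately have 1: "ascents N (raise_expo N \<eta>) + (\<Sum>j\<in>{1..N}. ?g j) = ascents N \<eta> + (\<Sum>i\<in>{1..N}. ?h i)"
    by simp
  have one: "1 \<in> {1..N}" using N by simp
  have b: "rank N \<eta> 1 = (\<Sum>j\<in>{1..N}. of_bool (before \<eta> j 1))"
    unfolding rank_before[OF one] by (simp add: Int_def)
  have "(\<Sum>j\<in>{1..N}. of_bool (before \<eta> j 1)) = (\<Sum>j\<in>{1..N}. ?g j + (if j = 1 then 1 else 0))"
    by (rule sum.cong) (auto simp: before_def)
  moreover have "(\<Sum>j\<in>{1..N}. if j = 1 then 1 else 0) = (1::nat)" using N by simp
  ultimately have "rank N \<eta> 1 = (\<Sum>j\<in>{1..N}. ?g j) + 1" unfolding b sum.distrib by (simp only:)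
  moreover have "(\<Sum>i\<in>{1..N}. ?h i) + rank N \<eta> 1 = N"
  proof -
    have "(\<Sum>i\<in>{1..N}. ?h i + of_bool (before \<eta> i 1)) = (\<Sum>i\<in>{1..N}. 1)"
      by (rule sum.cong) (auto simp: before_def of_bool_def)
    then have "(\<Sum>i\<in>{1..N}. ?h i) + (\<Sum>j\<in>{1..N}. of_bool (before \<eta> j 1)) = (\<Sum>i\<in>{1..N}. 1)"
      by (simp only: sum.distrib)
    moreover have "(\<Sum>i\<in>{1..N}. 1) = N" by simp
    ultimately show ?thesis unfolding b by (simp only:)
  qed
  ultimately show ?thesis using 1 by linarith
qed

lemma t_exponent_raise:
  assumes N: "1 \<le> N"
  shows "t_exponent N (raise_expo N \<eta>) = t_exponent N \<eta> + (N - rank N \<eta> 1)"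
proof -
  let ?c = "cyclic_shift N"
  have "(\<Sum>j\<in>{1..N}. (rank N (raise_expo N \<eta>) j - 1) * lookup (raise_expo N \<eta>) j)
    = (\<Sum>j\<in>{1..N}. (rank N \<eta> (?c j) - 1) * lookup \<eta> (?c j) + (if j = N then rank N \<eta> 1 - 1 else 0))"
    by (rule sum.cong) (use N in \<open>auto simp: rank_raise lookup_raise_expo cyclic_shift_def\<close>)
  also have "\<dots> = (\<Sum>j\<in>{1..N}. (rank N \<eta> (?c j) - 1) * lookup \<eta> (?c j)) + (rank N \<eta> 1 - 1)"
    using N by (simp add: sum.distrib)
  also have "(\<Sum>j\<in>{1..N}. (rank N \<eta> (?c j) - 1) * lookup \<eta> (?c j)) = (\<Sum>j\<in>{1..N}. (rank N \<eta> j - 1) * lookup \<eta> j)"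
    using sum.permute[OF cyclic_shift_permutes[OF N], of "\<lambda>j. (rank N \<eta> j - 1) * lookup \<eta> j"]
    by (simp add: comp_def)
  finally show ?thesis using ascents_raise[OF N, of \<eta>] by (simp add: t_exponent_def)
qed

lemma spec_value_raise:
  "1 \<le> N \<Longrightarrow> spec_value N (raise_expo N \<eta>) = tt ^ (N - rank N \<eta> 1) * spec_value N \<eta>"
  by (simp add: spec_value_def pair_product_raise t_exponent_raise power_add)

section \<open>Pair products and exponents under a swap\<close>

lemma transpose_less_iff:
  "\<not> (j \<in> {i, i + 1} \<and> k \<in> {i, i + 1}) \<Longrightarrow> transpose i (i + 1) j < transpose i (i + 1) k \<longleftrightarrow> j < (k::nat)"
  by (auto simp: transpose_def)

text \<open>Only the exchanged pair changes: once the larger entry is on the left, the factor for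
  the full difference k is no longer left out, and it is the factor of the intertwiner.\<close>

lemma pair_factor_swap:
  assumes i: "1 \<le> i" "i < N" and lt: "lookup \<eta> i < lookup \<eta> (i + 1)"
    and jk: "j \<in> {1..N}" "k \<in> {1..N}"
  shows "pair_factor N (swap_expo i \<eta>) j k = pair_factor N \<eta> (transpose i (i + 1) j) (transpose i (i + 1) k) *
     (if j = i then (if k = i + 1 then (1 - tt * swap_ratio N i \<eta>) / (1 - swap_ratio N i \<eta>) else 1) else 1)"
proof -
  let ?s = "transpose i (i + 1)"
  have ne: "lookup \<eta> i \<noteq> lookup \<eta> (i + 1)" using lt by simp
  note rk = rank_swap[OF i ne] and bf = before_swap[OF ne]
  have sne: "?s j \<noteq> ?s k \<longleftrightarrow> j \<noteq> k" by (simp only: inj_eq[OF inj_transpose])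
  consider "j = i" "k = i + 1" | "j = i + 1" "k = i" | "j = k" | "\<not> (j \<in> {i, i + 1} \<and> k \<in> {i, i + 1})"
    by auto
  then show ?thesis
  proof cases
    case 1
    define d where "d = lookup \<eta> (i + 1) - lookup \<eta> i"
    define r where "r = rank N \<eta> i - rank N \<eta> (i + 1)"
    have b: "before \<eta> (i + 1) i" using lt by (simp add: before_def)
    have rks: "rank N (swap_expo i \<eta>) i = rank N \<eta> (i + 1)" "rank N (swap_expo i \<eta>) (i + 1) = rank N \<eta> i"
      using rk[of i] rk[of "i + 1"] i unfolding transpose_apply_first transpose_apply_second by simp_all
    have d: "d = (d - 1) + 1" using lt by (simp add: d_def)
    have l: "pair_length (swap_expo i \<eta>) i (i + 1) = d" "pair_length \<eta> (i + 1) i = d - 1"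
      by (simp_all add: pair_length_def lookup_permute_expo d_def)
    have "pair_factor N (swap_expo i \<eta>) i (i + 1) = (\<Prod>k\<in>{1..d}. telescope_factor r k)"
      unfolding pair_factor_def l bf transpose_apply_first transpose_apply_second rks r_def
      using b by simp
    also have "\<dots> = (\<Prod>k\<in>{1..d - 1}. telescope_factor r k) * telescope_factor r d"
      by (subst d, subst (2) d) simp
    also have "(\<Prod>k\<in>{1..d - 1}. telescope_factor r k) = pair_factor N \<eta> (i + 1) i"
      using b unfolding pair_factor_def l by (simp add: r_def)
    also have "telescope_factor r d = (1 - tt * swap_ratio N i \<eta>) / (1 - swap_ratio N i \<eta>)"
      by (simp add: telescope_factor_def swap_ratio_def d_def r_def ac_simps)
    finally show ?thesis using 1 by simp
  next
    case 2
    have "\<not> before \<eta> i (i + 1)" using lt by (simp add: before_def)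
    then show ?thesis using 2 by (simp add: pair_factor_def bf[unfolded Suc_eq_plus1[symmetric]])
  next
    case 3
    then show ?thesis by (auto simp: pair_factor_def)
  next
    case 4
    have "pair_length (swap_expo i \<eta>) j k = pair_length \<eta> (?s j) (?s k)"
      unfolding pair_length_def lookup_swap_expo using transpose_less_iff[of k i j] 4 by auto
    moreover have "(if j = i then (if k = i + 1 then (1 - tt * swap_ratio N i \<eta>) / (1 - swap_ratio N i \<eta>) else 1) else 1) = 1"
      using 4 by auto
    ultimately show ?thesis unfolding pair_factor_def sne bf rk[OF jk(1)] rk[OF jk(2)] by simp
  qed
qed

lemma pair_product_swap:
  assumes i: "1 \<le> i" "i < N" and lt: "lookup \<eta> i < lookup \<eta> (i + 1)"
  shows "pair_product N (swap_expo i \<eta>) = (1 - tt * swap_ratio N i \<eta>) / (1 - swap_ratio N i \<eta>) * pair_product N \<eta>"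
proof -
  let ?R = "(1 - tt * swap_ratio N i \<eta>) / (1 - swap_ratio N i \<eta>)"
  have p: "transpose i (i + 1) permutes {1..N}" using i by (intro permutes_swap_id) auto
  have "pair_product N (swap_expo i \<eta>) = (\<Prod>j\<in>{1..N}. \<Prod>k\<in>{1..N}. pair_factor N \<eta> (transpose i (i + 1) j) (transpose i (i + 1) k) *
     (if j = i then (if k = i + 1 then ?R else 1) else 1))"
    unfolding pair_product_def by (intro prod.cong refl pair_factor_swap[OF i lt])
  also have "\<dots> = (\<Prod>j\<in>{1..N}. \<Prod>k\<in>{1..N}. pair_factor N \<eta> (transpose i (i + 1) j) (transpose i (i + 1) k)) *
     (\<Prod>j\<in>{1..N}. \<Prod>k\<in>{1..N}. if j = i then (if k = i + 1 then ?R else 1) else 1)"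
    by (simp only: prod.distrib)
  also have "(\<Prod>j\<in>{1..N}. \<Prod>k\<in>{1..N}. if j = i then (if k = i + 1 then ?R else 1) else 1)
      = (\<Prod>j\<in>{1..N}. if j = i then (\<Prod>k\<in>{1..N}. if k = i + 1 then ?R else 1) else 1)"
    by (rule prod.cong) auto
  also have "\<dots> = ?R" using i by simp
  finally show ?thesis unfolding prod_permute2[OF p] pair_product_def by (simp add: mult.commute)
qed

lemma ascents_swap:
  assumes i: "1 \<le> i" "i < N" and lt: "lookup \<eta> i < lookup \<eta> (i + 1)"
  shows "ascents N (swap_expo i \<eta>) + 1 = ascents N \<eta>"
proof -
  let ?s = "transpose i (i + 1)" and ?e = "lookup \<eta>"
  have p: "?s permutes {1..N}" using i by (intro permutes_swap_id) auto
  have pt: "of_bool (k < j \<and> ?e (?s k) < ?e (?s j)) + (if j = i then (if k = i + 1 then 1 else 0) else (0::nat))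
    = of_bool (?s k < ?s j \<and> ?e (?s k) < ?e (?s j) )" for j k
  proof -
    consider "j = i" "k = i + 1" | "j = i + 1" "k = i" | "j = k" | "\<not> (j \<in> {i, i + 1} \<and> k \<in> {i, i + 1})"
      by auto
    then show ?thesis
    proof cases
      case 4
      then show ?thesis using transpose_less_iff[of k i j] by auto
    qed (use lt in auto)
  qed
  have "ascents N (swap_expo i \<eta>) + (\<Sum>j\<in>{1..N}. \<Sum>k\<in>{1..N}. if j = i then (if k = i + 1 then 1 else 0) else (0::nat))
     = (\<Sum>j\<in>{1..N}. \<Sum>k\<in>{1..N}. of_bool (?s k < ?s j \<and> ?e (?s k) < ?e (?s j)))"
    unfolding ascents_def lookup_swap_expo sum.distrib[symmetric] pt ..
  also have "\<dots> = ascents N \<eta>"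
    unfolding ascents_def by (rule sum_permute2[OF p])
  also have "(\<Sum>j\<in>{1..N}. \<Sum>k\<in>{1..N}. if j = i then (if k = i + 1 then 1 else 0) else (0::nat))
      = (\<Sum>j\<in>{1..N}. if j = i then (\<Sum>k\<in>{1..N}. if k = i + 1 then 1 else 0) else 0)"
    by (rule sum.cong) auto
  also have "\<dots> = 1" using i by simp
  finally show ?thesis .
qed

lemma t_exponent_swap:
  assumes i: "1 \<le> i" "i < N" and lt: "lookup \<eta> i < lookup \<eta> (i + 1)"
  shows "t_exponent N (swap_expo i \<eta>) + 1 = t_exponent N \<eta>"
proof -
  let ?s = "transpose i (i + 1)"
  have p: "?s permutes {1..N}" using i by (intro permutes_swap_id) auto
  have ne: "lookup \<eta> i \<noteq> lookup \<eta> (i + 1)" using lt by simp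
  have "(\<Sum>j\<in>{1..N}. (rank N (swap_expo i \<eta>) j - 1) * lookup (swap_expo i \<eta>) j)
    = (\<Sum>j\<in>{1..N}. (rank N \<eta> (?s j) - 1) * lookup \<eta> (?s j))"
    by (rule sum.cong) (simp_all only: rank_swap[OF i ne] lookup_swap_expo)
  also have "\<dots> = (\<Sum>j\<in>{1..N}. (rank N \<eta> j - 1) * lookup \<eta> j)"
    using sum.permute[OF p, of "\<lambda>j. (rank N \<eta> j - 1) * lookup \<eta> j"] by (simp add: comp_def)
  finally show ?thesis using ascents_swap[OF i lt] by (simp add: t_exponent_def)
qed

lemma spec_value_swap:
  assumes i: "1 \<le> i" "i < N" and lt: "lookup \<eta> i < lookup \<eta> (i + 1)"
  shows "tt * spec_value N (swap_expo i \<eta>) = (1 - tt * swap_ratio N i \<eta>) / (1 - swap_ratio N i \<eta>) * spec_value N \<eta>"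
  unfolding spec_value_def pair_product_swap[OF i lt] t_exponent_swap[OF i lt, symmetric] by simp

section \<open>Induction from the zero composition\<close>

lemma excess_zero_iff: "composition N \<eta> \<Longrightarrow> excess N 0 \<eta> = 0 \<longleftrightarrow> \<eta> = 0"
proof
  assume c: "composition N \<eta>" and e: "excess N 0 \<eta> = 0"
  show "\<eta> = 0"
  proof (rule poly_mapping_eqI)
    fix k
    show "lookup \<eta> k = lookup 0 k"
    proof (cases "k \<in> {1..N}")
      case True
      then show ?thesis using e by (simp add: excess_def)
    next
      case False
      then have "k \<notin> keys \<eta>" using c by (auto simp: composition_def)
      then show ?thesis by (simp add: in_keys_iff)
    qed
  qed
qed (simp add: excess_def)

text \<open>0 is the only composition below or equal to 0, so triangularity leaves a single
  term.\<close>

lemma joint_eigenvector_one: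
  assumes N: "1 \<le> N"
  shows "joint_eigenvector N 0 1"
proof -
  have c: "composition N 0" by (simp add: composition_def)
  have one: "(1::mpol) = xmon 0" by simp
  have below0: "\<kappa> = 0" if "composition N \<kappa>" "below_eq N \<kappa> 0" for \<kappa>
  proof -
    have "excess N 0 \<kappa> = excess N 0 0"
      using that(2) excess_swap_steps[of N \<kappa> 0 0] by (auto simp: below_eq_def below_def dominated_def)
    then show ?thesis using excess_zero_iff[OF that(1)] by (simp add: excess_def)
  qed
  have "cherednik N i 1 = const (spectrum N 0 i) * 1" if i: "i \<in> {1..N}" for i
  proof -
    have T: "triangular N (id::nat \<Rightarrow> nat) (id::nat \<Rightarrow> nat) (cherednik N i) (\<lambda>\<kappa>. spectrum N \<kappa> i)"
      using triangular_cherednik i by simp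
    note TD = triangularD(4,5)[OF T c, unfolded permute_expo_id]
    have k: "\<kappa> = 0" if "\<kappa> \<in> keys (cherednik N i (xmon 0))" for \<kappa>
      using subsetD[OF TD(1) that] below0 by (elim in_lower_setE) simp
    have "cherednik N i (xmon 0) = single 0 (spectrum N 0 i)"
    proof (rule poly_mapping_eqI)
      fix \<kappa>
      show "lookup (cherednik N i (xmon 0)) \<kappa> = lookup (single 0 (spectrum N 0 i)) \<kappa>"
        using TD(2) k[of \<kappa>] by (cases "\<kappa> = 0") (auto simp: lookup_single when_def in_keys_iff)
    qed
    then show ?thesis by (simp add: const_def)
  qed
  then show ?thesis using c by (simp add: joint_eigenvector_def)
qed

lemma spec_value_zero: "spec_value N 0 = 1"
proof -
  have "pair_factor N 0 j i = 1" for j i by (simp add: pair_factor_def pair_length_def)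
  then show ?thesis by (simp add: spec_value_def t_exponent_def ascents_def pair_product_def)
qed

lemma weight_le: "weight N \<eta> \<le> N * excess N 0 \<eta>"
  unfolding weight_def excess_def sum_distrib_left by (rule sum_mono) simp

text \<open>A positive last entry is undone by lowering it; otherwise the last nonzero entry is
  followed by 0 and can be moved right. The former lowers the degree, the latter keeps it and raises
  \<open>weight\<close>, which is at most N times the degree.\<close>

lemma composition_induct [consumes 2, case_names zero raise swap]:
  assumes N: "1 \<le> N" and c: "composition N \<eta>"
    and zero: "P 0"
    and raise: "\<And>\<eta>. composition N \<eta> \<Longrightarrow> P \<eta> \<Longrightarrow> P (raise_expo N \<eta>)"
    and swap: "\<And>\<eta> i. composition N \<eta> \<Longrightarrow> 1 \<le> i \<Longrightarrow> i < N \<Longrightarrow>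
      lookup \<eta> i < lookup \<eta> (i + 1) \<Longrightarrow> P \<eta> \<Longrightarrow> P (swap_expo i \<eta>)"
  shows "P \<eta>"
  using c
proof (induction \<eta> rule: wf_induct_rule[OF wf_measures[of "[excess N 0, \<lambda>\<eta>. N * excess N 0 \<eta> - weight N \<eta>]"]])
  case (1 \<eta>)
  show ?case
  proof (cases "\<eta> = 0")
    case True
    then show ?thesis using zero by simp
  next
    case nz: False
    show ?thesis
    proof (cases "lookup \<eta> N = 0")
      case False
      define \<mu> where "\<mu> = permute_expo (cyclic_unshift N) (\<eta> - single N 1)"
      have bij: "bij (cyclic_shift N)" using cyclic_shift_permutes[OF N] by (rule permutes_bij)
      have sub: "\<eta> - single N 1 + single N 1 = \<eta>"
        using False by (intro poly_mapping_eqI) (auto simp: lookup_add lookup_minus lookup_single when_def)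
      have r: "raise_expo N \<mu> = \<eta>"
        unfolding raise_expo_def \<mu>_def inv_cyclic_shift[OF N, symmetric] permute_expo_inv(1)[OF bij] sub ..
      have "composition N (\<eta> - single N 1)"
        using 1(2) by (auto simp: composition_def in_keys_iff lookup_minus subset_iff)
      then have c: "composition N \<mu>"
        unfolding \<mu>_def inv_cyclic_shift[OF N, symmetric]
        by (rule composition_permute[OF permutes_inv[OF cyclic_shift_permutes[OF N]]])
      have "excess N 0 \<eta> = excess N 0 \<mu> + 1"
      proof -
        have "excess N 0 \<eta> = excess N 0 (permute_expo (cyclic_shift N) \<mu>) + 1"
          unfolding r[symmetric] using N
          by (simp add: excess_def raise_expo_def lookup_add sum.distrib lookup_single when_def)
        then show ?thesis using excess_permute[OF cyclic_shift_permutes[OF N]] by simp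
      qed
      then have "P \<mu>" by (intro 1(1) c) simp
      then show ?thesis using raise[OF c] r by simp
    next
      case True
      obtain k where k: "k \<in> keys \<eta>" using nz by fastforce
      define i where "i = Max (keys \<eta>)"
      have ik: "i \<in> keys \<eta>" unfolding i_def using k by (intro Max_in) auto
      then have i: "1 \<le> i" "i \<le> N" using 1(2) by (auto simp: composition_def)
      have "i \<noteq> N" using ik True by (auto simp: in_keys_iff)
      then have iN: "i < N" using i by simp
      have "i + 1 \<notin> keys \<eta>"
      proof
        assume "i + 1 \<in> keys \<eta>"
        then have "i + 1 \<le> i" unfolding i_def by (intro Max_ge) auto
        then show False by simp
      qed
      then have lt: "lookup \<eta> (i + 1) < lookup \<eta> i"
        using ik by (simp add: in_keys_iff)
      define \<mu> where "\<mu> = swap_expo i \<eta>"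
      have p: "transpose i (i + 1) permutes {1..N}" using i iN by (intro permutes_swap_id) auto
      have c: "composition N \<mu>" unfolding \<mu>_def by (rule composition_permute[OF p 1(2)])
      have r: "swap_expo i \<mu> = \<eta>" unfolding \<mu>_def
        by (rule poly_mapping_eqI) (simp only: lookup_swap_expo transpose_involutory)
      have "swap_step N \<mu> \<eta>"
        unfolding swap_step_def \<mu>_def using i iN lt by (intro exI[of _ i] exI[of _ "i + 1"]) simp
      then have w: "weight N \<eta> < weight N \<mu>" by (rule weight_swap_step)
      have e: "excess N 0 \<mu> = excess N 0 \<eta>" unfolding \<mu>_def by (rule excess_permute[OF p])
      have "N * excess N 0 \<mu> - weight N \<mu> < N * excess N 0 \<eta> - weight N \<eta>"
        using w e weight_le[of N \<mu>] by simp
      then have "P \<mu>" by (intro 1(1) c) (simp add: e)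
      moreover have "lookup \<mu> i < lookup \<mu> (i + 1)"
        unfolding \<mu>_def lookup_swap_expo using lt by simp
      ultimately show ?thesis using swap[OF c i(1) iN] r by simp
    qed
  qed
qed

theorem joint_eigenvector_exists:
  assumes N: "1 \<le> N" and c: "composition N \<eta>"
  shows "\<exists>E. joint_eigenvector N \<eta> E \<and> lookup E \<eta> = 1 \<and> principal_spec E = spec_value N \<eta>"
  using N c
proof (induction \<eta> rule: composition_induct)
  case zero
  show ?case using joint_eigenvector_one[OF N]
    by (intro exI[of _ 1]) (simp add: spec_value_zero)
next
  case (raise \<eta>)
  then obtain E where E: "joint_eigenvector N \<eta> E" "lookup E \<eta> = 1"
    "principal_spec E = spec_value N \<eta>" by blast
  \<comment> \<open>Restores the leading coefficient 1. The same power of q occurs in the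
    specialized value and is cancelled with it.\<close>
  define b where "b = inverse (qq ^ lookup \<eta> 1)"
  have b: "b * qq ^ lookup \<eta> 1 = 1" by (simp add: b_def)
  have "joint_eigenvector N (raise_expo N \<eta>) (const b * raise_op N E)"
    using joint_eigenvector_raise[OF N E(1)] subsetD[OF keys_const_mult_subset[of b "raise_op N E"]]
    by (simp add: joint_eigenvector_def linear_op_const_mult[OF linear_op_cherednik[OF N]] mult.left_commute)
  moreover have "lookup (const b * raise_op N E) (raise_expo N \<eta>) = 1"
    by (simp add: lookup_const_mult lookup_raise_op[OF N] E(2) b del: One_nat_def)
  moreover have "principal_spec (const b * raise_op N E) = (b * qq ^ lookup \<eta> 1) * (tt ^ (N - rank N \<eta> 1) * spec_value N \<eta>)"
    by (simp add: principal_spec_raise[OF N E(1)] E(3) del: One_nat_def)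
  ultimately show ?case unfolding b spec_value_raise[OF N] by (intro exI[of _ "const b * raise_op N E"]) simp
next
  case (swap \<eta> i)
  then obtain E where E: "joint_eigenvector N \<eta> E" "lookup E \<eta> = 1"
    "principal_spec E = spec_value N \<eta>" by blast
  note i = swap.hyps(2,3) and lt = swap.hyps(4)
  let ?F = "const (inverse tt) * swap_op N i \<eta> E"
  have "joint_eigenvector N (swap_expo i \<eta>) ?F"
    using joint_eigenvector_swap[OF i lt E(1)] subsetD[OF keys_const_mult_subset[of "inverse tt" "swap_op N i \<eta> E"]]
    by (simp add: joint_eigenvector_def linear_op_const_mult[OF linear_op_cherednik[OF N]] mult.left_commute)
  moreover have "lookup ?F (swap_expo i \<eta>) = 1"
    unfolding lookup_const_mult lookup_swap_op[OF i lt E(1) swap.hyps(1)] E(2) by simp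
  moreover have "principal_spec ?F = inverse tt * (tt * spec_value N (swap_expo i \<eta>))"
    unfolding spec_value_swap[OF i lt] by (simp add: principal_spec_swap[OF i lt] E(3))
  ultimately show ?case by (intro exI[of _ ?F]) simp
qed

subsection \<open>Length of permutations\<close>

definition inversions :: "nat \<Rightarrow> (nat \<Rightarrow> nat) \<Rightarrow> nat" where
  "inversions N w = (\<Sum>j\<in>{1..N}. \<Sum>k\<in>{1..N}. of_bool (k < j \<and> w j < w k))"

lemma inversions_ascent:
  assumes i: "1 \<le> i" "i < N" and lt: "w i < w (i + 1)"
  shows "inversions N (w \<circ> transpose i (i + 1)) = inversions N w + 1"
proof -
  let ?s = "transpose i (i + 1)"
  have p: "?s permutes {1..N}" using i by (intro permutes_swap_id) auto
  have pt: "of_bool (k < j \<and> w (?s j) < w (?s k)) = of_bool (?s k < ?s j \<and> w (?s j) < w (?s k))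
     + (if j = i + 1 then (if k = i then 1 else 0) else (0::nat))" for j k
  proof -
    consider "j = i" "k = i + 1" | "j = i + 1" "k = i" | "j = k" | "\<not> (j \<in> {i, i + 1} \<and> k \<in> {i, i + 1})"
      by auto
    then show ?thesis
    proof cases
      case 4
      then show ?thesis using transpose_less_iff[of k i j] by auto
    qed (use lt in auto)
  qed
  have "inversions N (w \<circ> ?s) = (\<Sum>j\<in>{1..N}. \<Sum>k\<in>{1..N}. of_bool (?s k < ?s j \<and> w (?s j) < w (?s k)))
    + (\<Sum>j\<in>{1..N}. \<Sum>k\<in>{1..N}. if j = i + 1 then (if k = i then 1 else 0) else (0::nat))"
    unfolding inversions_def comp_apply pt sum.distrib ..
  also have "(\<Sum>j\<in>{1..N}. \<Sum>k\<in>{1..N}. of_bool (?s k < ?s j \<and> w (?s j) < w (?s k))) = inversions N w"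
    unfolding inversions_def by (rule sum_permute2[OF p])
  also have "(\<Sum>j\<in>{1..N}. \<Sum>k\<in>{1..N}. if j = i + 1 then (if k = i then 1 else 0) else (0::nat))
      = (\<Sum>j\<in>{1..N}. if j = i + 1 then (\<Sum>k\<in>{1..N}. if k = i then 1 else 0) else 0)"
    by (rule sum.cong) auto
  also have "\<dots> = 1" using i by simp
  finally show ?thesis .
qed

lemma inversions_descent:
  assumes i: "1 \<le> i" "i < N" and lt: "w (i + 1) < w i"
  shows "inversions N w = inversions N (w \<circ> transpose i (i + 1)) + 1"
proof -
  let ?w = "w \<circ> transpose i (i + 1)"
  have e: "?w \<circ> transpose i (i + 1) = w" by (auto simp: fun_eq_iff)
  have "?w i < ?w (i + 1)" using lt by simp
  from inversions_ascent[where w = ?w, OF i this] show ?thesis unfolding e .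
qed

lemma inversions_adjacent_le:
  assumes i: "1 \<le> i" "i < N" and w: "inj w"
  shows "inversions N (w \<circ> transpose i (i + 1)) \<le> inversions N w + 1"
    "inversions N w \<le> inversions N (w \<circ> transpose i (i + 1)) + 1"
proof -
  have "w i \<noteq> w (i + 1)" using injD[OF w, of i "i + 1"] by auto
  then have "w i < w (i + 1) \<or> w (i + 1) < w i" by auto
  then show "inversions N (w \<circ> transpose i (i + 1)) \<le> inversions N w + 1"
    "inversions N w \<le> inversions N (w \<circ> transpose i (i + 1)) + 1"
    using inversions_ascent[OF i, of w] inversions_descent[OF i, of w] by auto
qed

text \<open>Write the transposition of a and b as s u s, with s exchanging a, a + 1 and u exchanging
  a + 1, b. By induction u gains at least one inversion; if the first s loses one, the last gains
  one, and if the first gains one, the last loses at most one.\<close>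

lemma inversions_transpose:
  assumes "1 \<le> a" "a < b" "b \<le> N" "inj w" "w a < w b"
  shows "inversions N w < inversions N (w \<circ> transpose a b)"
  using assms
proof (induction "b - a" arbitrary: a w rule: less_induct)
  case less
  show ?case
  proof (cases "b = a + 1")
    case True
    then show ?thesis using inversions_ascent[of a N w] less.prems by simp
  next
    case False
    let ?s = "transpose a (a + 1)"
    have ab: "a + 1 < b" and i: "1 \<le> a" "a < N" using False less.prems by auto
    have e: "(w \<circ> ?s \<circ> transpose (a + 1) b) \<circ> ?s = w \<circ> transpose a b"
      using ab by (auto simp: fun_eq_iff transpose_def)
    have ij: "inj (w \<circ> ?s)" "inj (w \<circ> ?s \<circ> transpose (a + 1) b)" using less.prems(4)
      by (auto intro!: inj_compose)
    have v: "(w \<circ> ?s) (a + 1) < (w \<circ> ?s) b" using less.prems(5) ab by (simp add: transpose_def)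
    have IH: "inversions N (w \<circ> ?s) < inversions N (w \<circ> ?s \<circ> transpose (a + 1) b)"
      by (rule less.hyps) (use ab less.prems ij v in auto)
    have last: "inversions N (w \<circ> ?s \<circ> transpose (a + 1) b) \<le> inversions N (w \<circ> transpose a b) + 1"
      using inversions_adjacent_le(2)[OF i ij(2)] unfolding e .
    have "w a \<noteq> w (a + 1)" using injD[OF less.prems(4), of a "a + 1"] by auto
    then consider "w a < w (a + 1)" | "w (a + 1) < w a" by linarith
    then show ?thesis
    proof cases
      case 1
      then show ?thesis using inversions_ascent[OF i, of w] IH last by simp
    next
      case 2
      let ?u = "w \<circ> ?s \<circ> transpose (a + 1) b"
      have "?u a < ?u (a + 1)" using 2 ab less.prems(5) by (simp add: transpose_def)
      from inversions_ascent[where w = ?u, OF i this] have "inversions N (w \<circ> transpose a b) = inversions N ?u + 1"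
        unfolding e .
      then show ?thesis using inversions_descent[OF i 2] IH by simp
    qed
  qed
qed

lemma inversions_id: "inversions N id = 0" "inversions N (\<lambda>a. a) = 0"
  by (auto simp: inversions_def intro!: sum.neutral)

lemma word_perm_Nil [simp]: "word_perm [] = id"
  by (simp add: word_perm_def)

lemma word_perm_snoc: "word_perm (is @ [i]) = word_perm is \<circ> transpose i (i + 1)"
  by (simp add: word_perm_def compose_append)

lemma word_perm_permutes: "set is \<subseteq> {1..<N} \<Longrightarrow> word_perm is permutes {1..N}"
proof (induction "is" rule: rev_induct)
  case (snoc i "is")
  then have "transpose i (i + 1) permutes {1..N}" by (intro permutes_swap_id) auto
  then show ?case unfolding word_perm_snoc using snoc by (intro permutes_compose) auto
qed (simp add: permutes_id)

lemma inversions_word_perm: "set is \<subseteq> {1..<N} \<Longrightarrow> inversions N (word_perm is) \<le> length is"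
proof (induction "is" rule: rev_induct)
  case Nil
  show ?case by (simp add: inversions_id)
next
  case (snoc i "is")
  have "inj (word_perm is)" using snoc.prems word_perm_permutes[of "is" N] permutes_inj by auto
  moreover have "1 \<le> i" "i < N" using snoc.prems by auto
  ultimately have "inversions N (word_perm (is @ [i])) \<le> inversions N (word_perm is) + 1"
    unfolding word_perm_snoc by (intro inversions_adjacent_le(1))
  then show ?case using snoc by simp
qed

lemma permutes_no_descent:
  fixes w :: "nat \<Rightarrow> nat"
  assumes w: "w permutes {1..N}" and asc: "\<And>i. 1 \<le> i \<Longrightarrow> i < N \<Longrightarrow> w i < w (i + 1)"
  shows "w = id"
proof (rule permutes_natset_ge[OF w])
  have "1 \<le> i \<Longrightarrow> i \<le> N \<Longrightarrow> i \<le> w i" for i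
  proof (induction i rule: nat_induct_at_least)
    case base
    then show ?case using permutes_in_image[OF w, of 1] by simp
  next
    case (Suc i)
    then show ?case using asc[of i] by simp
  qed
  then show "\<forall>i\<in>{1..N}. i \<le> w i" by simp
qed

text \<open>Splitting off a descent at the right end of the word lowers the inversions by one; a
  permutation without descents is the identity.\<close>

lemma reduced_word_exists_aux:
  assumes "w permutes {1..N}"
  shows "\<exists>is. set is \<subseteq> {1..<N} \<and> word_perm is = w \<and> length is = inversions N w"
  using assms
proof (induction "inversions N w" arbitrary: w rule: less_induct)
  case less
  show ?case
  proof (cases "\<exists>i. 1 \<le> i \<and> i < N \<and> w (i + 1) < w i")
    case True
    then obtain i where i: "1 \<le> i" "i < N" "w (i + 1) < w i" by blast
    let ?s = "transpose i (i + 1)"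
    have p: "?s permutes {1..N}" using i by (intro permutes_swap_id) auto
    note d = inversions_descent[OF i]
    have "\<exists>is. set is \<subseteq> {1..<N} \<and> word_perm is = w \<circ> ?s \<and> length is = inversions N (w \<circ> ?s)"
      by (rule less.hyps) (use d permutes_compose[OF p less.prems] in auto)
    then obtain js where js: "set js \<subseteq> {1..<N}" "word_perm js = w \<circ> ?s" "length js = inversions N (w \<circ> ?s)"
      by blast
    have "word_perm (js @ [i]) = w" unfolding word_perm_snoc js(2) by (auto simp: fun_eq_iff)
    then show ?thesis using js d i by (intro exI[of _ "js @ [i]"]) auto
  next
    case False
    have "w i < w (i + 1)" if "1 \<le> i" "i < N" for i
    proof -
      have "w i \<noteq> w (i + 1)" using injD[OF permutes_inj[OF less.prems], of i "i + 1"] by auto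
      moreover have "\<not> w (i + 1) < w i" using False that by blast
      ultimately show ?thesis by linarith
    qed
    then have "w = id" by (rule permutes_no_descent[OF less.prems])
    then show ?thesis by (intro exI[of _ "[]"]) (simp add: inversions_id)
  qed
qed

lemma perm_length_inversions:
  assumes "w permutes {1..N}"
  shows "perm_length N w = inversions N w"
  unfolding perm_length_def
proof (rule Least_equality)
  show "\<exists>is. set is \<subseteq> {1..<N} \<and> word_perm is = w \<and> length is = inversions N w"
    by (rule reduced_word_exists_aux[OF assms])
next
  fix r assume "\<exists>is. set is \<subseteq> {1..<N} \<and> word_perm is = w \<and> length is = r"
  then show "inversions N w \<le> r" using inversions_word_perm by blast
qed

lemma reduced_word_exists: "w permutes {1..N} \<Longrightarrow> \<exists>is. reduced_word N w is"
  using reduced_word_exists_aux[of w N] by (simp add: reduced_word_def perm_length_inversions)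

subsection \<open>Minimal permutations and the Bruhat order\<close>

text \<open>Extended by the identity outside 1..N to satisfy \<open>permutes\<close>. Its inverse is
  the minimal sorting permutation, see \<open>min_perm_eq\<close>.\<close>

definition rank_perm :: "nat \<Rightarrow> expo \<Rightarrow> nat \<Rightarrow> nat" where
  "rank_perm N \<eta> j = (if j \<in> {1..N} then rank N \<eta> j else j)"

lemma rank_less_iff:
  assumes "i \<in> {1..N}" "j \<in> {1..N}"
  shows "rank N \<eta> j < rank N \<eta> i \<longleftrightarrow> before \<eta> j i \<and> j \<noteq> i"
proof
  assume l: "rank N \<eta> j < rank N \<eta> i"
  show "before \<eta> j i \<and> j \<noteq> i"
  proof (rule ccontr)
    assume "\<not> (before \<eta> j i \<and> j \<noteq> i)"
    then have "i = j \<or> before \<eta> i j \<and> i \<noteq> j" using before_total[of \<eta> i j] by auto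
    then show False using rank_less[of j N i \<eta>] assms l by auto
  qed
next
  assume "before \<eta> j i \<and> j \<noteq> i"
  then show "rank N \<eta> j < rank N \<eta> i" using rank_less[OF assms] by simp
qed

lemma rank_perm_permutes: "rank_perm N \<eta> permutes {1..N}"
proof (rule bij_imp_permutes)
  have "inj_on (rank_perm N \<eta>) {1..N}"
  proof (rule inj_onI)
    fix i j assume ij: "i \<in> {1..N}" "j \<in> {1..N}" "rank_perm N \<eta> i = rank_perm N \<eta> j"
    then have "\<not> rank N \<eta> i < rank N \<eta> j" "\<not> rank N \<eta> j < rank N \<eta> i" by (simp_all add: rank_perm_def)
    then show "i = j" using rank_less_iff[of i N j \<eta>] rank_less_iff[of j N i \<eta>] ij before_total[of \<eta> i j]
      by auto
  qed
  moreover have "rank_perm N \<eta> ` {1..N} \<subseteq> {1..N}"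
    using rank_bounds by (auto simp: rank_perm_def)
  ultimately show "bij_betw (rank_perm N \<eta>) {1..N} {1..N}"
    by (simp add: bij_betw_def endo_inj_surj)
qed (simp only: rank_perm_def if_False)

lemma rank_perm_less_iff:
  "i \<in> {1..N} \<Longrightarrow> j \<in> {1..N} \<Longrightarrow> rank_perm N \<eta> j < rank_perm N \<eta> i \<longleftrightarrow> before \<eta> j i \<and> j \<noteq> i"
  using rank_less_iff[of i N j \<eta>] by (simp add: rank_perm_def)

section \<open>Decreasing rearrangements and sorting permutations\<close>

lemma mset_upt_Suc: "mset [1..<N + 1] = mset_set {1..N}"
  by (simp add: atLeastLessThanSuc_atLeastAtMost del: upt_Suc)

lemma image_mset_permutes:
  assumes "p permutes {1..N}"
  shows "image_mset p (mset_set {1..N}) = mset_set {1..N}"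
  using image_mset_mset_set[OF inj_on_subset[OF permutes_inj[OF assms] subset_UNIV], of "{1..N}"]
  unfolding permutes_image[OF assms] .

lemma mset_decr_rearr: "mset (decr_rearr N \<eta>) = image_mset (lookup \<eta>) (mset_set {1..N})"
  unfolding decr_rearr_def mset_rev mset_sort mset_map mset_upt_Suc ..

lemma decr_rearr_eqI:
  assumes "mset xs = image_mset (lookup \<eta>) (mset_set {1..N})" "sorted (rev xs)"
  shows "decr_rearr N \<eta> = xs"
proof -
  have "sort (map (lookup \<eta>) [1..<N + 1]) = rev xs"
  proof (rule properties_for_sort)
    show "mset (rev xs) = mset (map (lookup \<eta>) [1..<N + 1])"
      unfolding mset_rev assms(1) mset_map mset_upt_Suc ..
  qed (rule assms(2))
  then show ?thesis unfolding decr_rearr_def by (simp only: rev_rev_ident)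
qed

lemma decr_rearr_eq_map:
  assumes w: "w permutes {1..N}"
    and dec: "\<And>i l. 1 \<le> i \<Longrightarrow> i < l \<Longrightarrow> l \<le> N \<Longrightarrow> lookup \<eta> (w l) \<le> lookup \<eta> (w i)"
  shows "decr_rearr N \<eta> = map (\<lambda>i. lookup \<eta> (w i)) [1..<N + 1]"
proof -
  let ?L = "map (\<lambda>i. lookup \<eta> (w i)) [1..<N + 1]"
  have "mset ?L = image_mset (lookup \<eta>) (image_mset w (mset_set {1..N}))"
    unfolding mset_map mset_upt_Suc multiset.map_comp comp_def ..
  then have "mset ?L = image_mset (lookup \<eta>) (mset_set {1..N})"
    unfolding image_mset_permutes[OF w] .
  moreover have "sorted (rev ?L)"
    unfolding sorted_rev_iff_nth_mono
  proof (intro allI impI)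
    fix i j assume ij: "i \<le> j" "j < length ?L"
    then have n: "?L ! j = lookup \<eta> (w (1 + j))" "?L ! i = lookup \<eta> (w (1 + i))"
      by (simp_all add: nth_upt del: upt_Suc)
    have "j < N" using ij(2) by (simp del: upt_Suc)
    then show "?L ! j \<le> ?L ! i" unfolding n using dec[of "1 + i" "1 + j"] ij(1) by (cases "i = j") auto
  qed
  ultimately show ?thesis by (rule decr_rearr_eqI)
qed

lemma decr_rearr_rank_perm:
  "decr_rearr N \<eta> = map (\<lambda>i. lookup \<eta> (inv (rank_perm N \<eta>) i)) [1..<N + 1]"
proof (rule decr_rearr_eq_map[OF permutes_inv[OF rank_perm_permutes]])
  fix i l assume il: "1 \<le> i" "i < l" "l \<le> N"
  let ?w = "inv (rank_perm N \<eta>)"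
  note p = rank_perm_permutes[of N \<eta>]
  have mem: "?w i \<in> {1..N}" "?w l \<in> {1..N}"
    using permutes_in_image[OF permutes_inv[OF p], of i] permutes_in_image[OF permutes_inv[OF p], of l] il by auto
  have "rank_perm N \<eta> (?w i) < rank_perm N \<eta> (?w l)" using il by (simp add: permutes_inverses[OF p])
  then have "before \<eta> (?w i) (?w l)" unfolding rank_perm_less_iff[OF mem(2,1)] by simp
  then show "lookup \<eta> (?w l) \<le> lookup \<eta> (?w i)" by (auto simp: before_def)
qed

lemma decr_rearr_nth: "i \<in> {1..N} \<Longrightarrow> decr_rearr N \<eta> ! (i - 1) = lookup \<eta> (inv (rank_perm N \<eta>) i)"
  unfolding decr_rearr_rank_perm by (auto simp: nth_upt simp del: upt_Suc)

definition sorting_perm :: "nat \<Rightarrow> expo \<Rightarrow> (nat \<Rightarrow> nat) \<Rightarrow> bool" where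
  "sorting_perm N \<eta> u \<longleftrightarrow> u permutes {1..N} \<and> (\<forall>i\<in>{1..N}. lookup \<eta> (u i) = decr_rearr N \<eta> ! (i - 1))"

lemma inversions_inv:
  assumes u: "u permutes {1..N}"
  shows "inversions N u = (\<Sum>j\<in>{1..N}. \<Sum>i\<in>{1..N}. of_bool (i < j \<and> inv u j < inv u i))"
proof -
  have "inversions N u = (\<Sum>j\<in>{1..N}. \<Sum>k\<in>{1..N}. of_bool (inv u k < inv u j \<and> j < k))"
    unfolding inversions_def
    using sum_permute2[OF permutes_inv[OF u], of "\<lambda>j k. of_bool (k < j \<and> u j < u k) :: nat"]
    unfolding permutes_inverses(1)[OF u] by (rule sym)
  then show ?thesis by (subst sum.swap) (simp only: conj_commute)
qed

lemma sorting_perm_inverse_less: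
  assumes u: "sorting_perm N \<eta> u" and ij: "i \<in> {1..N}" "j \<in> {1..N}" and lt: "lookup \<eta> i < lookup \<eta> j"
  shows "inv u j < inv u i"
proof (rule ccontr)
  assume n: "\<not> inv u j < inv u i"
  have p: "u permutes {1..N}" using u by (simp add: sorting_perm_def)
  have mem: "inv u i \<in> {1..N}" "inv u j \<in> {1..N}"
    using permutes_in_image[OF permutes_inv[OF p]] ij by auto
  have val: "lookup \<eta> k = decr_rearr N \<eta> ! (inv u k - 1)" if "inv u k \<in> {1..N}" for k
  proof -
    have "\<forall>i\<in>{1..N}. lookup \<eta> (u i) = decr_rearr N \<eta> ! (i - 1)"
      using u unfolding sorting_perm_def by (rule conjunct2)
    from bspec[OF this that] show ?thesis unfolding permutes_inverses(1)[OF p] .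
  qed
  have "sorted (rev (decr_rearr N \<eta>))" by (simp add: decr_rearr_def)
  moreover have "length (decr_rearr N \<eta>) = N" by (simp add: decr_rearr_def)
  moreover have "inv u i - 1 \<le> inv u j - 1" "inv u j - 1 < N" using n mem by auto
  ultimately have "decr_rearr N \<eta> ! (inv u j - 1) \<le> decr_rearr N \<eta> ! (inv u i - 1)"
    by (simp add: sorted_rev_iff_nth_mono)
  then show False using lt val[OF mem(1)] val[OF mem(2)] by simp
qed

lemma sorting_perm_rank_perm: "sorting_perm N \<eta> (inv (rank_perm N \<eta>))"
  by (simp add: sorting_perm_def permutes_inv[OF rank_perm_permutes] decr_rearr_nth del: One_nat_def)

lemma inversions_rank_perm: "inversions N (inv (rank_perm N \<eta>)) = ascents N \<eta>"
proof -
  note p = rank_perm_permutes[of N \<eta>]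
  have "inversions N (inv (rank_perm N \<eta>))
      = (\<Sum>j\<in>{1..N}. \<Sum>i\<in>{1..N}. of_bool (i < j \<and> rank_perm N \<eta> j < rank_perm N \<eta> i))"
    unfolding inversions_inv[OF permutes_inv[OF p]] permutes_inv_inv[OF p] ..
  also have "\<dots> = ascents N \<eta>"
    unfolding ascents_def
    by (intro sum.cong refl arg_cong[where f = of_bool]) (auto simp: rank_perm_less_iff before_def)
  finally show ?thesis .
qed

text \<open>A sorting permutation must invert every ascent. If it inverts nothing else, tied entries
  keep their order, so its inverse orders the positions exactly as \<open>before\<close>
  does.\<close>

lemma sorting_perm_inversions_ge:
  assumes u: "sorting_perm N \<eta> u"
  shows "ascents N \<eta> \<le> inversions N u"
    and "inversions N u = ascents N \<eta> \<Longrightarrow> u = inv (rank_perm N \<eta>)"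
proof -
  have p: "u permutes {1..N}" using u by (simp add: sorting_perm_def)
  let ?f = "\<lambda>j i. of_bool (i < j \<and> lookup \<eta> i < lookup \<eta> j) :: nat"
  let ?g = "\<lambda>j i. of_bool (i < j \<and> inv u j < inv u i) :: nat"
  have le: "?f j i \<le> ?g j i" if "j \<in> {1..N}" "i \<in> {1..N}" for i j
    using sorting_perm_inverse_less[OF u that(2,1)] by (auto simp: of_bool_def)
  show "ascents N \<eta> \<le> inversions N u"
    unfolding inversions_inv[OF p] ascents_def by (intro sum_mono le)
  assume eq: "inversions N u = ascents N \<eta>"
  \<comment> \<open>Equal totals of termwise ordered sums force equality, first of the inner sums
    and then of their terms.\<close>
  have eq2: "?f j i = ?g j i" if "j \<in> {1..N}" "i \<in> {1..N}" for i j
  proof -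
    have "(\<Sum>i\<in>{1..N}. ?f j i) = (\<Sum>i\<in>{1..N}. ?g j i)"
    proof (rule sum_mono_inv[where I = "{1..N}" and f = "\<lambda>j. \<Sum>i\<in>{1..N}. ?f j i" and g = "\<lambda>j. \<Sum>i\<in>{1..N}. ?g j i"])
      show "(\<Sum>j\<in>{1..N}. \<Sum>i\<in>{1..N}. ?f j i) = (\<Sum>j\<in>{1..N}. \<Sum>i\<in>{1..N}. ?g j i)"
        using eq unfolding inversions_inv[OF p] ascents_def by (rule sym)
      show "(\<Sum>i\<in>{1..N}. ?f k i) \<le> (\<Sum>i\<in>{1..N}. ?g k i)" if "k \<in> {1..N}" for k
        by (intro sum_mono le that)
    qed (rule that(1), rule finite_atLeastAtMost)
    then show ?thesis
    proof (rule sum_mono_inv[where I = "{1..N}"])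
      show "?f j k \<le> ?g j k" if "k \<in> {1..N}" for k by (rule le[OF \<open>j \<in> {1..N}\<close> that])
    qed (rule that(2), rule finite_atLeastAtMost)
  qed
  have less: "inv u j < inv u i \<longleftrightarrow> before \<eta> j i \<and> j \<noteq> i" if ij: "i \<in> {1..N}" "j \<in> {1..N}" for i j
  proof -
    have "inv u i \<noteq> inv u j" if "i \<noteq> j" using inj_eq[OF permutes_inj[OF permutes_inv[OF p]]] that by simp
    moreover have "i < j \<Longrightarrow> inv u j < inv u i \<longleftrightarrow> lookup \<eta> i < lookup \<eta> j"
      using eq2[OF ij(2,1)] by (auto simp: of_bool_eq_iff)
    moreover have "j < i \<Longrightarrow> inv u i < inv u j \<longleftrightarrow> lookup \<eta> j < lookup \<eta> i"
      using eq2[OF ij] by (auto simp: of_bool_eq_iff)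
    ultimately show ?thesis
      by (cases i j rule: linorder_cases) (auto simp: before_def)
  qed
  have le2: "inv u j \<le> inv u i \<longleftrightarrow> before \<eta> j i" if ij: "i \<in> {1..N}" "j \<in> {1..N}" for i j
  proof (cases "i = j")
    case False
    then have "inv u i \<noteq> inv u j" using inj_eq[OF permutes_inj[OF permutes_inv[OF p]]] by simp
    then show ?thesis using less[OF ij] False by auto
  qed (simp add: before_def)
  have "inv u i = rank_perm N \<eta> i" for i
  proof (cases "i \<in> {1..N}")
    case True
    then have mem: "inv u i \<in> {1..N}" using permutes_in_image[OF permutes_inv[OF p]] by blast
    \<comment> \<open>The rank of i is the number of positions that \<open>inv u\<close> sends to at
      most \<open>inv u i\<close>, hence \<open>inv u i\<close> itself.\<close>
    have "{j\<in>{1..N}. before \<eta> j i} = {j\<in>{1..N}. inv u j \<le> inv u i}" using le2[OF True] by blast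
    also have "\<dots> = u ` {1..inv u i}"
    proof (intro equalityI subsetI)
      fix j assume j: "j \<in> {j\<in>{1..N}. inv u j \<le> inv u i}"
      then have "inv u j \<in> {1..N}" using permutes_in_image[OF permutes_inv[OF p], of j] by blast
      then show "j \<in> u ` {1..inv u i}" using j
        by (intro image_eqI[of j u "inv u j"]) (auto simp: permutes_inverses[OF p])
    next
      fix j assume "j \<in> u ` {1..inv u i}"
      then obtain k where k: "j = u k" "k \<in> {1..inv u i}" by blast
      then show "j \<in> {j\<in>{1..N}. inv u j \<le> inv u i}"
        using mem permutes_in_image[OF p, of k] by (auto simp: permutes_inverses[OF p])
    qed
    finally have "rank N \<eta> i = inv u i"
      unfolding rank_before[OF True] using card_image[OF inj_on_subset[OF permutes_inj[OF p] subset_UNIV], of "{1..inv u i}"]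
      by simp
    then show ?thesis using True by (simp add: rank_perm_def)
  next
    case False
    show ?thesis unfolding rank_perm_def permutes_not_in[OF permutes_inv[OF p] False]
      using False by (simp only: if_False)
  qed
  then have "inv u = rank_perm N \<eta>" by (rule ext)
  then show "u = inv (rank_perm N \<eta>)" using permutes_inv_inv[OF p] by simp
qed

lemma min_perm_eq: "min_perm N \<eta> = inv (rank_perm N \<eta>)"
proof -
  let ?w = "inv (rank_perm N \<eta>)"
  have P: "(w permutes {1..N} \<and> (\<forall>i\<in>{1..N}. lookup \<eta> (w i) = decr_rearr N \<eta> ! (i - 1))) \<longleftrightarrow> sorting_perm N \<eta> w" for w
    by (simp add: sorting_perm_def)
  have len: "perm_length N u = inversions N u" if "sorting_perm N \<eta> u" for u
    using that by (intro perm_length_inversions) (simp add: sorting_perm_def)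
  have "(THE w. is_arg_min (perm_length N) (sorting_perm N \<eta>) w) = ?w"
  proof (rule the_equality)
    show "is_arg_min (perm_length N) (sorting_perm N \<eta>) ?w"
      unfolding is_arg_min_def
    proof (intro conjI notI)
      show "sorting_perm N \<eta> ?w" by (rule sorting_perm_rank_perm)
      assume "\<exists>y. sorting_perm N \<eta> y \<and> perm_length N y < perm_length N ?w"
      then obtain y where y: "sorting_perm N \<eta> y" "perm_length N y < perm_length N ?w" by blast
      then show False
        using sorting_perm_inversions_ge(1)[OF y(1)]
        by (simp add: len sorting_perm_rank_perm inversions_rank_perm)
    qed
  next
    fix u assume u: "is_arg_min (perm_length N) (sorting_perm N \<eta>) u"
    then have s: "sorting_perm N \<eta> u" and "\<not> perm_length N ?w < perm_length N u"
      using sorting_perm_rank_perm[of N \<eta>] by (auto simp: is_arg_min_def)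
    then have "inversions N u \<le> ascents N \<eta>"
      by (simp add: len sorting_perm_rank_perm inversions_rank_perm)
    then show "u = ?w" using sorting_perm_inversions_ge[OF s] by simp
  qed
  then show ?thesis unfolding min_perm_def P .
qed

text \<open>No entry strictly between a and b ties with either, so the swap preserves the order
  within ties and the rank permutations differ by one transposition.\<close>

lemma bruhat_step_nearest_swap:
  assumes ab: "1 \<le> a" "a < b" "b \<le> N" and lt: "lookup \<eta> b < lookup \<eta> a"
    and near: "\<And>c. a < c \<Longrightarrow> c < b \<Longrightarrow> lookup \<eta> c \<noteq> lookup \<eta> a \<and> lookup \<eta> c \<noteq> lookup \<eta> b"
  shows "bruhat_step N (min_perm N \<eta>) (min_perm N (permute_expo (transpose a b) \<eta>))"
proof -
  let ?t = "transpose a b" and ?\<kappa> = "permute_expo (transpose a b) \<eta>"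
  let ?w = "inv (rank_perm N \<eta>)"
  have t: "?t permutes {1..N}" using ab by (intro permutes_swap_id) auto
  have in1: "a \<in> {1..N}" "b \<in> {1..N}" using ab by auto
  have bf: "before ?\<kappa> j i \<longleftrightarrow> before \<eta> (?t j) (?t i)" for i j
  proof -
    have n: "\<not> (a < k \<and> k < b)" if "lookup \<eta> k = lookup \<eta> a \<or> lookup \<eta> k = lookup \<eta> b" for k
      using near[of k] that by auto
    have l: "lookup ?\<kappa> k = lookup \<eta> (?t k)" for k by (simp add: lookup_permute_expo)
    have "j \<le> i \<longleftrightarrow> ?t j \<le> ?t i" if "lookup \<eta> (?t j) = lookup \<eta> (?t i)"
    proof (cases "j = a \<or> j = b")
      case j: True
      show ?thesis
      proof (cases "i = a \<or> i = b")
        case True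
        then show ?thesis using j that lt by auto
      next
        case False
        then have "?t i = i" by (simp add: transpose_def)
        moreover from this have "\<not> (a < i \<and> i < b)" using n[of i] j that by auto
        ultimately show ?thesis using j False ab(2) by auto
      qed
    next
      case j: False
      then have tj: "?t j = j" by (simp add: transpose_def)
      show ?thesis
      proof (cases "i = a \<or> i = b")
        case True
        then have "\<not> (a < j \<and> j < b)" using n[of j] that unfolding tj by auto
        then show ?thesis using True j ab(2) unfolding tj by auto
      next
        case False
        then show ?thesis unfolding tj by (simp add: transpose_def)
      qed
    qed
    then show ?thesis unfolding before_def l by blast
  qed
  have rk: "rank_perm N ?\<kappa> = rank_perm N \<eta> \<circ> ?t"
  proof
    fix i
    show "rank_perm N ?\<kappa> i = (rank_perm N \<eta> \<circ> ?t) i"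
    proof (cases "i \<in> {1..N}")
      case True
      then have "?t i \<in> {1..N}" using permutes_in_image[OF t] by blast
      then show ?thesis using True rank_permute[OF t True bf] by (simp add: rank_perm_def del: atLeastAtMost_iff)
    next
      case False
      then show ?thesis using in1 by (auto simp: rank_perm_def transpose_def)
    qed
  qed
  note p = rank_perm_permutes[of N \<eta>]
  let ?a = "rank_perm N \<eta> a" and ?b = "rank_perm N \<eta> b"
  have rab: "?a < ?b" unfolding rank_perm_less_iff[OF in1(2,1)] using lt ab by (simp add: before_def)
  have mem: "?a \<in> {1..N}" "?b \<in> {1..N}" using permutes_in_image[OF p] in1 by auto
  have wab: "?w ?a = a" "?w ?b = b" by (simp_all add: permutes_inverses[OF p])
  have "min_perm N ?\<kappa> = ?t \<circ> ?w"
    unfolding min_perm_eq rk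
    using o_inv_distrib[OF permutes_bij[OF p] permutes_bij[OF t]] by simp
  \<comment> \<open>\<open>bruhat_step\<close> multiplies on the right, so the swap of positions is
    rewritten as a swap of their ranks.\<close>
  also have "\<dots> = ?w \<circ> transpose ?a ?b"
  proof
    fix k
    have "?w k = a \<longleftrightarrow> k = ?a" "?w k = b \<longleftrightarrow> k = ?b"
      using permutes_inverses[OF p] by auto
    then show "(?t \<circ> ?w) k = (?w \<circ> transpose ?a ?b) k"
      using wab by (auto simp: transpose_def)
  qed
  finally have e: "min_perm N ?\<kappa> = ?w \<circ> transpose ?a ?b" .
  have pw: "?w permutes {1..N}" by (rule permutes_inv[OF p])
  have "inversions N ?w < inversions N (?w \<circ> transpose ?a ?b)"
    by (rule inversions_transpose) (use mem rab wab ab permutes_inj[OF pw] in auto)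
  moreover have "(?w \<circ> transpose ?a ?b) permutes {1..N}"
    by (rule permutes_compose[OF permutes_swap_id[OF mem] pw])
  ultimately have "perm_length N ?w < perm_length N (?w \<circ> transpose ?a ?b)"
    by (simp add: perm_length_inversions[OF pw] perm_length_inversions)
  moreover have "\<exists>x\<in>{1..N}. \<exists>y\<in>{1..N}. x \<noteq> y \<and> ?w \<circ> transpose ?a ?b = ?w \<circ> transpose x y"
    by (rule bexI[OF _ mem(1)], rule bexI[OF _ mem(2)]) (use rab in simp)
  ultimately show ?thesis
    unfolding bruhat_step_def e unfolding min_perm_eq[of N \<eta>] by (rule conjI[rotated])
qed

text \<open>A general swap is a sequence of swaps of entries with no equal entry in between.\<close>

lemma bruhat_less_swap:
  assumes "1 \<le> a" "a < b" "b \<le> N" "lookup \<eta> b < lookup \<eta> a"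
  shows "bruhat_less N (min_perm N \<eta>) (min_perm N (permute_expo (transpose a b) \<eta>))"
  using assms
proof (induction "b - a" arbitrary: a b \<eta> rule: less_induct)
  case less
  note ab = less.prems(1-3) and lt = less.prems(4)
  show ?case
  proof (cases "\<exists>c. a < c \<and> c < b \<and> (lookup \<eta> c = lookup \<eta> a \<or> lookup \<eta> c = lookup \<eta> b)")
    case False
    have "bruhat_step N (min_perm N \<eta>) (min_perm N (permute_expo (transpose a b) \<eta>))"
      by (rule bruhat_step_nearest_swap[OF ab lt]) (use False in blast)
    then show ?thesis by (auto simp: bruhat_less_def)
  next
    case True
    then obtain c where c: "a < c" "c < b"
      "lookup \<eta> c = lookup \<eta> a \<or> lookup \<eta> c = lookup \<eta> b" by blast
    note tr = tranclp_trans[of "bruhat_step N", folded bruhat_less_def]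
    from c(3) show ?thesis
    proof
      assume e: "lookup \<eta> c = lookup \<eta> a"
      let ?\<mu> = "permute_expo (transpose c b) \<eta>"
      have m: "permute_expo (transpose a c) ?\<mu> = permute_expo (transpose a b) \<eta>"
        by (rule poly_mapping_eqI) (use c ab e in \<open>auto simp: lookup_permute_expo transpose_def\<close>)
      have "bruhat_less N (min_perm N \<eta>) (min_perm N ?\<mu>)"
        by (rule less.hyps) (use c ab lt e in auto)
      moreover have "bruhat_less N (min_perm N ?\<mu>) (min_perm N (permute_expo (transpose a c) ?\<mu>))"
        by (rule less.hyps) (use c ab lt e in \<open>auto simp: lookup_permute_expo transpose_def\<close>)
      ultimately show ?thesis unfolding m by (rule tr)
    next
      assume e: "lookup \<eta> c = lookup \<eta> b"
      let ?\<mu> = "permute_expo (transpose a c) \<eta>"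
      have m: "permute_expo (transpose c b) ?\<mu> = permute_expo (transpose a b) \<eta>"
        by (rule poly_mapping_eqI) (use c ab e in \<open>auto simp: lookup_permute_expo transpose_def\<close>)
      have "bruhat_less N (min_perm N \<eta>) (min_perm N ?\<mu>)"
        by (rule less.hyps) (use c ab lt e in auto)
      moreover have "bruhat_less N (min_perm N ?\<mu>) (min_perm N (permute_expo (transpose c b) ?\<mu>))"
        by (rule less.hyps) (use c ab lt e in \<open>auto simp: lookup_permute_expo transpose_def\<close>)
      ultimately show ?thesis unfolding m by (rule tr)
    qed
  qed
qed

section \<open>Comparison with the dominance order\<close>

lemma excess_decr_rearr: "excess N c \<eta> = (\<Sum>x\<leftarrow>decr_rearr N \<eta>. x - c)"
proof -
  have "(\<Sum>x\<leftarrow>decr_rearr N \<eta>. x - c) = sum_mset (image_mset (\<lambda>x. x - c) (mset (decr_rearr N \<eta>)))"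
    unfolding mset_map[symmetric] sum_mset_sum_list ..
  also have "\<dots> = (\<Sum>j\<in>{1..N}. lookup \<eta> j - c)"
    unfolding mset_decr_rearr multiset.map_comp comp_def sum_unfold_sum_mset ..
  finally show ?thesis unfolding excess_def by (rule sym)
qed

lemma decr_rearr_permute:
  assumes "p permutes {1..N}"
  shows "decr_rearr N (permute_expo p \<eta>) = decr_rearr N \<eta>"
proof -
  have "image_mset (lookup (permute_expo p \<eta>)) (mset_set {1..N})
      = image_mset (\<lambda>i. lookup \<eta> (p i)) (mset_set {1..N})"
    by (rule image_mset_cong) (rule lookup_permute_expo[OF permutes_inj[OF assms]])
  also have "\<dots> = image_mset (lookup \<eta>) (image_mset p (mset_set {1..N}))"
    unfolding multiset.map_comp comp_def ..
  finally have "mset (decr_rearr N \<eta>) = image_mset (lookup (permute_expo p \<eta>)) (mset_set {1..N})"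
    unfolding image_mset_permutes[OF assms] mset_decr_rearr by (rule sym)
  then show ?thesis by (rule decr_rearr_eqI) (simp add: decr_rearr_def)
qed

lemma sum_list_take_le: "sum_list (take k xs) \<le> k * c + (\<Sum>x\<leftarrow>xs. x - c)" for xs :: "nat list"
proof (induction xs arbitrary: k)
  case (Cons x xs)
  show ?case
  proof (cases k)
    case (Suc l)
    then show ?thesis using Cons[of l] by simp
  qed simp
qed simp

text \<open>Equality in \<open>sum_list_take_le\<close> when c is the k-th entry: the first k
  entries are at least c and the later ones contribute nothing.\<close>

lemma sum_list_take_eq:
  fixes xs :: "nat list"
  assumes "sorted_wrt (\<ge>) xs" "1 \<le> k" "k \<le> length xs"
  shows "sum_list (take k xs) = k * (xs ! (k - 1)) + (\<Sum>x\<leftarrow>xs. x - xs ! (k - 1))"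
  using assms
proof (induction xs arbitrary: k)
  case (Cons x xs)
  show ?case
  proof (cases "k = 1")
    case True
    have "(\<Sum>y\<leftarrow>xs. y - x) = 0" using Cons.prems(1) by (auto simp: sum_list_eq_0_iff)
    then show ?thesis using True by simp
  next
    case False
    then obtain l where l: "k = Suc l" "1 \<le> l" using Cons.prems(2) by (cases k) auto
    have "xs ! (l - 1) \<in> set xs" using Cons.prems(3) l by simp
    then have le: "xs ! (l - 1) \<le> x" using Cons.prems(1) by auto
    have nth: "(x # xs) ! (k - 1) = xs ! (l - 1)" using l by (cases l) auto
    have "sum_list (take l xs) = l * (xs ! (l - 1)) + (\<Sum>x\<leftarrow>xs. x - xs ! (l - 1))"
      by (rule Cons.IH) (use Cons.prems l in auto)
    then show ?thesis unfolding nth unfolding l(1) using le by simp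
  qed
qed simp

lemma dominance_less_dominated:
  assumes d: "dominated N \<kappa> \<eta>"
  shows "dominance_less (decr_rearr N \<kappa>) (decr_rearr N \<eta>)"
  unfolding dominance_less_def
proof (intro conjI allI notI)
  have ex: "excess N c \<kappa> \<le> excess N c \<eta>" for c using d by (simp add: dominated_def)
  have len: "length (decr_rearr N \<nu>) = N" for \<nu> by (simp add: decr_rearr_def)
  assume "decr_rearr N \<kappa> = decr_rearr N \<eta>"
  then show False using d by (auto simp: dominated_def excess_decr_rearr)
next
  have len: "length (decr_rearr N \<nu>) = N" for \<nu> by (simp add: decr_rearr_def)
  show s: "sum_list (decr_rearr N \<kappa>) = sum_list (decr_rearr N \<eta>)"
    using d by (simp add: dominated_def excess_decr_rearr)
  fix k
  show "sum_list (take k (decr_rearr N \<kappa>)) \<le> sum_list (take k (decr_rearr N \<eta>))"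
  proof (cases "1 \<le> k \<and> k \<le> N")
    case True
    let ?c = "decr_rearr N \<eta> ! (k - 1)"
    have "sum_list (take k (decr_rearr N \<kappa>)) \<le> k * ?c + excess N ?c \<kappa>"
      unfolding excess_decr_rearr by (rule sum_list_take_le)
    also have "\<dots> \<le> k * ?c + excess N ?c \<eta>" using d by (simp add: dominated_def)
    also have "\<dots> = sum_list (take k (decr_rearr N \<eta>))"
      unfolding excess_decr_rearr
      by (rule sum_list_take_eq[symmetric])
        (use True len in \<open>auto simp: decr_rearr_def sorted_wrt_rev\<close>)
    finally show ?thesis .
  next
    case False
    then consider "k = 0" | "N \<le> k" by linarith
    then show ?thesis using s len by cases simp_all
  qed
qed

text \<open>A swap keeps the rearrangement and moves a larger entry right, which lengthens the
  minimal permutation; hence the reversed arguments of \<open>bruhat_less\<close>.\<close>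

lemma below_expo_prec:
  assumes "below N \<kappa> \<eta>"
  shows "expo_prec N \<kappa> \<eta>"
proof -
  have one: "decr_rearr N \<kappa> = decr_rearr N \<eta> \<and> bruhat_less N (min_perm N \<eta>) (min_perm N \<kappa>)"
    if st: "swap_step N \<kappa> \<eta>" for \<kappa> \<eta>
  proof -
    obtain a b where ab: "1 \<le> a" "a < b" "b \<le> N" "lookup \<eta> b < lookup \<eta> a"
      and k: "\<kappa> = permute_expo (transpose a b) \<eta>" using st by (auto simp: swap_step_def)
    have "transpose a b permutes {1..N}" using ab by (intro permutes_swap_id) auto
    then show ?thesis unfolding k using decr_rearr_permute bruhat_less_swap[OF ab] by blast
  qed
  have "decr_rearr N \<kappa> = decr_rearr N \<eta> \<and> bruhat_less N (min_perm N \<eta>) (min_perm N \<kappa>)"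
    if "(swap_step N)\<^sup>+\<^sup>+ \<kappa> \<eta>"
    using that
  proof (induction rule: tranclp_induct)
    case (base y)
    then show ?case by (rule one)
  next
    case (step y z)
    have "decr_rearr N y = decr_rearr N z \<and> bruhat_less N (min_perm N z) (min_perm N y)"
      by (rule one[OF step.hyps(2)])
    then show ?case using step.IH unfolding bruhat_less_def by (auto intro: tranclp_trans)
  qed
  then show ?thesis using assms dominance_less_dominated unfolding below_def expo_prec_def by blast
qed

lemma nonsym_macdonald_eq:
  assumes N: "1 \<le> N" and \<eta>: "composition N \<eta>" and E: "joint_eigenvector N \<eta> E" "lookup E \<eta> = 1"
  shows "nonsym_macdonald N \<eta> = E"
  unfolding nonsym_macdonald_def
proof (rule the_equality)
  show "is_nonsym_macdonald N \<eta> E"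
    unfolding is_nonsym_macdonald_def
  proof (intro conjI ballI)
    fix \<nu> assume \<nu>: "\<nu> \<in> keys E"
    have "composition N \<nu>" using E(1) \<nu> by (simp add: joint_eigenvector_def)
    then show "\<nu> = \<eta> \<or> keys \<nu> \<subseteq> {1..N} \<and> expo_prec N \<nu> \<eta>"
      using joint_eigenvector_keys(1)[OF E(1) \<eta> \<nu>] below_expo_prec
      by (auto simp: below_eq_def composition_def)
  qed (use E in \<open>auto simp: joint_eigenvector_def spectrum_def\<close>)
next
  fix F assume F: "is_nonsym_macdonald N \<eta> F"
  have "composition N \<nu>" if "\<nu> \<in> keys F" for \<nu>
    using F \<eta> that by (auto simp: is_nonsym_macdonald_def composition_def)
  then have "joint_eigenvector N \<eta> F"
    using F by (simp add: is_nonsym_macdonald_def joint_eigenvector_def spectrum_def)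
  then show "F = E"
    using joint_eigenvector_unique[OF _ E(1) \<eta> _ N, of F] E(2) F by (simp add: is_nonsym_macdonald_def)
qed

theorem principal_spec_nonsym_macdonald:
  assumes \<eta>: "composition N \<eta>"
  shows "principal_spec (nonsym_macdonald N \<eta>) = spec_value N \<eta>"
proof (cases "1 \<le> N")
  case True
  from joint_eigenvector_exists[OF True \<eta>] obtain E
    where "joint_eigenvector N \<eta> E" "lookup E \<eta> = 1" "principal_spec E = spec_value N \<eta>" by blast
  then show ?thesis using nonsym_macdonald_eq[OF True \<eta>] by simp
next
  case False
  \<comment> \<open>Without variables there are no eigenvalue conditions, and the support condition
    leaves 0 as the only exponent, with coefficient 1.\<close>
  then have N: "N = 0" by simp
  have z: "\<eta> = 0" using \<eta> by (simp add: composition_def N)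
  have "nonsym_macdonald N \<eta> = 1"
    unfolding nonsym_macdonald_def z N
  proof (rule the_equality)
    show "is_nonsym_macdonald 0 0 1" by (simp add: is_nonsym_macdonald_def)
    fix E assume E: "is_nonsym_macdonald 0 0 E"
    show "E = 1"
    proof (rule poly_mapping_eqI)
      fix \<nu>
      have "\<nu> = 0" if "\<nu> \<in> keys E"
        using E that by (auto simp: is_nonsym_macdonald_def)
      then show "lookup E \<nu> = lookup 1 \<nu>"
        using E by (cases "\<nu> = 0") (auto simp: is_nonsym_macdonald_def lookup_one in_keys_iff)
    qed
  qed
  then show ?thesis by (simp add: z N spec_value_zero)
qed

subsection \<open>Symmetrization\<close>

lemma principal_spec_hecke_perm:
  assumes "w permutes {1..N}"
  shows "principal_spec (hecke_perm N w f) = tt ^ inversions N w * principal_spec f"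
proof -
  define ws where "ws = (SOME is. reduced_word N w is)"
  have "reduced_word N w ws" unfolding ws_def using reduced_word_exists[OF assms] by (rule someI_ex)
  then have ws: "set ws \<subseteq> {1..<N}" "length ws = inversions N w"
    by (auto simp: reduced_word_def perm_length_inversions[OF assms])
  have "principal_spec (compose (map hecke us) f) = tt ^ length us * principal_spec f"
    if "set us \<subseteq> {1..<N}" for us
    using that by (induction us) (auto simp: principal_spec_hecke)
  from this[OF ws(1)] show ?thesis by (simp add: hecke_perm_def ws_def[symmetric] ws(2))
qed

lemma pull_left_permutes:
  assumes "m < b" "b \<le> n"
  shows "pull_left n b permutes {m + 1..n}"
proof -
  have "pull_left n b \<circ> pull_right b n = id" "pull_right b n \<circ> pull_left n b = id"
    using assms by (auto simp: pull_left_def pull_right_def fun_eq_iff)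
  then have "bij (pull_left n b)" using o_bij by blast
  moreover have "pull_left n b k = k" if "k \<notin> {m + 1..n}" for k
    using that assms by (auto simp: pull_left_def)
  ultimately show ?thesis by (auto simp: permutes_def bij_iff)
qed

text \<open>Each further step of the cycle creates one inversion, because it moves the largest value
  n + 1, fixed by s, one place to the left.\<close>

lemma inversions_pull_left:
  assumes s: "s permutes {m + 1..n}" and b: "m < b" "b \<le> n + 1" and n: "n + 1 \<le> N"
  shows "inversions N (s \<circ> pull_left (n + 1) b) = inversions N s + (n + 1 - b)"
  using b(2,1)
proof (induction b rule: inc_induct)
  case base
  have "pull_left (n + 1) (n + 1) = id" by (auto simp: pull_left_def fun_eq_iff)
  then show ?case by simp
next
  case (step b)
  have e: "s \<circ> pull_left (n + 1) (Suc b) \<circ> transpose b (b + 1) = s \<circ> pull_left (n + 1) b"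
    using step.hyps by (auto simp: pull_left_def fun_eq_iff transpose_def)
  have "s b \<in> {m + 1..n}" using permutes_in_image[OF s, of b] step by auto
  moreover have "s (n + 1) = n + 1" using permutes_not_in[OF s, of "n + 1"] by auto
  ultimately have "(s \<circ> pull_left (n + 1) (Suc b)) b < (s \<circ> pull_left (n + 1) (Suc b)) (b + 1)"
    by (simp add: pull_left_def)
  from inversions_ascent[where w = "s \<circ> pull_left (n + 1) (Suc b)", OF _ _ this, of N] have "inversions N (s \<circ> pull_left (n + 1) b)
      = inversions N (s \<circ> pull_left (n + 1) (Suc b)) + 1"
    unfolding e using step.hyps step.prems n by simp
  moreover have "inversions N (s \<circ> pull_left (n + 1) (Suc b)) = inversions N s + (n + 1 - Suc b)"
    by (rule step.IH) (use step in auto)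
  ultimately show ?case using step.hyps by linarith
qed

text \<open>A permutation of m + 1, ..., n + 1 is given by the place b of its largest value and a
  permutation s of the others, and has n + 1 - b more inversions than s. The geometric sum over b is
  the next factor of the factorial.\<close>

lemma sum_inversions:
  assumes "m + k \<le> N"
  shows "(\<Sum>s | s permutes {m + 1..m + k}. tt ^ inversions N s) = qfact tt k"
  using assms
proof (induction k)
  case 0
  have "{s. s permutes {m + 1..m + 0}} = {id}" by (auto simp: permutes_empty)
  then show ?case by (simp add: qfact_def inversions_id)
next
  case (Suc k)
  define n where "n = m + k"
  have n: "m + Suc k = n + 1" by (simp add: n_def)
  let ?P = "{s. s permutes {m + 1..n}}" and ?B = "{m + 1..n + 1}"
  have PL: "pull_left (n + 1) b permutes {m + 1..n + 1}" if "b \<in> ?B" for b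
    by (rule pull_left_permutes) (use that in auto)
  have fixed: "s (n + 1) = n + 1" if "s permutes {m + 1..n}" for s
    using permutes_not_in[OF that, of "n + 1"] by auto
  have sub: "s permutes {m + 1..n + 1}" if "s permutes {m + 1..n}" for s
    using that by (rule permutes_subset) auto
  have plb: "pull_left (n + 1) b b = n + 1" for b by (simp add: pull_left_def)
  have "bij_betw (\<lambda>(s, b). s \<circ> pull_left (n + 1) b) (?P \<times> ?B) {s. s permutes {m + 1..n + 1}}"
    unfolding bij_betw_def
  proof (intro conjI)
    show "inj_on (\<lambda>(s, b). s \<circ> pull_left (n + 1) b) (?P \<times> ?B)"
    proof (rule inj_onI)
      fix x y assume x: "x \<in> ?P \<times> ?B" and y: "y \<in> ?P \<times> ?B"
        and xy: "(case x of (s, b) \<Rightarrow> s \<circ> pull_left (n + 1) b) = (case y of (s, b) \<Rightarrow> s \<circ> pull_left (n + 1) b)"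
      obtain s b where sb: "x = (s, b)" "s permutes {m + 1..n}" "b \<in> ?B" using x by auto
      obtain s' b' where sb': "y = (s', b')" "s' permutes {m + 1..n}" "b' \<in> ?B" using y by auto
      have e: "s \<circ> pull_left (n + 1) b = s' \<circ> pull_left (n + 1) b'" using xy sb(1) sb'(1) by simp
      have "s' (pull_left (n + 1) b' b) = n + 1"
        using fun_cong[OF e, of b] unfolding comp_apply plb fixed[OF sb(2)] by simp
      then have "s' (pull_left (n + 1) b' b) = s' (pull_left (n + 1) b' b')"
        unfolding plb[of b'] fixed[OF sb'(2)] .
      then have "pull_left (n + 1) b' b = pull_left (n + 1) b' b'" by (rule injD[OF permutes_inj[OF sb'(2)]])
      then have bb: "b = b'" by (rule injD[OF permutes_inj[OF PL[OF sb'(3)]]])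
      have "s k = s' k" for k
      proof -
        obtain l where "k = pull_left (n + 1) b' l"
          using permutes_surj[OF PL[OF sb'(3)]] by (rule surjE)
        then show ?thesis using fun_cong[OF e, of l] unfolding bb by simp
      qed
      then show "x = y" using bb sb(1) sb'(1) by auto
    qed
    show "(\<lambda>(s, b). s \<circ> pull_left (n + 1) b) ` (?P \<times> ?B) = {s. s permutes {m + 1..n + 1}}"
    proof (intro equalityI subsetI)
      fix u assume "u \<in> (\<lambda>(s, b). s \<circ> pull_left (n + 1) b) ` (?P \<times> ?B)"
      then obtain s b where "u = s \<circ> pull_left (n + 1) b" "s permutes {m + 1..n}" "b \<in> ?B" by auto
      then show "u \<in> {s. s permutes {m + 1..n + 1}}" using permutes_compose[OF PL sub] by simp
    next
      fix u assume "u \<in> {s. s permutes {m + 1..n + 1}}"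
      then have u: "u permutes {m + 1..n + 1}" by simp
      define b where "b = inv u (n + 1)"
      have "inv u (n + 1) \<in> ?B"
        using permutes_in_image[OF permutes_inv[OF u], of "n + 1"] by (simp add: n_def)
      then have b: "b \<in> ?B" by (simp add: b_def)
      define s where "s = u \<circ> inv (pull_left (n + 1) b)"
      have "s permutes {m + 1..n + 1}" unfolding s_def
        by (rule permutes_compose[OF permutes_inv[OF PL[OF b]] u])
      moreover have "s (n + 1) = n + 1"
      proof -
        have "inv (pull_left (n + 1) b) (n + 1) = b"
          using plb[of b] permutes_inverses(2)[OF PL[OF b], of b] by simp
        then show ?thesis unfolding s_def b_def using permutes_inverses(1)[OF u] by simp
      qed
      ultimately have "s permutes {m + 1..n}"
      proof -
        assume a: "s permutes {m + 1..n + 1}" "s (n + 1) = n + 1"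
        show ?thesis
        proof (rule permutes_superset[OF a(1)])
          fix x assume "x \<in> {m + 1..n + 1} - {m + 1..n}"
          then have "x = n + 1" by auto
          then show "s x = x" using a(2) by simp
        qed
      qed
      moreover have "u = s \<circ> pull_left (n + 1) b"
        unfolding s_def comp_assoc using permutes_inv_o(2)[OF PL[OF b]] by simp
      ultimately show "u \<in> (\<lambda>(s, b). s \<circ> pull_left (n + 1) b) ` (?P \<times> ?B)" using b
        by (intro image_eqI[where x = "(s, b)"]) auto
    qed
  qed
  from sum.reindex_bij_betw[OF this, of "\<lambda>s. tt ^ inversions N s"]
  have "(\<Sum>s | s permutes {m + 1..n + 1}. tt ^ inversions N s)
      = (\<Sum>x\<in>?P \<times> ?B. tt ^ inversions N (case x of (s, b) \<Rightarrow> s \<circ> pull_left (n + 1) b))" by simp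
  also have "\<dots> = (\<Sum>x\<in>?P \<times> ?B. case x of (s, b) \<Rightarrow> tt ^ inversions N s * tt ^ (n + 1 - b))"
  proof (rule sum.cong)
    fix x assume "x \<in> ?P \<times> ?B"
    then obtain s b where x: "x = (s, b)" "s permutes {m + 1..n}" "b \<in> ?B" by auto
    then have "inversions N (s \<circ> pull_left (n + 1) b) = inversions N s + (n + 1 - b)"
      using Suc.prems n by (intro inversions_pull_left) auto
    then show "tt ^ inversions N (case x of (s, b) \<Rightarrow> s \<circ> pull_left (n + 1) b)
        = (case x of (s, b) \<Rightarrow> tt ^ inversions N s * tt ^ (n + 1 - b))"
      unfolding x(1) by (simp add: power_add)
  qed simp
  also have "\<dots> = (\<Sum>s\<in>?P. tt ^ inversions N s) * (\<Sum>b\<in>?B. tt ^ (n + 1 - b))"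
    unfolding sum_product sum.cartesian_product ..
  also have "(\<Sum>s\<in>?P. tt ^ inversions N s) = qfact tt k" using Suc n_def by simp
  also have "(\<Sum>b\<in>?B. tt ^ (n + 1 - b)) = (\<Sum>i\<in>{..<Suc k}. tt ^ i)"
    by (rule sum.reindex_bij_witness[of _ "\<lambda>i. n + 1 - i" "\<lambda>b. n + 1 - b"]) (auto simp: n_def)
  also have "\<dots> = (1 - tt ^ Suc k) / (1 - tt)"
    using one_diff_power_eq[of tt "Suc k"] by (simp add: field_simps del: power_Suc)
  finally show ?case unfolding n by (simp add: qfact_def del: power_Suc)
qed

lemma principal_spec_sum: "principal_spec (sum f I) = (\<Sum>i\<in>I. principal_spec (f i))"
  by (induction I rule: infinite_finite_induct) auto

theorem principal_spec_msym_macdonald: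
  assumes le: "length (fst \<Lambda>) + length (snd \<Lambda>) \<le> N" and c: "composition N (eta \<Lambda> N)"
  shows "principal_spec (msym_macdonald \<Lambda> N)
    = qfact tt (N - length (fst \<Lambda>)) / u_norm \<Lambda> N * spec_value N (eta \<Lambda> N)"
proof -
  define m where "m = length (fst \<Lambda>)"
  let ?S = "{s. s permutes {m + 1..N}}"
  have mN: "m + (N - m) = N" using le by (simp add: m_def)
  have "principal_spec (hecke_perm N s (nonsym_macdonald N (eta \<Lambda> N))) = tt ^ inversions N s * spec_value N (eta \<Lambda> N)"
    if "s \<in> ?S" for s
  proof -
    have "s permutes {1..N}" using that by (auto intro: permutes_subset)
    then show ?thesis by (simp add: principal_spec_hecke_perm principal_spec_nonsym_macdonald[OF c])
  qed
  then have "principal_spec (\<Sum>s\<in>?S. hecke_perm N s (nonsym_macdonald N (eta \<Lambda> N)))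
      = (\<Sum>s\<in>?S. tt ^ inversions N s) * spec_value N (eta \<Lambda> N)"
    unfolding principal_spec_sum sum_distrib_right by (rule sum.cong[OF refl])
  also have "(\<Sum>s\<in>?S. tt ^ inversions N s) = qfact tt (N - m)"
    using sum_inversions[of m "N - m" N] mN by simp
  finally show ?thesis
    using le by (simp add: msym_macdonald_def Let_def m_def)
qed

subsection \<open>Row by row evaluation\<close>

text \<open>Sends r to the position of rank r, which becomes row r of the diagram padded to N
  rows.\<close>

definition row_pos :: "nat \<Rightarrow> expo \<Rightarrow> nat \<Rightarrow> nat" where
  "row_pos N \<eta> = inv (rank_perm N \<eta>)"

definition row_val :: "nat \<Rightarrow> expo \<Rightarrow> nat \<Rightarrow> nat" where
  "row_val N \<eta> r = lookup \<eta> (row_pos N \<eta> r)"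

lemma row_pos_permutes: "row_pos N \<eta> permutes {1..N}"
  unfolding row_pos_def by (rule permutes_inv[OF rank_perm_permutes])

lemma row_pos_in: "r \<in> {1..N} \<Longrightarrow> row_pos N \<eta> r \<in> {1..N}"
  using permutes_in_image[OF row_pos_permutes] by blast

lemma rank_row_pos: "r \<in> {1..N} \<Longrightarrow> rank N \<eta> (row_pos N \<eta> r) = r"
  using permutes_inverses(1)[OF rank_perm_permutes, of N \<eta> r] row_pos_in[of r N \<eta>]
  by (simp add: rank_perm_def row_pos_def)

lemma before_row_pos:
  assumes "r \<in> {1..N}" "s \<in> {1..N}"
  shows "before \<eta> (row_pos N \<eta> r) (row_pos N \<eta> s) \<and> row_pos N \<eta> r \<noteq> row_pos N \<eta> s \<longleftrightarrow> r < s"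
  using rank_less_iff[OF row_pos_in[OF assms(2)] row_pos_in[OF assms(1)], of \<eta> \<eta> \<eta>]
  unfolding rank_row_pos[OF assms(1)] rank_row_pos[OF assms(2)] by (rule sym)

lemma row_val_mono:
  assumes "r \<in> {1..N}" "s \<in> {1..N}" "r < s"
  shows "row_val N \<eta> s < row_val N \<eta> r \<or> row_val N \<eta> s = row_val N \<eta> r \<and> row_pos N \<eta> r < row_pos N \<eta> s"
  using before_row_pos[OF assms(1,2), of \<eta>] assms(3) by (auto simp: before_def row_val_def)

lemma upward_closed_interval:
  assumes "\<And>s s'. s \<in> {r + 1..N} \<Longrightarrow> s' \<in> {r + 1..N} \<Longrightarrow> s \<le> s' \<Longrightarrow> P s \<Longrightarrow> P s'"
  shows "{s\<in>{r + 1..N}. P s} = {r + 1 + card {s\<in>{r + 1..N}. \<not> P s}..N}"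
proof (cases "\<exists>s\<in>{r + 1..N}. P s")
  case True
  define t where "t = (LEAST s. s \<in> {r + 1..N} \<and> P s)"
  have t: "t \<in> {r + 1..N} \<and> P t"
    unfolding t_def by (rule LeastI_ex) (use True in blast)
  have least: "t \<le> s" if "s \<in> {r + 1..N}" "P s" for s
    unfolding t_def by (rule Least_le) (use that in blast)
  have "{s\<in>{r + 1..N}. \<not> P s} = {r + 1..<t}"
  proof (intro equalityI subsetI)
    fix s assume s: "s \<in> {s\<in>{r + 1..N}. \<not> P s}"
    then have "\<not> t \<le> s" using assms[of t s] t by blast
    then show "s \<in> {r + 1..<t}" using s by simp
  next
    fix s assume s: "s \<in> {r + 1..<t}"
    then have "s \<in> {r + 1..N}" using t by simp
    moreover from this have "\<not> P s" using least[of s] s by auto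
    ultimately show "s \<in> {s\<in>{r + 1..N}. \<not> P s}" by blast
  qed
  then have c: "r + 1 + card {s\<in>{r + 1..N}. \<not> P s} = t" using t by simp
  show ?thesis unfolding c
  proof (intro equalityI subsetI)
    fix s assume "s \<in> {s\<in>{r + 1..N}. P s}"
    then show "s \<in> {t..N}" using least[of s] by simp
  next
    fix s assume s: "s \<in> {t..N}"
    then have "s \<in> {r + 1..N}" using t by simp
    moreover from this have "P s" using assms[of t s] t s by auto
    ultimately show "s \<in> {s\<in>{r + 1..N}. P s}" by blast
  qed
next
  case False
  then have "{s\<in>{r + 1..N}. \<not> P s} = {r + 1..N}" "{s\<in>{r + 1..N}. P s} = {}" by auto
  then show ?thesis by auto
qed

lemma prod_telescope_factor:
  assumes "L \<le> M" "1 \<le> k"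
  shows "(\<Prod>s\<in>{r + 1 + L..r + M}. telescope_factor (s - r) k)
    = (1 - qq ^ k * tt ^ (M + 1)) / (1 - qq ^ k * tt ^ (L + 1))"
  using assms(1)
proof (induction M rule: dec_induct)
  case base
  have "1 - qq ^ k * tt ^ (L + 1) \<noteq> 0" by (rule one_minus_nonzero) simp
  then show ?case by simp
next
  case (step M)
  have nz: "1 - qq ^ k * tt ^ (M + 1) \<noteq> 0" by (rule one_minus_nonzero) simp
  have "{r + 1 + L..r + Suc M} = insert (r + Suc M) {r + 1 + L..r + M}" using step.hyps by auto
  then have "(\<Prod>s\<in>{r + 1 + L..r + Suc M}. telescope_factor (s - r) k)
      = telescope_factor (M + 1) k * (\<Prod>s\<in>{r + 1 + L..r + M}. telescope_factor (s - r) k)" by simp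
  also have "\<dots> = (1 - qq ^ k * tt ^ (M + 1 + 1)) / (1 - qq ^ k * tt ^ (M + 1)) *
      ((1 - qq ^ k * tt ^ (M + 1)) / (1 - qq ^ k * tt ^ (L + 1)))"
    unfolding step.IH by (simp only: telescope_factor_def)
  also have "\<dots> = (1 - qq ^ k * tt ^ (Suc M + 1)) / (1 - qq ^ k * tt ^ (L + 1))"
    using nz by (simp only: times_divide_times_eq) simp
  finally show ?case .
qed

text \<open>The leg of the cell (r, j) in the auxiliary diagram in which each of the N rows ends in
  a circle filled with its position.\<close>

definition row_leg :: "nat \<Rightarrow> expo \<Rightarrow> nat \<Rightarrow> nat \<Rightarrow> nat" where
  "row_leg N \<eta> r j = card {s\<in>{r + 1..N}. j \<le> row_val N \<eta> s + of_bool (row_pos N \<eta> s < row_pos N \<eta> r)}"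

text \<open>With v the length of the row, k is the arm in that auxiliary diagram of the cell in
  column v + 1 - k. The numerators are what the telescoping leaves at the last row N.\<close>

definition row_product :: "nat \<Rightarrow> expo \<Rightarrow> nat \<Rightarrow> qt" where
  "row_product N \<eta> r = (\<Prod>k\<in>{1..row_val N \<eta> r}. (1 - qq ^ k * tt ^ (N - r + 1)) /
     (1 - qq ^ k * tt ^ (row_leg N \<eta> r (row_val N \<eta> r + 1 - k) + 1)))"

text \<open>For fixed \<open>r\<close> and \<open>k\<close> the rows \<open>s\<close> that contribute a factor form a final segment of
  \<open>{r + 1..N}\<close>, so the factors telescope.\<close>

lemma pair_product_rows: "pair_product N \<eta> = (\<Prod>r\<in>{1..N}. row_product N \<eta> r)"
proof -
  let ?w = "row_pos N \<eta>" and ?v = "row_val N \<eta>"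
  let ?b = "\<lambda>r s. of_bool (?w s < ?w r) :: nat"
  have pf: "pair_factor N \<eta> (?w r) (?w s) = (if r < s then \<Prod>k\<in>{1..?v r - ?v s - ?b r s}. telescope_factor (s - r) k else 1)"
    if "r \<in> {1..N}" "s \<in> {1..N}" for r s
    unfolding pair_factor_def before_row_pos[OF that] rank_row_pos[OF that(1)] rank_row_pos[OF that(2)]
      pair_length_def row_val_def by (simp add: of_bool_def)
  have row: "(\<Prod>s\<in>{1..N}. if r < s then \<Prod>k\<in>{1..?v r - ?v s - ?b r s}. telescope_factor (s - r) k else 1)
      = row_product N \<eta> r" if r: "r \<in> {1..N}" for r
  proof -
    have "{s\<in>{1..N}. r < s} = {r + 1..N}" using r by auto
    then have "(\<Prod>s\<in>{1..N}. if r < s then \<Prod>k\<in>{1..?v r - ?v s - ?b r s}. telescope_factor (s - r) k else 1)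
       = (\<Prod>s\<in>{r + 1..N}. \<Prod>k\<in>{1..?v r - ?v s - ?b r s}. telescope_factor (s - r) k)"
      by (simp add: prod.inter_filter[symmetric])
    also have "\<dots> = (\<Prod>s\<in>{r + 1..N}. \<Prod>k\<in>{1..?v r}. if ?v s + ?b r s + k \<le> ?v r then telescope_factor (s - r) k else 1)"
    proof (rule prod.cong[OF refl])
      fix s
      have "{k\<in>{1..?v r}. ?v s + ?b r s + k \<le> ?v r} = {1..?v r - ?v s - ?b r s}" by auto
      then show "(\<Prod>k\<in>{1..?v r - ?v s - ?b r s}. telescope_factor (s - r) k)
          = (\<Prod>k\<in>{1..?v r}. if ?v s + ?b r s + k \<le> ?v r then telescope_factor (s - r) k else 1)"
        using prod.inter_filter[of "{1..?v r}" "\<lambda>k. telescope_factor (s - r) k" "\<lambda>k. ?v s + ?b r s + k \<le> ?v r"]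
        by simp
    qed
    also have "\<dots> = (\<Prod>k\<in>{1..?v r}. \<Prod>s\<in>{r + 1..N}. if ?v s + ?b r s + k \<le> ?v r then telescope_factor (s - r) k else 1)"
      by (rule prod.swap)
    also have "\<dots> = row_product N \<eta> r"
      unfolding row_product_def
    proof (rule prod.cong[OF refl])
      fix k assume k: "k \<in> {1..?v r}"
      let ?P = "\<lambda>s. ?v s + ?b r s + k \<le> ?v r"
      \<comment> \<open>The rows without a k-th factor are those counted by the leg in column v + 1
        - k, with v the length of row r.\<close>
      have neg: "{s\<in>{r + 1..N}. \<not> ?P s} = {s\<in>{r + 1..N}. ?v r + 1 - k \<le> ?v s + ?b r s}"
        using k by auto
      define L where "L = row_leg N \<eta> r (?v r + 1 - k)"
      have L: "card {s\<in>{r + 1..N}. \<not> ?P s} = L" unfolding neg L_def row_leg_def ..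
      have "card {s\<in>{r + 1..N}. \<not> ?P s} \<le> card {r + 1..N}" by (rule card_mono) auto
      then have LN: "L \<le> N - r" unfolding L by simp
      have "{s\<in>{r + 1..N}. ?P s} = {r + 1 + L..N}"
        unfolding L[symmetric]
      proof (rule upward_closed_interval)
        fix s s' assume s: "s \<in> {r + 1..N}" "s' \<in> {r + 1..N}" "s \<le> s'" "?P s"
        show "?P s'"
        proof (cases "s = s'")
          case False
          then have "s < s'" using s(3) by simp
          then have "?v s' < ?v s \<or> ?v s' = ?v s \<and> ?w s < ?w s'"
            using row_val_mono[of s N s' \<eta>] s(1,2) by auto
          then have "?v s' + ?b r s' \<le> ?v s + ?b r s" by auto
          then show ?thesis using s(4) by linarith
        qed (use s in simp)
      qed
      moreover have "(\<Prod>s\<in>{r + 1..N}. if ?P s then telescope_factor (s - r) k else 1)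
          = (\<Prod>s\<in>{s\<in>{r + 1..N}. ?P s}. telescope_factor (s - r) k)"
        by (rule prod.inter_filter[symmetric]) simp
      ultimately have "(\<Prod>s\<in>{r + 1..N}. if ?P s then telescope_factor (s - r) k else 1)
          = (\<Prod>s\<in>{r + 1 + L..r + (N - r)}. telescope_factor (s - r) k)" using r by simp
      also have "\<dots> = (1 - qq ^ k * tt ^ (N - r + 1)) / (1 - qq ^ k * tt ^ (L + 1))"
        by (rule prod_telescope_factor[OF LN]) (use k in simp)
      finally show "(\<Prod>s\<in>{r + 1..N}. if ?P s then telescope_factor (s - r) k else 1)
        = (1 - qq ^ k * tt ^ (N - r + 1)) / (1 - qq ^ k * tt ^ (row_leg N \<eta> r (?v r + 1 - k) + 1))"
        unfolding L_def .
    qed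
    finally show ?thesis .
  qed
  have "pair_product N \<eta> = (\<Prod>r\<in>{1..N}. \<Prod>s\<in>{1..N}. pair_factor N \<eta> (?w r) (?w s))"
    unfolding pair_product_def by (rule prod_permute2[OF row_pos_permutes, symmetric])
  also have "\<dots> = (\<Prod>r\<in>{1..N}. row_product N \<eta> r)"
  proof (rule prod.cong[OF refl])
    fix r assume r: "r \<in> {1..N}"
    have "(\<Prod>s\<in>{1..N}. pair_factor N \<eta> (?w r) (?w s))
       = (\<Prod>s\<in>{1..N}. if r < s then \<Prod>k\<in>{1..?v r - ?v s - ?b r s}. telescope_factor (s - r) k else 1)"
      by (rule prod.cong[OF refl]) (rule pf[OF r])
    then show "(\<Prod>s\<in>{1..N}. pair_factor N \<eta> (?w r) (?w s)) = row_product N \<eta> r"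
      unfolding row[OF r] .
  qed
  finally show ?thesis .
qed

text \<open>Each entry contributes the factor for the number of its later copies; for a fixed value
  these numbers run through 0, 1, ... and give the factorial. In this form the normalization can be
  matched with rows.\<close>

lemma prod_qfact_count_list:
  "(\<Prod>i\<in>set ys. qfact x (count_list ys i))
     = (\<Prod>i\<in>{..<length ys}. (1 - x ^ (count_list (drop (i + 1) ys) (ys ! i) + 1)) / (1 - x))"
proof (induction ys)
  case (Cons y ys)
  have "(\<Prod>i\<in>set (y # ys). qfact x (count_list (y # ys) i))
      = (1 - x ^ (count_list ys y + 1)) / (1 - x) * (\<Prod>i\<in>set ys. qfact x (count_list ys i))"
  proof (cases "y \<in> set ys")
    case True
    have "(\<Prod>i\<in>set ys. qfact x (count_list (y # ys) i))
        = qfact x (count_list (y # ys) y) * (\<Prod>i\<in>set ys - {y}. qfact x (count_list (y # ys) i))"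
      by (rule prod.remove) (use True in auto)
    also have "(\<Prod>i\<in>set ys - {y}. qfact x (count_list (y # ys) i)) = (\<Prod>i\<in>set ys - {y}. qfact x (count_list ys i))"
      by (rule prod.cong) auto
    also have "qfact x (count_list (y # ys) y) = (1 - x ^ (count_list ys y + 1)) / (1 - x) * qfact x (count_list ys y)"
      by (simp add: qfact_def)
    also have "(1 - x ^ (count_list ys y + 1)) / (1 - x) * qfact x (count_list ys y) * (\<Prod>i\<in>set ys - {y}. qfact x (count_list ys i))
        = (1 - x ^ (count_list ys y + 1)) / (1 - x) * (\<Prod>i\<in>set ys. qfact x (count_list ys i))"
      using prod.remove[of "set ys" y "\<lambda>i. qfact x (count_list ys i)"] True by (simp add: mult.assoc)
    finally show ?thesis using True by (simp add: insert_absorb)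
  next
    case False
    have "(\<Prod>i\<in>set ys. qfact x (count_list (y # ys) i)) = (\<Prod>i\<in>set ys. qfact x (count_list ys i))"
      by (rule prod.cong) (use False in auto)
    then show ?thesis using False by (simp add: qfact_def)
  qed
  then show ?case
    unfolding Cons.IH by (simp add: prod.lessThan_Suc_shift del: prod.lessThan_Suc)
qed simp

lemma count_list_drop:
  assumes "i < length ys"
  shows "count_list (drop (i + 1) ys) y = card {j\<in>{i + 1..<length ys}. ys ! j = y}"
proof -
  have "count_list zs y = card {j\<in>{..<length zs}. zs ! j = y}" for zs
    unfolding count_list_eq_length_filter length_filter_conv_card by (rule arg_cong[where f = card]) auto
  then have "count_list (drop (i + 1) ys) y = card {j\<in>{..<length ys - (i + 1)}. ys ! (i + 1 + j) = y}"
    using assms by (auto intro!: arg_cong[where f = card])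
  also have "\<dots> = card ((\<lambda>j. i + 1 + j) ` {j\<in>{..<length ys - (i + 1)}. ys ! (i + 1 + j) = y})"
    by (rule card_image[symmetric]) (simp add: inj_on_def)
  also have "(\<lambda>j. i + 1 + j) ` {j\<in>{..<length ys - (i + 1)}. ys ! (i + 1 + j) = y} = {j\<in>{i + 1..<length ys}. ys ! j = y}"
  proof (intro equalityI subsetI)
    fix j assume j: "j \<in> {j\<in>{i + 1..<length ys}. ys ! j = y}"
    then have "j = i + 1 + (j - (i + 1))" by simp
    then show "j \<in> (\<lambda>j. i + 1 + j) ` {j\<in>{..<length ys - (i + 1)}. ys ! (i + 1 + j) = y}"
      by (rule image_eqI) (use j in auto)
  qed auto
  finally show ?thesis .
qed

subsection \<open>Rows of the diagram\<close>

locale padded_diagram =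
  fixes \<Lambda> :: "nat list \<times> nat list" and N m :: nat
  assumes mpart: "m_partition m \<Lambda>" and le: "m + length (snd \<Lambda>) \<le> N"
begin

definition entry :: "nat \<Rightarrow> nat" where "entry = lookup (eta \<Lambda> N)"

definition pos :: "nat \<Rightarrow> nat" where "pos = row_pos N (eta \<Lambda> N)"

definition val :: "nat \<Rightarrow> nat" where "val = row_val N (eta \<Lambda> N)"

lemma length_fst: "length (fst \<Lambda>) = m"
  using mpart by (simp add: m_partition_def)

lemma m_le: "m \<le> N"
  using le by simp

lemma length_padded: "length (padded \<Lambda> N) = N - m"
  using le by (simp add: padded_def length_fst)

lemma entry_eq: "entry i = (if i \<in> {1..N} then (fst \<Lambda> @ rev (padded \<Lambda> N)) ! (i - 1) else 0)"
  unfolding entry_def eta_def Let_def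
  by (simp add: lookup_sum lookup_single when_def sum.delta)

lemma entry_fst: "1 \<le> i \<Longrightarrow> i \<le> m \<Longrightarrow> entry i = fst \<Lambda> ! (i - 1)"
  using m_le by (auto simp: entry_eq nth_append length_fst)

lemma entry_snd: "i < N - m \<Longrightarrow> entry (m + 1 + i) = rev (padded \<Lambda> N) ! i"
  using m_le by (auto simp: entry_eq nth_append length_fst)

lemma composition_eta: "composition N (eta \<Lambda> N)"
  unfolding composition_def
proof
  fix k assume "k \<in> keys (eta \<Lambda> N)"
  then have "entry k \<noteq> 0" by (simp add: in_keys_iff entry_def)
  then show "k \<in> {1..N}" unfolding entry_eq by (auto split: if_splits)
qed

lemma sorted_padded: "sorted (rev (padded \<Lambda> N))"
proof -
  have "sorted_wrt (\<ge>) (snd \<Lambda>)" using mpart by (simp add: m_partition_def is_partition_def)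
  moreover have "sorted_wrt (\<ge>) (replicate k (0::nat))" for k by (simp add: sorted_wrt_iff_nth_less)
  ultimately have "sorted_wrt (\<ge>) (padded \<Lambda> N)" by (auto simp: padded_def sorted_wrt_append)
  then show ?thesis by (simp add: sorted_wrt_rev)
qed

lemma entry_mono:
  assumes "m < i" "i \<le> j" "j \<le> N"
  shows "entry i \<le> entry j"
proof -
  have ij: "entry i = rev (padded \<Lambda> N) ! (i - m - 1)" "entry j = rev (padded \<Lambda> N) ! (j - m - 1)"
    using entry_snd[of "i - m - 1"] entry_snd[of "j - m - 1"] assms by simp_all
  show ?thesis unfolding ij
    by (rule sorted_nth_mono[OF sorted_padded]) (use assms length_padded in auto)
qed

definition row :: "nat \<Rightarrow> nat \<times> nat option" where
  "row p = (entry p, if p \<le> m then Some p else None)"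

lemma map_row: "map row [1..<N + 1] = map (\<lambda>i. (fst \<Lambda> ! (i - 1), Some i)) [1..<length (fst \<Lambda>) + 1]
      @ map (\<lambda>k. (k, None)) (rev (padded \<Lambda> N))"
proof (rule nth_equalityI)
  show "length (map row [1..<N + 1]) = length (map (\<lambda>i. (fst \<Lambda> ! (i - 1), Some i)) [1..<length (fst \<Lambda>) + 1]
      @ map (\<lambda>k. (k, None)) (rev (padded \<Lambda> N)))"
    using m_le by (simp add: length_fst length_padded del: upt_Suc)
next
  fix i assume "i < length (map row [1..<N + 1])"
  then have i: "i < N" by (simp del: upt_Suc)
  have l: "map row [1..<N + 1] ! i = row (1 + i)" using i by (simp add: nth_upt del: upt_Suc)
  show "map row [1..<N + 1] ! i = (map (\<lambda>i. (fst \<Lambda> ! (i - 1), Some i)) [1..<length (fst \<Lambda>) + 1]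
      @ map (\<lambda>k. (k, None)) (rev (padded \<Lambda> N))) ! i"
  proof (cases "i < m")
    case True
    then show ?thesis unfolding l
      using entry_fst[of "1 + i"] by (simp add: nth_append length_fst row_def nth_upt del: upt_Suc)
  next
    case False
    then have e: "entry (1 + i) = rev (padded \<Lambda> N) ! (i - m)" using entry_snd[of "i - m"] i by simp
    have "length (rev (padded \<Lambda> N)) = N - m" by (simp add: length_padded)
    then show ?thesis unfolding l using e False i
      by (simp add: nth_append length_fst row_def del: upt_Suc rev_rev_ident length_rev)
  qed
qed

abbreviation row_key :: "nat \<times> nat option \<Rightarrow> int" where "row_key r \<equiv> - int (fst r)"

lemma pos_permutes: "pos permutes {1..N}"
  unfolding pos_def by (rule row_pos_permutes)

lemma val_eq: "val r = entry (pos r)"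
  by (simp add: val_def row_val_def pos_def entry_def)

lemma val_mono: "r \<in> {1..N} \<Longrightarrow> s \<in> {1..N} \<Longrightarrow> r < s \<Longrightarrow> val s < val r \<or> val s = val r \<and> pos r < pos s"
  unfolding val_def pos_def by (rule row_val_mono)

text \<open>\<open>before\<close> compares lengths first and positions second, which is the result
  of a stable sort of the rows listed by position.\<close>

lemma sort_rows: "sort_key row_key (map row [1..<N + 1]) = map (\<lambda>r. row (pos r)) [1..<N + 1]"
proof (rule properties_for_sort_key)
  show "mset (map (\<lambda>r. row (pos r)) [1..<N + 1]) = mset (map row [1..<N + 1])"
  proof -
    have "mset (map (\<lambda>r. row (pos r)) [1..<N + 1]) = image_mset row (image_mset pos (mset_set {1..N}))"
      unfolding mset_map mset_upt_Suc multiset.map_comp comp_def ..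
    then show ?thesis unfolding image_mset_permutes[OF pos_permutes] mset_map mset_upt_Suc .
  qed
  show "sorted (map row_key (map (\<lambda>r. row (pos r)) [1..<N + 1]))"
    unfolding map_map comp_def row_def fst_conv val_eq[symmetric] sorted_iff_nth_mono_less
  proof (intro allI impI)
    fix i j assume ij: "i < j" "j < length (map (\<lambda>r. - int (val r)) [1..<N + 1])"
    then have jN: "j < N" by (simp del: upt_Suc)
    then show "map (\<lambda>r. - int (val r)) [1..<N + 1] ! i \<le> map (\<lambda>r. - int (val r)) [1..<N + 1] ! j"
      using ij(1) val_mono[of "1 + i" "1 + j"] by (auto simp: nth_upt simp del: upt_Suc)
  qed
  fix k
  have "map pos (filter (\<lambda>r. row_key k = - int (val r)) [1..<N + 1]) = filter (\<lambda>p. row_key k = - int (entry p)) [1..<N + 1]"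
  proof (rule sorted_distinct_set_unique)
    let ?F = "filter (\<lambda>r. row_key k = - int (val r)) [1..<N + 1]"
    show "sorted (map pos ?F)"
      unfolding sorted_iff_nth_mono_less
    proof (intro allI impI)
      fix i j assume ij: "i < j" "j < length (map pos ?F)"
      then have l: "i < length ?F" "j < length ?F" by simp_all
      have "sorted_wrt (<) ?F" by (intro sorted_wrt_filter) (simp del: upt_Suc)
      then have "?F ! i < ?F ! j" using ij(1) l(2) by (rule sorted_wrt_nth_less)
      moreover have "?F ! i \<in> set ?F" "?F ! j \<in> set ?F" using l nth_mem by blast+
      ultimately have "pos (?F ! i) < pos (?F ! j)"
        using val_mono[of "?F ! i" "?F ! j"] by (auto simp del: upt_Suc)
      then show "map pos ?F ! i \<le> map pos ?F ! j" using l by simp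
    qed
    show "distinct (map pos ?F)"
      using inj_on_subset[OF permutes_inj[OF pos_permutes] subset_UNIV]
      by (simp add: distinct_map del: upt_Suc)
    show "set (map pos ?F) = set (filter (\<lambda>p. row_key k = - int (entry p)) [1..<N + 1])"
    proof (intro equalityI subsetI)
      fix p assume "p \<in> set (map pos ?F)"
      then obtain r where r: "p = pos r" "r \<in> {1..N}" "row_key k = - int (val r)" by (auto simp del: upt_Suc)
      then have "p \<in> {1..N}" using permutes_in_image[OF pos_permutes] by blast
      then show "p \<in> set (filter (\<lambda>p. row_key k = - int (entry p)) [1..<N + 1])"
        using r by (auto simp: val_eq simp del: upt_Suc)
    next
      fix p assume p: "p \<in> set (filter (\<lambda>p. row_key k = - int (entry p)) [1..<N + 1])"
      then have "p \<in> {1..N}" by (auto simp del: upt_Suc)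
      then obtain r where r: "p = pos r" "r \<in> {1..N}" using permutes_image[OF pos_permutes] by blast
      then show "p \<in> set (map pos ?F)" using p by (auto simp: val_eq simp del: upt_Suc)
    qed
  qed (simp_all add: sorted_wrt_filter del: upt_Suc)
  then have "map row (map pos (filter (\<lambda>r. row_key k = - int (val r)) [1..<N + 1]))
      = map row (filter (\<lambda>p. row_key k = - int (entry p)) [1..<N + 1])" by (rule arg_cong)
  then show "filter (\<lambda>x. row_key k = row_key x) (map (\<lambda>r. row (pos r)) [1..<N + 1])
      = filter (\<lambda>x. row_key k = row_key x) (map row [1..<N + 1])"
    by (simp add: filter_map comp_def row_def val_eq del: upt_Suc)
qed

text \<open>\<open>eta\<close> lists \<lambda> increasingly and with zeros, the diagram decreasingly
  and without. Rows of equal length without circle are indistinguishable, so the stable sort gives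
  the same list up to empty rows at the end.\<close>

lemma padded_rows:
  "diagram_rows \<Lambda> @ replicate (N - m - length (snd \<Lambda>)) (0, None) = map (\<lambda>r. row (pos r)) [1..<N + 1]"
proof -
  define C where "C = map (\<lambda>i. (fst \<Lambda> ! (i - 1), Some i)) [1..<length (fst \<Lambda>) + 1]"
  define Z where "Z = replicate (N - m - length (snd \<Lambda>)) (0::nat, None :: nat option)"
  let ?g = "\<lambda>k::nat. (k, None :: nat option)"
  have P: "map ?g (padded \<Lambda> N) = map ?g (snd \<Lambda>) @ Z" by (simp add: padded_def Z_def length_fst)
  have D: "diagram_rows \<Lambda> = sort_key row_key (C @ map ?g (snd \<Lambda>))" by (simp add: diagram_rows_def C_def)
  have "sort_key row_key (C @ map ?g (rev (padded \<Lambda> N))) = diagram_rows \<Lambda> @ Z"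
  proof (rule properties_for_sort_key)
    show "mset (diagram_rows \<Lambda> @ Z) = mset (C @ map ?g (rev (padded \<Lambda> N)))"
      unfolding rev_map[symmetric] P D by simp
    show "sorted (map row_key (diagram_rows \<Lambda> @ Z))"
      unfolding map_append sorted_append D by (auto simp: Z_def)
    fix k
    have rr: "filter (\<lambda>x. row_key k = row_key x) (map ?g (rev zs)) = filter (\<lambda>x. row_key k = row_key x) (map ?g zs)" for zs
    proof -
      have "filter (\<lambda>x. row_key k = row_key x) (map ?g zs) = replicate (length (filter (\<lambda>x. fst k = x) zs)) (fst k, None)" for zs
        by (induction zs) auto
      then show ?thesis by (simp add: rev_filter[symmetric])
    qed
    have st: "filter (\<lambda>x. row_key k = row_key x) (sort_key row_key xs) = filter (\<lambda>x. row_key k = row_key x) xs" for xs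
      using sort_key_stable[of row_key "row_key k" xs] by (simp only: eq_commute[of "row_key k"])
    show "filter (\<lambda>x. row_key k = row_key x) (diagram_rows \<Lambda> @ Z) = filter (\<lambda>x. row_key k = row_key x) (C @ map ?g (rev (padded \<Lambda> N)))"
      unfolding filter_append D st rr P by simp
  qed
  then show ?thesis unfolding Z_def C_def map_row[symmetric] sort_rows by (rule sym)
qed

lemma length_diagram_rows: "length (diagram_rows \<Lambda>) = m + length (snd \<Lambda>)"
  by (simp add: diagram_rows_def length_fst del: upt_Suc)

lemma diagram_rows_nth:
  assumes "1 \<le> r" "r \<le> m + length (snd \<Lambda>)"
  shows "diagram_rows \<Lambda> ! (r - 1) = row (pos r)"
proof -
  have "r - 1 < m + length (snd \<Lambda>)" using assms by simp
  then have "(diagram_rows \<Lambda> @ replicate (N - m - length (snd \<Lambda>)) (0, None)) ! (r - 1) = diagram_rows \<Lambda> ! (r - 1)"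
    by (simp add: nth_append length_diagram_rows)
  then show ?thesis unfolding padded_rows using assms le by (simp add: nth_upt del: upt_Suc)
qed

lemma row_beyond:
  assumes "m + length (snd \<Lambda>) < r" "r \<le> N"
  shows "val r = 0" "m < pos r"
proof -
  have "\<not> r - 1 < m + length (snd \<Lambda>)" using assms by simp
  then have "(diagram_rows \<Lambda> @ replicate (N - m - length (snd \<Lambda>)) (0, None)) ! (r - 1) = (0, None)"
    using assms by (simp add: nth_append length_diagram_rows nth_replicate)
  moreover have "[1..<N + 1] ! (r - 1) = r" using assms by (subst nth_upt) auto
  ultimately have "row (pos r) = (0, None)" unfolding padded_rows using assms by (simp del: upt_Suc)
  then show "val r = 0" "m < pos r" by (auto simp: row_def val_eq split: if_splits)
qed

section \<open>Squares, circles, arms and legs\<close>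

definition circ :: "nat \<Rightarrow> nat" where "circ r = of_bool (pos r \<le> m)"

lemma squares_eq: "squares \<Lambda> = {(i, j). i \<in> {1..N} \<and> j \<in> {1..val i}}"
proof -
  have "1 \<le> i \<and> i \<le> length (diagram_rows \<Lambda>) \<and> 1 \<le> j \<and> j \<le> row_len \<Lambda> i \<longleftrightarrow> i \<in> {1..N} \<and> j \<in> {1..val i}" for i j
  proof (cases "1 \<le> i \<and> i \<le> m + length (snd \<Lambda>)")
    case True
    then have "row_len \<Lambda> i = val i" using diagram_rows_nth[of i] by (simp add: row_len_def row_def val_eq)
    then show ?thesis using True le by (simp add: length_diagram_rows)
  next
    case False
    then show ?thesis using row_beyond(1)[of i] by (auto simp: length_diagram_rows)
  qed
  then show ?thesis unfolding squares_def by simp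
qed

lemma row_circle_eq: "1 \<le> i \<Longrightarrow> i \<le> m + length (snd \<Lambda>) \<Longrightarrow> row_circle \<Lambda> i = (if pos i \<le> m then Some (pos i) else None)"
  using diagram_rows_nth[of i] by (simp add: row_circle_def row_def)

lemma circles_eq: "circles \<Lambda> = {(i, j). i \<in> {1..N} \<and> pos i \<le> m \<and> j = val i + 1}"
proof -
  have "1 \<le> i \<and> i \<le> length (diagram_rows \<Lambda>) \<and> row_circle \<Lambda> i \<noteq> None \<and> j = row_len \<Lambda> i + 1
      \<longleftrightarrow> i \<in> {1..N} \<and> pos i \<le> m \<and> j = val i + 1" for i j
  proof (cases "1 \<le> i \<and> i \<le> m + length (snd \<Lambda>)")
    case True
    then have "row_len \<Lambda> i = val i" using diagram_rows_nth[of i] by (simp add: row_len_def row_def val_eq)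
    then show ?thesis using True le row_circle_eq[of i] by (auto simp: length_diagram_rows)
  next
    case False
    then show ?thesis using row_beyond(2)[of i] by (auto simp: length_diagram_rows)
  qed
  then show ?thesis unfolding circles_def by simp
qed

lemma cells_eq: "cells \<Lambda> = Sigma {1..N} (\<lambda>r. {1..val r + circ r})"
  unfolding cells_def squares_eq circles_eq by (auto simp: circ_def of_bool_def split: if_splits)

lemma cell_row_bound:
  assumes "r \<in> {1..N}" "j \<in> {1..val r + circ r}"
  shows "1 \<le> r" "r \<le> m + length (snd \<Lambda>)"
proof -
  show "r \<le> m + length (snd \<Lambda>)"
  proof (rule ccontr)
    assume "\<not> r \<le> m + length (snd \<Lambda>)"
    then show False using row_beyond[of r] assms by (auto simp: circ_def)
  qed
qed (use assms in simp)

lemma arm_eq: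
  assumes r: "r \<in> {1..N}" and j: "j \<in> {1..val r + circ r}"
  shows "arm \<Lambda> (r, j) = val r + circ r - j"
proof (cases "(r, j) \<in> circles \<Lambda>")
  case True
  then show ?thesis by (auto simp: arm_def circles_eq circ_def)
next
  case False
  have "{j'. j < j' \<and> (r, j') \<in> squares \<Lambda>} = {j + 1..val r}" using r by (auto simp: squares_eq)
  moreover have "j \<le> val r" using False j r by (auto simp: circles_eq circ_def of_bool_def split: if_splits)
  ultimately show ?thesis
    using False row_circle_eq[OF cell_row_bound[OF r j]] by (simp add: arm_def circ_def)
qed

text \<open>As the position of row r is at most m, every lower row with a smaller position has a
  circle too, so comparing fillings is comparing positions as in \<open>row_leg\<close>.\<close>

lemma leg_circle:
  assumes r: "r \<in> {1..N}" and c: "pos r \<le> m" and j: "1 \<le> j" "j \<le> val r"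
  shows "leg \<Lambda> (r, j) = row_leg N (eta \<Lambda> N) r j"
proof -
  have rb: "1 \<le> r" "r \<le> m + length (snd \<Lambda>)"
    using cell_row_bound[OF r, of j] j by auto
  have nc: "(r, j) \<notin> circles \<Lambda>" using j by (simp add: circles_eq)
  have "{i'. r < i' \<and> (i', j) \<in> circles \<Lambda> \<and> the (row_circle \<Lambda> i') < pos r}
     = {s\<in>{r + 1..N}. j = val s + 1 \<and> pos s < pos r}"
  proof (intro equalityI subsetI)
    fix s assume s: "s \<in> {i'. r < i' \<and> (i', j) \<in> circles \<Lambda> \<and> the (row_circle \<Lambda> i') < pos r}"
    then have s': "s \<in> {1..N}" "pos s \<le> m" "j = val s + 1" by (auto simp: circles_eq)
    have "s \<le> m + length (snd \<Lambda>)" using cell_row_bound[OF s'(1), of 1] s'(2) by (simp add: circ_def)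
    then have "row_circle \<Lambda> s = Some (pos s)" using row_circle_eq[of s] s' by simp
    then show "s \<in> {s\<in>{r + 1..N}. j = val s + 1 \<and> pos s < pos r}" using s s' by auto
  next
    fix s assume s: "s \<in> {s\<in>{r + 1..N}. j = val s + 1 \<and> pos s < pos r}"
    then have s': "s \<in> {1..N}" "pos s \<le> m" "j = val s + 1" using c by auto
    have "s \<le> m + length (snd \<Lambda>)" using cell_row_bound[OF s'(1), of 1] s'(2) by (simp add: circ_def)
    then have "row_circle \<Lambda> s = Some (pos s)" using row_circle_eq[of s] s' by simp
    then show "s \<in> {i'. r < i' \<and> (i', j) \<in> circles \<Lambda> \<and> the (row_circle \<Lambda> i') < pos r}"
      using s s' by (auto simp: circles_eq)
  qed
  moreover have "{i'. r < i' \<and> (i', j) \<in> squares \<Lambda>} = {s\<in>{r + 1..N}. j \<le> val s}"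
    using j by (auto simp: squares_eq)
  ultimately have "leg \<Lambda> (r, j) = card {s\<in>{r + 1..N}. j \<le> val s} + card {s\<in>{r + 1..N}. j = val s + 1 \<and> pos s < pos r}"
    using nc row_circle_eq[OF rb] c by (simp add: leg_def)
  also have "\<dots> = card ({s\<in>{r + 1..N}. j \<le> val s} \<union> {s\<in>{r + 1..N}. j = val s + 1 \<and> pos s < pos r})"
    by (rule card_Un_disjoint[symmetric]) auto
  also have "{s\<in>{r + 1..N}. j \<le> val s} \<union> {s\<in>{r + 1..N}. j = val s + 1 \<and> pos s < pos r}
      = {s\<in>{r + 1..N}. j \<le> val s + of_bool (pos s < pos r)}"
    by (auto simp: of_bool_def split: if_splits)
  finally show ?thesis by (simp add: row_leg_def val_def pos_def)
qed

lemma leg_circle_cell: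
  assumes "r \<in> {1..N}" "pos r \<le> m"
  shows "leg \<Lambda> (r, val r + 1) = 0"
  using assms by (simp add: leg_def circles_eq)

lemma leg_plain:
  assumes r: "r \<in> {1..N}" and c: "m < pos r" and j: "1 \<le> j" "j \<le> val r"
  shows "leg \<Lambda> (r, j) = card {s\<in>{r + 1..N}. j \<le> val s}"
proof -
  have rb: "1 \<le> r" "r \<le> m + length (snd \<Lambda>)"
    using cell_row_bound[OF r, of j] j by auto
  have "(r, j) \<notin> circles \<Lambda>" using j by (simp add: circles_eq)
  moreover have "{i'. r < i' \<and> (i', j) \<in> squares \<Lambda>} = {s\<in>{r + 1..N}. j \<le> val s}"
    using j by (auto simp: squares_eq)
  ultimately show ?thesis using row_circle_eq[OF rb] c by (simp add: leg_def)
qed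

text \<open>Since \<open>\<lambda>\<close> is stored increasingly, every lower row of smaller length sits further left.\<close>

lemma row_leg_plain:
  assumes r: "r \<in> {1..N}" and c: "m < pos r" and j: "1 \<le> j" "j \<le> val r"
  shows "row_leg N (eta \<Lambda> N) r j = card {s\<in>{r + 1..N}. j - 1 \<le> val s}"
proof -
  have "j \<le> val s + of_bool (pos s < pos r) \<longleftrightarrow> j - 1 \<le> val s" if s: "s \<in> {r + 1..N}" for s
  proof -
    have "pos s < pos r" if "val s < val r"
    proof (rule ccontr)
      assume n: "\<not> pos s < pos r"
      have "pos s \<in> {1..N}" using permutes_in_image[OF pos_permutes, of s] s r by auto
      then have "entry (pos r) \<le> entry (pos s)" using entry_mono[of "pos r" "pos s"] c n by auto
      then show False using that by (simp add: val_eq)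
    qed
    then show ?thesis using j by (cases "val s < val r") auto
  qed
  then have "{s\<in>{r + 1..N}. j \<le> val s + of_bool (pos s < pos r)} = {s\<in>{r + 1..N}. j - 1 \<le> val s}" by blast
  then show ?thesis by (simp add: row_leg_def val_def pos_def)
qed

end

subsection \<open>Comparison with the product over the cells\<close>

text \<open>Co-arms run over 0, ..., v - 1 and the index of \<open>row_product\<close> over 1, ...,
  v; this exchanges the two ranges.\<close>

lemma prod_shift_last: "(\<Prod>j\<in>{1..v}. h (j - 1)) * h v = h 0 * (\<Prod>k\<in>{1..v}. h k)"
  for h :: "nat \<Rightarrow> 'a::comm_monoid_mult"
  by (induction v) (simp_all add: ac_simps)

lemma prod_reverse: "(\<Prod>k\<in>{1..v}. h k) = (\<Prod>j\<in>{1..v}. h (v + 1 - j))"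
  for h :: "nat \<Rightarrow> 'a::comm_monoid_mult"
  by (rule prod.reindex_bij_witness[of _ "\<lambda>j. v + 1 - j" "\<lambda>j. v + 1 - j"]) auto

lemma card_pairs:
  "card {(i, j). i \<in> {1..N} \<and> j \<in> {1..N} \<and> P i j} = (\<Sum>j\<in>{1..N}. \<Sum>i\<in>{1..N}. of_bool (P i j))" for N :: nat
proof -
  have "{(i, j). i \<in> {1..N} \<and> j \<in> {1..N} \<and> P i j} = Sigma {1..N} (\<lambda>i. {j\<in>{1..N}. P i j})" by auto
  then have "card {(i, j). i \<in> {1..N} \<and> j \<in> {1..N} \<and> P i j} = (\<Sum>i\<in>{1..N}. card {j\<in>{1..N}. P i j})"
    by simp
  also have "\<dots> = (\<Sum>i\<in>{1..N}. \<Sum>j\<in>{1..N}. of_bool (P i j))"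
    by (simp add: Int_def)
  also have "\<dots> = (\<Sum>j\<in>{1..N}. \<Sum>i\<in>{1..N}. of_bool (P i j))" by (rule sum.swap)
  finally show ?thesis .
qed

lemma sum_triangular:
  fixes m N :: nat
  assumes "m \<le> N"
  shows "(\<Sum>j\<in>{1..N}. \<Sum>i\<in>{1..N}. of_bool (m < i \<and> i < j)) = (N - m) * (N - m - 1) div 2"
proof -
  have "(\<Sum>i\<in>{1..N}. of_bool (m < i \<and> i < j)) = j - 1 - m" if "j \<in> {1..N}" for j
  proof -
    have "(\<Sum>i\<in>{1..N}. of_bool (m < i \<and> i < j)) = card {i\<in>{1..N}. m < i \<and> i < j}" by (simp add: Int_def)
    also have "{i\<in>{1..N}. m < i \<and> i < j} = {m + 1..<j}" using that by auto
    finally show ?thesis by simp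
  qed
  then have "(\<Sum>j\<in>{1..N}. \<Sum>i\<in>{1..N}. of_bool (m < i \<and> i < j)) = (\<Sum>j\<in>{1..N}. j - 1 - m)" by simp
  also have "2 * (\<Sum>j\<in>{1..N}. j - 1 - m) = (N - m) * (N - m - 1)"
    using assms
  proof (induction N rule: dec_induct)
    case base
    have "(\<Sum>j\<in>{1..m}. j - 1 - m) = 0" by (rule sum.neutral) auto
    then show ?case by simp
  next
    case (step N)
    obtain d where "N = m + d" using step.hyps le_Suc_ex by blast
    then show ?case using step.IH by (cases d) (simp_all add: algebra_simps)
  qed
  then have "(\<Sum>j\<in>{1..N}. j - 1 - m) = (N - m) * (N - m - 1) div 2" by linarith
  finally show ?thesis .
qed

context padded_diagram
begin

text \<open>For p > m this is the number of later copies of the entry in the increasing list of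
  \<lambda>, hence gives one factor of \<open>u_norm\<close>.\<close>

definition ties :: "nat \<Rightarrow> nat" where
  "ties p = card {p'\<in>{p + 1..N}. entry p' = entry p}"

definition cell_factor :: "nat \<times> nat \<Rightarrow> qt" where
  "cell_factor s = (1 - qq ^ coarm s * tt powi (int N - int (coleg s))) /
       (1 - qq ^ arm \<Lambda> s * tt ^ (leg \<Lambda> s + 1))"

lemma cell_factor_eq:
  assumes r: "r \<in> {1..N}" and j: "j \<in> {1..val r + circ r}"
  shows "cell_factor (r, j) = (1 - qq ^ (j - 1) * tt ^ (N - r + 1)) /
     (1 - qq ^ (val r + circ r - j) * tt ^ (leg \<Lambda> (r, j) + 1))"
proof -
  have "int N - int (r - 1) = int (N - r + 1)" using r by auto
  then have "tt powi (int N - int (r - 1)) = tt ^ (N - r + 1)" by (simp only: power_int_of_nat)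
  then show ?thesis unfolding cell_factor_def arm_eq[OF r j] by (simp add: coarm_def coleg_def)
qed

lemma row_product_reverse:
  "row_product N (eta \<Lambda> N) r = (\<Prod>k\<in>{1..val r}. 1 - qq ^ k * tt ^ (N - r + 1)) /
    (\<Prod>j\<in>{1..val r}. 1 - qq ^ (val r + 1 - j) * tt ^ (row_leg N (eta \<Lambda> N) r j + 1))"
proof -
  let ?v = "val r" and ?L = "row_leg N (eta \<Lambda> N) r"
  have "(\<Prod>k\<in>{1..?v}. 1 - qq ^ k * tt ^ (?L (?v + 1 - k) + 1))
      = (\<Prod>j\<in>{1..?v}. 1 - qq ^ (?v + 1 - j) * tt ^ (?L (?v + 1 - (?v + 1 - j)) + 1))"
    by (rule prod_reverse)
  also have "\<dots> = (\<Prod>j\<in>{1..?v}. 1 - qq ^ (?v + 1 - j) * tt ^ (?L j + 1))"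
    by (rule prod.cong) auto
  finally show ?thesis unfolding row_product_def prod_dividef val_def[symmetric] by simp
qed

text \<open>The circle adds a numerator, so that the powers of q run over 0, ..., v; its denominator
  is 1 - t, because its arm and leg are 0.\<close>

lemma circle_row_product:
  assumes r: "r \<in> {1..N}" and c: "pos r \<le> m"
  shows "(\<Prod>j\<in>{1..val r + circ r}. cell_factor (r, j)) * (1 - tt)
    = (1 - tt ^ (N - r + 1)) * row_product N (eta \<Lambda> N) r"
proof -
  let ?v = "val r" and ?n = "N - r + 1" and ?L = "row_leg N (eta \<Lambda> N) r"
  have ci: "circ r = 1" using c by (simp add: circ_def)
  have "cell_factor (r, j) = (1 - qq ^ (j - 1) * tt ^ ?n) / (1 - qq ^ (?v + 1 - j) * tt ^ (?L j + 1))"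
    if "j \<in> {1..?v}" for j
    using cell_factor_eq[OF r, of j] that leg_circle[OF r c, of j] unfolding ci by simp
  then have "(\<Prod>j\<in>{1..?v}. cell_factor (r, j))
      = (\<Prod>j\<in>{1..?v}. (1 - qq ^ (j - 1) * tt ^ ?n) / (1 - qq ^ (?v + 1 - j) * tt ^ (?L j + 1)))"
    by (rule prod.cong[OF refl])
  also have "\<dots> = (\<Prod>j\<in>{1..?v}. 1 - qq ^ (j - 1) * tt ^ ?n) / (\<Prod>j\<in>{1..?v}. 1 - qq ^ (?v + 1 - j) * tt ^ (?L j + 1))"
    by (rule prod_dividef)
  finally have 1: "(\<Prod>j\<in>{1..?v}. cell_factor (r, j))
    = (\<Prod>j\<in>{1..?v}. 1 - qq ^ (j - 1) * tt ^ ?n) / (\<Prod>j\<in>{1..?v}. 1 - qq ^ (?v + 1 - j) * tt ^ (?L j + 1))" .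
  have "cell_factor (r, ?v + 1) = (1 - qq ^ ?v * tt ^ ?n) / (1 - tt)"
    using cell_factor_eq[OF r, of "?v + 1"] leg_circle_cell[OF r c] unfolding ci by simp
  then have "(\<Prod>j\<in>{1..?v + circ r}. cell_factor (r, j)) * (1 - tt)
      = ((\<Prod>j\<in>{1..?v}. 1 - qq ^ (j - 1) * tt ^ ?n) * (1 - qq ^ ?v * tt ^ ?n)) /
        (\<Prod>j\<in>{1..?v}. 1 - qq ^ (?v + 1 - j) * tt ^ (?L j + 1))"
    unfolding ci by (simp add: 1[unfolded One_nat_def])
  also have "(\<Prod>j\<in>{1..?v}. 1 - qq ^ (j - 1) * tt ^ ?n) * (1 - qq ^ ?v * tt ^ ?n)
      = (1 - qq ^ 0 * tt ^ ?n) * (\<Prod>k\<in>{1..?v}. 1 - qq ^ k * tt ^ ?n)"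
    by (rule prod_shift_last)
  finally show ?thesis unfolding row_product_reverse by simp
qed

text \<open>Lengths decrease weakly downwards and ties are listed by position: a lower row at least
  as long has equal length and lies further right.\<close>

lemma ties_pos:
  assumes r: "r \<in> {1..N}"
  shows "card {s\<in>{r + 1..N}. val r \<le> val s} = ties (pos r)"
proof -
  have "card {s\<in>{r + 1..N}. val r \<le> val s} = card (pos ` {s\<in>{r + 1..N}. val r \<le> val s})"
    by (rule card_image[symmetric]) (rule inj_on_subset[OF permutes_inj[OF pos_permutes] subset_UNIV])
  also have "pos ` {s\<in>{r + 1..N}. val r \<le> val s} = {p'\<in>{pos r + 1..N}. entry p' = entry (pos r)}"
  proof (intro equalityI subsetI)
    fix p assume "p \<in> pos ` {s\<in>{r + 1..N}. val r \<le> val s}"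
    then obtain s where s: "p = pos s" "s \<in> {r + 1..N}" "val r \<le> val s" by blast
    have "s \<in> {1..N}" using s r by simp
    then have "val s = val r" "pos r < pos s" "pos s \<in> {1..N}"
      using val_mono[OF r, of s] s permutes_in_image[OF pos_permutes, of s] by auto
    then show "p \<in> {p'\<in>{pos r + 1..N}. entry p' = entry (pos r)}" using s by (simp add: val_eq)
  next
    fix p assume p: "p \<in> {p'\<in>{pos r + 1..N}. entry p' = entry (pos r)}"
    then have "p \<in> {1..N}" by simp
    then obtain s where s: "p = pos s" "s \<in> {1..N}" using permutes_image[OF pos_permutes] by blast
    have "val s = val r" "pos r < pos s" using p s by (auto simp: val_eq)
    then have "\<not> s < r" "s \<noteq> r" using val_mono[of s r] s r by auto
    then show "p \<in> pos ` {s\<in>{r + 1..N}. val r \<le> val s}" using s \<open>val s = val r\<close> by auto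
  qed
  finally show ?thesis by (simp add: ties_def)
qed

text \<open>g j is the denominator of the cell in column j, and by \<open>row_leg_plain\<close> g (j
  - 1) is that of the row product. Shifting both products leaves h 0 / g v, because all lower rows
  count at j = 0 and thus g 0 = h v.\<close>

lemma plain_row_product:
  assumes r: "r \<in> {1..N}" and c: "m < pos r"
  shows "(\<Prod>j\<in>{1..val r + circ r}. cell_factor (r, j)) * (1 - tt ^ (ties (pos r) + 1))
    = (1 - tt ^ (N - r + 1)) * row_product N (eta \<Lambda> N) r"
proof -
  define v where "v = val r"
  define A where "A = (\<lambda>j. card {s\<in>{r + 1..N}. j \<le> val s})"
  define h where "h = (\<lambda>k. 1 - qq ^ k * tt ^ (N - r + 1))"
  define g where "g = (\<lambda>j. 1 - qq ^ (v - j) * tt ^ (A j + 1))"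
  have gnz: "g j \<noteq> 0" for j unfolding g_def by (rule one_minus_nonzero) simp
  have ci: "circ r = 0" using c by (simp add: circ_def)
  have "cell_factor (r, j) = h (j - 1) / g j" if "j \<in> {1..v}" for j
    using cell_factor_eq[OF r, of j] that leg_plain[OF r c, of j] unfolding ci v_def
    by (simp add: h_def g_def A_def v_def)
  then have "(\<Prod>j\<in>{1..v + circ r}. cell_factor (r, j)) = (\<Prod>j\<in>{1..v}. h (j - 1) / g j)"
    unfolding ci by (intro prod.cong) auto
  then have T: "(\<Prod>j\<in>{1..v + circ r}. cell_factor (r, j)) = (\<Prod>j\<in>{1..v}. h (j - 1)) / (\<Prod>j\<in>{1..v}. g j)"
    by (simp only: prod_dividef)
  have "(\<Prod>j\<in>{1..v}. 1 - qq ^ (v + 1 - j) * tt ^ (row_leg N (eta \<Lambda> N) r j + 1)) = (\<Prod>j\<in>{1..v}. g (j - 1))"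
  proof (rule prod.cong[OF refl])
    fix j assume j: "j \<in> {1..v}"
    then have "v + 1 - j = v - (j - 1)" by auto
    then show "1 - qq ^ (v + 1 - j) * tt ^ (row_leg N (eta \<Lambda> N) r j + 1) = g (j - 1)"
      using row_leg_plain[OF r c, of j] j unfolding g_def A_def v_def by simp
  qed
  then have R: "row_product N (eta \<Lambda> N) r = (\<Prod>k\<in>{1..v}. h k) / (\<Prod>j\<in>{1..v}. g (j - 1))"
    unfolding row_product_reverse h_def v_def by simp
  have "{s\<in>{r + 1..N}. 0 \<le> val s} = {r + 1..N}" by auto
  then have "A 0 = N - r" unfolding A_def by simp
  then have g0: "g 0 = h v" by (simp add: g_def h_def)
  have gv: "g v = 1 - tt ^ (ties (pos r) + 1)" using ties_pos[OF r] by (simp add: g_def A_def v_def)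
  have h0: "h 0 = 1 - tt ^ (N - r + 1)" by (simp add: h_def)
  note H = prod_shift_last[of h v] and G = prod_shift_last[of g v]
  have nz: "(\<Prod>j\<in>{1..v}. g j) \<noteq> 0" "(\<Prod>j\<in>{1..v}. g (j - 1)) \<noteq> 0" using gnz by (simp_all add: prod_zero_iff)
  have "(\<Prod>j\<in>{1..v}. h (j - 1)) * g v * (\<Prod>j\<in>{1..v}. g (j - 1))
      = (\<Prod>j\<in>{1..v}. h (j - 1)) * ((\<Prod>j\<in>{1..v}. g (j - 1)) * g v)" by (simp only: ac_simps)
  also have "\<dots> = ((\<Prod>j\<in>{1..v}. h (j - 1)) * h v) * (\<Prod>j\<in>{1..v}. g j)"
    unfolding G g0 by (simp only: ac_simps)
  also have "\<dots> = h 0 * (\<Prod>k\<in>{1..v}. h k) * (\<Prod>j\<in>{1..v}. g j)" unfolding H ..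
  finally have "(\<Prod>j\<in>{1..v}. h (j - 1)) / (\<Prod>j\<in>{1..v}. g j) * g v = h 0 * ((\<Prod>k\<in>{1..v}. h k) / (\<Prod>j\<in>{1..v}. g (j - 1)))"
    using nz by (simp add: frac_eq_eq)
  then show ?thesis unfolding v_def[symmetric] T R gv[symmetric] h0[symmetric] .
qed

section \<open>The product over all cells and the normalization\<close>

lemma sum_pos: "(\<Sum>r\<in>{1..N}. f (pos r)) = (\<Sum>p\<in>{1..N}. f p)"
  using sum.permute[OF pos_permutes, of f] by (simp add: comp_def)

lemma prod_pos: "(\<Prod>r\<in>{1..N}. f (pos r)) = (\<Prod>p\<in>{1..N}. f p)"
  using prod.permute[OF pos_permutes, of f] by (simp add: comp_def)

lemma split_interval: "{1..N} = {1..m} \<union> {m + 1..N}" "{1..m} \<inter> {m + 1..N} = {}"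
  using m_le by auto

text \<open>The rows contribute 1 - t^{N-r+1}, together the numerator of the factorial of N. The N
  factors 1 - t of its denominator split into m from the rows with circles and N - m that normalize
  the factors of the ties.\<close>

lemma prod_cells:
  "(\<Prod>s\<in>cells \<Lambda>. cell_factor s) * (\<Prod>p\<in>{m + 1..N}. (1 - tt ^ (ties p + 1)) / (1 - tt))
    = qfact tt N * pair_product N (eta \<Lambda> N)"
proof -
  define d where "d = (\<lambda>p. if p \<le> m then 1 - tt else 1 - tt ^ (ties p + 1))"
  have row: "(\<Prod>j\<in>{1..val r + circ r}. cell_factor (r, j)) * d (pos r)
      = (1 - tt ^ (N - r + 1)) * row_product N (eta \<Lambda> N) r" if "r \<in> {1..N}" for r
    using circle_row_product[OF that] plain_row_product[OF that] by (simp add: d_def)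
  have "(\<Prod>s\<in>cells \<Lambda>. cell_factor s) = (\<Prod>r\<in>{1..N}. \<Prod>j\<in>{1..val r + circ r}. cell_factor (r, j))"
    unfolding cells_eq by (subst prod.Sigma) auto
  moreover have "(\<Prod>r\<in>{1..N}. d (pos r)) = (\<Prod>p\<in>{1..N}. d p)" by (rule prod_pos)
  ultimately have 1: "(\<Prod>s\<in>cells \<Lambda>. cell_factor s) * (\<Prod>p\<in>{1..N}. d p)
      = (\<Prod>r\<in>{1..N}. (\<Prod>j\<in>{1..val r + circ r}. cell_factor (r, j)) * d (pos r))"
    by (simp only: prod.distrib)
  also have "\<dots> = (\<Prod>r\<in>{1..N}. (1 - tt ^ (N - r + 1)) * row_product N (eta \<Lambda> N) r)"
    by (rule prod.cong[OF refl]) (rule row)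
  also have "\<dots> = (\<Prod>r\<in>{1..N}. 1 - tt ^ (N - r + 1)) * pair_product N (eta \<Lambda> N)"
    unfolding pair_product_rows prod.distrib ..
  also have "(\<Prod>r\<in>{1..N}. 1 - tt ^ (N - r + 1)) = (\<Prod>i\<in>{1..N}. 1 - tt ^ i)"
    by (rule prod.reindex_bij_witness[of _ "\<lambda>j. N + 1 - j" "\<lambda>j. N + 1 - j"]) (auto simp: Suc_diff_le)
  also have "\<dots> = qfact tt N * (1 - tt) ^ N"
    unfolding qfact_def prod_dividef by simp
  finally have 2: "(\<Prod>s\<in>cells \<Lambda>. cell_factor s) * (\<Prod>p\<in>{1..N}. d p)
      = qfact tt N * (1 - tt) ^ N * pair_product N (eta \<Lambda> N)" .
  have "(\<Prod>p\<in>{1..N}. d p) = (\<Prod>p\<in>{1..m}. d p) * (\<Prod>p\<in>{m + 1..N}. d p)"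
    unfolding split_interval(1) by (rule prod.union_disjoint) auto
  also have "(\<Prod>p\<in>{1..m}. d p) = (\<Prod>p\<in>{1..m}. 1 - tt)" by (rule prod.cong) (auto simp: d_def)
  also have "\<dots> = (1 - tt) ^ m" by simp
  also have "(\<Prod>p\<in>{m + 1..N}. d p) = (\<Prod>p\<in>{m + 1..N}. 1 - tt ^ (ties p + 1))"
    by (rule prod.cong) (auto simp: d_def)
  also have "\<dots> = (\<Prod>p\<in>{m + 1..N}. (1 - tt ^ (ties p + 1)) / (1 - tt)) * (1 - tt) ^ (N - m)"
    unfolding prod_dividef by simp
  also have "(1 - tt) ^ m * ((\<Prod>p\<in>{m + 1..N}. (1 - tt ^ (ties p + 1)) / (1 - tt)) * (1 - tt) ^ (N - m))
      = (1 - tt) ^ N * (\<Prod>p\<in>{m + 1..N}. (1 - tt ^ (ties p + 1)) / (1 - tt))"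
    using m_le by (simp add: power_add[symmetric] mult.left_commute mult.commute)
  finally have "(1 - tt) ^ N * ((\<Prod>s\<in>cells \<Lambda>. cell_factor s) * (\<Prod>p\<in>{m + 1..N}. (1 - tt ^ (ties p + 1)) / (1 - tt)))
      = (1 - tt) ^ N * (qfact tt N * pair_product N (eta \<Lambda> N))"
    using 2 by (simp only: ac_simps)
  then show ?thesis by simp
qed

lemma ties_count_list:
  assumes "i < N - m"
  shows "count_list (drop (i + 1) (rev (padded \<Lambda> N))) (rev (padded \<Lambda> N) ! i) = ties (m + 1 + i)"
proof -
  let ?ys = "rev (padded \<Lambda> N)"
  have len: "length ?ys = N - m" by (simp add: length_padded)
  have "count_list (drop (i + 1) ?ys) (?ys ! i) = card {j\<in>{i + 1..<N - m}. ?ys ! j = ?ys ! i}"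
    using count_list_drop[of i ?ys] assms unfolding len by blast
  also have "\<dots> = card ((\<lambda>j. m + 1 + j) ` {j\<in>{i + 1..<N - m}. ?ys ! j = ?ys ! i})"
    by (rule card_image[symmetric]) (simp add: inj_on_def)
  also have "(\<lambda>j. m + 1 + j) ` {j\<in>{i + 1..<N - m}. ?ys ! j = ?ys ! i}
      = {p'\<in>{m + 1 + i + 1..N}. entry p' = entry (m + 1 + i)}"
  proof (intro equalityI subsetI)
    fix p assume "p \<in> (\<lambda>j. m + 1 + j) ` {j\<in>{i + 1..<N - m}. ?ys ! j = ?ys ! i}"
    then obtain j where j: "p = m + 1 + j" "j \<in> {i + 1..<N - m}" "?ys ! j = ?ys ! i" by blast
    then have "m + 1 + j \<le> N" by auto
    then show "p \<in> {p'\<in>{m + 1 + i + 1..N}. entry p' = entry (m + 1 + i)}"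
      using j entry_snd[OF assms] entry_snd[of j] by simp
  next
    fix p assume p: "p \<in> {p'\<in>{m + 1 + i + 1..N}. entry p' = entry (m + 1 + i)}"
    define j where "j = p - (m + 1)"
    have j: "p = m + 1 + j" "j \<in> {i + 1..<N - m}" using p by (auto simp: j_def)
    then have "?ys ! j = ?ys ! i" using p entry_snd[OF assms] entry_snd[of j] by simp
    then show "p \<in> (\<lambda>j. m + 1 + j) ` {j\<in>{i + 1..<N - m}. ?ys ! j = ?ys ! i}" using j by blast
  qed
  finally show ?thesis by (simp add: ties_def)
qed

text \<open>Passing from 1/t to t turns the q-integer of k + 1 into t^{-k} times itself. Taken
  factor by factor, these powers are collected on the left.\<close>

lemma u_norm_eq:
  "u_norm \<Lambda> N * tt ^ (\<Sum>p\<in>{m + 1..N}. ties p)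
    = (\<Prod>p\<in>{m + 1..N}. (1 - tt ^ (ties p + 1)) / (1 - tt)) * tt ^ ((N - m) * (N - m - 1) div 2)"
proof -
  let ?ys = "rev (padded \<Lambda> N)" and ?x = "inverse tt"
  have fac: "(1 - ?x ^ (k + 1)) / (1 - ?x) * tt ^ k = (1 - tt ^ (k + 1)) / (1 - tt)" for k
  proof -
    have "?x ^ (k + 1) * tt ^ (k + 1) = 1"
      unfolding power_mult_distrib[symmetric] left_inverse[OF tt_nonzero] by simp
    then have "(1 - ?x ^ (k + 1)) * tt ^ (k + 1) = tt ^ (k + 1) - 1"
      unfolding left_diff_distrib by (simp only: mult_1_left)
    moreover have "(1 - ?x) * tt = tt - 1" by (simp add: left_diff_distrib)
    ultimately have "(1 - ?x ^ (k + 1)) / (1 - ?x) * tt ^ k = (tt ^ (k + 1) - 1) / (tt - 1)"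
      by (metis (no_types, lifting) mult_divide_mult_cancel_right power_Suc2 Suc_eq_plus1 tt_nonzero
          times_divide_eq_left mult.assoc)
    also have "\<dots> = (1 - tt ^ (k + 1)) / (1 - tt)" by (metis minus_diff_eq minus_divide_divide)
    finally show ?thesis .
  qed
  have "(\<Prod>i\<in>set (padded \<Lambda> N). qfact ?x (count_list (padded \<Lambda> N) i)) = (\<Prod>i\<in>set ?ys. qfact ?x (count_list ?ys i))"
    by simp
  also have "\<dots> = (\<Prod>i\<in>{..<N - m}. (1 - ?x ^ (ties (m + 1 + i) + 1)) / (1 - ?x))"
    unfolding prod_qfact_count_list length_rev length_padded
    by (rule prod.cong[OF refl]) (simp only: ties_count_list lessThan_iff)
  also have "\<dots> = (\<Prod>p\<in>{m + 1..N}. (1 - ?x ^ (ties p + 1)) / (1 - ?x))"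
    by (rule prod.reindex_bij_witness[of _ "\<lambda>p. p - (m + 1)" "\<lambda>i. m + 1 + i"]) auto
  finally have F: "(\<Prod>i\<in>set (padded \<Lambda> N). qfact ?x (count_list (padded \<Lambda> N) i)) * tt ^ (\<Sum>p\<in>{m + 1..N}. ties p)
      = (\<Prod>p\<in>{m + 1..N}. (1 - ?x ^ (ties p + 1)) / (1 - ?x) * tt ^ ties p)"
    unfolding power_sum prod.distrib by (simp only:)
  have "u_norm \<Lambda> N * tt ^ (\<Sum>p\<in>{m + 1..N}. ties p)
      = (\<Prod>i\<in>set (padded \<Lambda> N). qfact ?x (count_list (padded \<Lambda> N) i)) * tt ^ (\<Sum>p\<in>{m + 1..N}. ties p)
        * tt ^ ((N - m) * (N - m - 1) div 2)"
    unfolding u_norm_def Let_def length_fst by (simp only: ac_simps)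
  then show ?thesis unfolding F fac .
qed

text \<open>Among rows of equal length those with circles come first, so turning circles into
  squares keeps the lengths weakly decreasing.\<close>

lemma squared_partition_eq:
  "squared_partition \<Lambda> = map (\<lambda>r. val r + circ r) [1..<m + length (snd \<Lambda>) + 1]"
proof -
  let ?ys = "map (\<lambda>r. val r + circ r) [1..<m + length (snd \<Lambda>) + 1]"
  let ?f = "\<lambda>x :: nat \<times> nat option. fst x + of_bool (snd x \<noteq> None) :: nat"
  have "?ys = map ?f (diagram_rows \<Lambda>)"
  proof (rule nth_equalityI)
    show "length ?ys = length (map ?f (diagram_rows \<Lambda>))" by (simp add: length_diagram_rows del: upt_Suc)
    fix i assume "i < length ?ys"
    then have i: "i < m + length (snd \<Lambda>)" by (simp del: upt_Suc)
    have "diagram_rows \<Lambda> ! i = row (pos (1 + i))" using diagram_rows_nth[of "1 + i"] i by simp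
    then show "?ys ! i = map ?f (diagram_rows \<Lambda>) ! i"
      using i by (simp add: nth_upt length_diagram_rows row_def val_eq circ_def del: upt_Suc)
  qed
  then have "mset ?ys = image_mset ?f (mset (diagram_rows \<Lambda>))" by (simp only: mset_map)
  also have "\<dots> = mset (map ?f (map (\<lambda>i. (fst \<Lambda> ! (i - 1), Some i)) [1..<length (fst \<Lambda>) + 1] @ map (\<lambda>k. (k, None)) (snd \<Lambda>)))"
    unfolding diagram_rows_def mset_sort mset_map ..
  also have "map ?f (map (\<lambda>i. (fst \<Lambda> ! (i - 1), Some i)) [1..<length (fst \<Lambda>) + 1] @ map (\<lambda>k. (k, None)) (snd \<Lambda>))
      = map (\<lambda>k. k + 1) (fst \<Lambda>) @ snd \<Lambda>"
  proof -
    have "map (\<lambda>i. fst \<Lambda> ! (i - 1) + 1) [1..<length (fst \<Lambda>) + 1] = map (\<lambda>k. k + 1) (fst \<Lambda>)"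
      by (rule nth_equalityI) (simp_all add: nth_upt del: upt_Suc)
    then show ?thesis by (simp add: comp_def del: upt_Suc)
  qed
  finally have ms: "mset (rev ?ys) = mset (map (\<lambda>k. k + 1) (fst \<Lambda>) @ snd \<Lambda>)" by (simp only: mset_rev)
  have "sorted (rev ?ys)"
    unfolding sorted_rev_iff_nth_mono
  proof (intro allI impI)
    fix i j assume ij: "i \<le> j" "j < length ?ys"
    then have j: "j < m + length (snd \<Lambda>)" by (simp del: upt_Suc)
    have n: "?ys ! j = val (1 + j) + circ (1 + j)" "?ys ! i = val (1 + i) + circ (1 + i)"
      using ij j by (simp_all add: nth_upt del: upt_Suc)
    show "?ys ! j \<le> ?ys ! i"
    proof (cases "i = j")
      case False
      then have "val (1 + j) < val (1 + i) \<or> val (1 + j) = val (1 + i) \<and> pos (1 + i) < pos (1 + j)"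
        using val_mono[of "1 + i" "1 + j"] ij j le by auto
      then show ?thesis unfolding n by (auto simp: circ_def)
    qed simp
  qed
  then have "sort (map (\<lambda>k. k + 1) (fst \<Lambda>) @ snd \<Lambda>) = rev ?ys" by (rule properties_for_sort[OF ms])
  then show ?thesis unfolding squared_partition_def by (simp only: rev_rev_ident)
qed

section \<open>The power of t\<close>

lemma mpart_n_eq:
  "mpart_n \<Lambda> = (\<Sum>p\<in>{1..N}. (rank N (eta \<Lambda> N) p - 1) * entry p)
    + (\<Sum>p\<in>{1..N}. (rank N (eta \<Lambda> N) p - 1) * of_bool (p \<le> m))"
proof -
  let ?n = "m + length (snd \<Lambda>)"
  have "mpart_n \<Lambda> = (\<Sum>i\<in>{1..?n}. (i - 1) * squared_partition \<Lambda> ! (i - 1))"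
    unfolding mpart_n_def partition_n_def squared_partition_eq by (simp del: upt_Suc)
  also have "\<dots> = (\<Sum>i\<in>{1..?n}. (i - 1) * (val i + circ i))"
    unfolding squared_partition_eq
    by (rule sum.cong[OF refl]) (auto simp: nth_upt simp del: upt_Suc)
  also have "\<dots> = (\<Sum>i\<in>{1..N}. (i - 1) * (val i + circ i))"
  proof (rule sum.mono_neutral_left)
    show "\<forall>i\<in>{1..N} - {1..?n}. (i - 1) * (val i + circ i) = 0"
    proof
      fix i assume "i \<in> {1..N} - {1..?n}"
      then have "?n < i" "i \<le> N" by auto
      then show "(i - 1) * (val i + circ i) = 0" using row_beyond[of i] by (simp add: circ_def)
    qed
  qed (use le in auto)
  also have "\<dots> = (\<Sum>r\<in>{1..N}. (rank N (eta \<Lambda> N) (pos r) - 1) * entry (pos r) + (rank N (eta \<Lambda> N) (pos r) - 1) * of_bool (pos r \<le> m))"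
    by (rule sum.cong[OF refl])
      (simp add: pos_def rank_row_pos circ_def val_eq[unfolded pos_def] distrib_left del: atLeastAtMost_iff)
  also have "\<dots> = (\<Sum>p\<in>{1..N}. (rank N (eta \<Lambda> N) p - 1) * entry p + (rank N (eta \<Lambda> N) p - 1) * of_bool (p \<le> m))"
    by (rule sum_pos)
  finally show ?thesis by (simp only: sum.distrib)
qed

lemma coInv_eq: "coInv (fst \<Lambda>) = (\<Sum>j\<in>{1..N}. \<Sum>i\<in>{1..N}. of_bool (i < j \<and> j \<le> m \<and> entry j \<le> entry i))"
proof -
  have "{(i, j). 1 \<le> i \<and> i < j \<and> j \<le> length (fst \<Lambda>) \<and> fst \<Lambda> ! (i - 1) \<ge> fst \<Lambda> ! (j - 1)}
     = {(i, j). i \<in> {1..N} \<and> j \<in> {1..N} \<and> (i < j \<and> j \<le> m \<and> entry j \<le> entry i)}"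
    using m_le by (auto simp: length_fst entry_fst)
  then show ?thesis unfolding coInv_def card_pairs[symmetric] by (rule arg_cong)
qed

lemma ties_sum_eq:
  "(\<Sum>p\<in>{m + 1..N}. ties p) = (\<Sum>j\<in>{1..N}. \<Sum>i\<in>{1..N}. of_bool (m < i \<and> i < j \<and> entry i = entry j))"
proof -
  have "(\<Sum>i\<in>{1..N}. \<Sum>j\<in>{1..N}. of_bool (m < i \<and> i < j \<and> entry i = entry j)) = (\<Sum>i\<in>{1..N}. if m < i then ties i else 0)"
  proof (rule sum.cong[OF refl])
    fix i assume i: "i \<in> {1..N}"
    have "{j\<in>{1..N}. i < j \<and> entry i = entry j} = {p'\<in>{i + 1..N}. entry p' = entry i}" by auto
    then show "(\<Sum>j\<in>{1..N}. of_bool (m < i \<and> i < j \<and> entry i = entry j)) = (if m < i then ties i else 0)"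
      by (simp add: ties_def Int_def)
  qed
  also have "\<dots> = (\<Sum>i\<in>{i\<in>{1..N}. m < i}. ties i)" by (rule sum.inter_filter[symmetric]) simp
  also have "{i\<in>{1..N}. m < i} = {m + 1..N}" by auto
  finally show ?thesis by (subst sum.swap) (rule sym)
qed

text \<open>The rank minus 1 counts the positions before p. They are split into those right of p,
  whose entries must be larger, and those left of p, where equality suffices.\<close>

lemma rank_sum_eq:
  "(\<Sum>p\<in>{1..N}. (rank N (eta \<Lambda> N) p - 1) * of_bool (p \<le> m))
    = (\<Sum>j\<in>{1..N}. \<Sum>i\<in>{1..N}. of_bool (i < j \<and> i \<le> m \<and> entry i < entry j) + of_bool (i < j \<and> j \<le> m \<and> entry j \<le> entry i))"
proof -
  let ?f = "\<lambda>p j. of_bool (p \<le> m \<and> before (eta \<Lambda> N) j p \<and> j \<noteq> p) :: nat"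
  have "(\<Sum>p\<in>{1..N}. (rank N (eta \<Lambda> N) p - 1) * of_bool (p \<le> m)) = (\<Sum>p\<in>{1..N}. \<Sum>j\<in>{1..N}. ?f p j)"
  proof (rule sum.cong[OF refl])
    fix p assume p: "p \<in> {1..N}"
    have "{j\<in>{1..N}. before (eta \<Lambda> N) j p} = insert p {j\<in>{1..N}. before (eta \<Lambda> N) j p \<and> j \<noteq> p}"
      using p by (auto simp: before_def)
    then have "rank N (eta \<Lambda> N) p = card {j\<in>{1..N}. before (eta \<Lambda> N) j p \<and> j \<noteq> p} + 1"
      unfolding rank_before[OF p] by simp
    then show "(rank N (eta \<Lambda> N) p - 1) * of_bool (p \<le> m) = (\<Sum>j\<in>{1..N}. ?f p j)"
      by (simp add: Int_def)
  qed
  also have "\<dots> = (\<Sum>p\<in>{1..N}. \<Sum>j\<in>{1..N}. of_bool (p < j) * ?f p j) + (\<Sum>p\<in>{1..N}. \<Sum>j\<in>{1..N}. of_bool (j < p) * ?f p j)"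
    unfolding sum.distrib[symmetric] by (intro sum.cong refl) auto
  also have "(\<Sum>p\<in>{1..N}. \<Sum>j\<in>{1..N}. of_bool (p < j) * ?f p j) = (\<Sum>j\<in>{1..N}. \<Sum>p\<in>{1..N}. of_bool (p < j) * ?f p j)"
    by (rule sum.swap)
  also have "(\<Sum>j\<in>{1..N}. \<Sum>p\<in>{1..N}. of_bool (p < j) * ?f p j) + (\<Sum>p\<in>{1..N}. \<Sum>j\<in>{1..N}. of_bool (j < p) * ?f p j)
      = (\<Sum>j\<in>{1..N}. \<Sum>i\<in>{1..N}. of_bool (i < j) * ?f i j + of_bool (i < j) * ?f j i)"
    unfolding sum.distrib ..
  also have "\<dots> = (\<Sum>j\<in>{1..N}. \<Sum>i\<in>{1..N}. of_bool (i < j \<and> i \<le> m \<and> entry i < entry j) + of_bool (i < j \<and> j \<le> m \<and> entry j \<le> entry i))"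
    by (intro sum.cong refl) (auto simp: before_def entry_def of_bool_def)
  finally show ?thesis .
qed

text \<open>Compared pair by pair for i < j. For i > m the entries increase weakly, so each such
  pair is either an ascent or a tie, and these pairs are counted by the triangular number; for i
  \<le> m the terms agree directly.\<close>

lemma exponent_identity:
  "t_exponent N (eta \<Lambda> N) + (\<Sum>p\<in>{m + 1..N}. ties p) + coInv (fst \<Lambda>) = mpart_n \<Lambda> + (N - m) * (N - m - 1) div 2"
proof -
  have pt: "of_bool (i < j \<and> entry i < entry j) + of_bool (m < i \<and> i < j \<and> entry i = entry j)
        + of_bool (i < j \<and> j \<le> m \<and> entry j \<le> entry i)
      = of_bool (i < j \<and> i \<le> m \<and> entry i < entry j) + of_bool (i < j \<and> j \<le> m \<and> entry j \<le> entry i)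
        + (of_bool (m < i \<and> i < j) :: nat)" if "j \<in> {1..N}" for i j
  proof (cases "m < i \<and> i < j")
    case True
    then have "entry i \<le> entry j" using that entry_mono[of i j] by simp
    then show ?thesis using True by (auto simp: of_bool_def)
  qed (auto simp: of_bool_def)
  have "ascents N (eta \<Lambda> N) + (\<Sum>p\<in>{m + 1..N}. ties p) + coInv (fst \<Lambda>)
      = (\<Sum>p\<in>{1..N}. (rank N (eta \<Lambda> N) p - 1) * of_bool (p \<le> m)) + (N - m) * (N - m - 1) div 2"
    unfolding ascents_def entry_def[symmetric] ties_sum_eq coInv_eq rank_sum_eq sum_triangular[OF m_le, symmetric]
      sum.distrib[symmetric]
    by (intro sum.cong refl) (rule pt)
  then show ?thesis unfolding t_exponent_def mpart_n_eq entry_def[symmetric] by linarith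
qed

theorem principal_spec_formula:
  "principal_spec (msym_macdonald \<Lambda> N) =
    tt powi (int (mpart_n \<Lambda>) - int (coInv (fst \<Lambda>))) * (qfact tt (N - m) / qfact tt N) *
    (\<Prod>s\<in>cells \<Lambda>. cell_factor s)"
proof -
  define Q where "Q = (\<Prod>p\<in>{m + 1..N}. (1 - tt ^ (ties p + 1)) / (1 - tt))"
  define E where "E = (\<Sum>p\<in>{m + 1..N}. ties p)"
  define C where "C = (N - m) * (N - m - 1) div 2"
  define te where "te = t_exponent N (eta \<Lambda> N)"
  define PP where "PP = pair_product N (eta \<Lambda> N)"
  have nz: "1 - tt ^ (k + 1) \<noteq> 0" for k using one_minus_nonzero[of 0 "k + 1"] by simp
  have Q0: "Q \<noteq> 0" unfolding Q_def using nz by (simp add: prod_zero_iff)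
  have qf0: "qfact tt N \<noteq> 0"
  proof -
    have "1 - tt ^ j \<noteq> 0" if "j \<in> {1..N}" for j
    proof -
      have "j - 1 + 1 = j" using that by simp
      then show ?thesis using nz[of "j - 1"] by (simp only: not_False_eq_True)
    qed
    then show ?thesis unfolding qfact_def by (simp add: prod_zero_iff)
  qed
  have u: "u_norm \<Lambda> N * tt ^ E = Q * tt ^ C" using u_norm_eq unfolding Q_def E_def C_def .
  then have u0: "u_norm \<Lambda> N \<noteq> 0" using Q0 by auto
  have cl: "(\<Prod>s\<in>cells \<Lambda>. cell_factor s) * Q = qfact tt N * PP" using prod_cells unfolding Q_def PP_def .
  have "te + E + coInv (fst \<Lambda>) = mpart_n \<Lambda> + C"
    using exponent_identity unfolding te_def E_def C_def .
  then have "int (mpart_n \<Lambda>) - int (coInv (fst \<Lambda>)) = int (te + E) - int C" by linarith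
  then have pw: "tt powi (int (mpart_n \<Lambda>) - int (coInv (fst \<Lambda>))) = tt ^ (te + E) / tt ^ C"
    by (simp only: power_int_diff[OF disjI1[OF tt_nonzero]] power_int_of_nat)
  have "principal_spec (msym_macdonald \<Lambda> N) = qfact tt (N - m) / u_norm \<Lambda> N * (tt ^ te * PP)"
    using principal_spec_msym_macdonald[OF _ composition_eta] le
    unfolding length_fst spec_value_def te_def PP_def by simp
  \<comment> \<open>The fraction is expanded by t^E because \<open>u_norm_eq\<close> evaluates the
    normalization together with this power.\<close>
  also have "\<dots> = qfact tt (N - m) * (tt ^ (te + E) * PP) / (u_norm \<Lambda> N * tt ^ E)"
    by (simp add: power_add)
  also have "\<dots> = qfact tt (N - m) * (tt ^ (te + E) * PP) / (Q * tt ^ C)" unfolding u ..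
  also have "\<dots> = tt ^ (te + E) / tt ^ C * qfact tt (N - m) * (PP / Q)" by (simp add: ac_simps)
  also have "PP / Q = (\<Prod>s\<in>cells \<Lambda>. cell_factor s) / qfact tt N"
    using cl Q0 qf0 by (simp add: frac_eq_eq ac_simps)
  finally show ?thesis unfolding pw by simp
qed

end

text \<open>Parts of \<lambda> are positive, so every row of the diagram has a cell in the first
  column, be it a circle. In row N + 1 its co-arm 0 and co-leg N make the numerator vanish.\<close>

lemma vanishing_cell:
  assumes mpart: "m_partition m \<Lambda>" and gt: "N < m + length (snd \<Lambda>)"
  shows "(N + 1, 1) \<in> cells \<Lambda>" "finite (cells \<Lambda>)"
proof -
  have len: "length (diagram_rows \<Lambda>) = m + length (snd \<Lambda>)"
    using mpart by (simp add: diagram_rows_def m_partition_def del: upt_Suc)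
  have set: "set (diagram_rows \<Lambda>) = set (map (\<lambda>i. (fst \<Lambda> ! (i - 1), Some i)) [1..<length (fst \<Lambda>) + 1]
      @ map (\<lambda>k. (k, None)) (snd \<Lambda>))"
    unfolding diagram_rows_def set_sort ..
  have "diagram_rows \<Lambda> ! N \<in> set (diagram_rows \<Lambda>)" using gt len by simp
  moreover have "0 \<notin> set (snd \<Lambda>)" using mpart by (simp add: m_partition_def is_partition_def)
  ultimately have "snd (diagram_rows \<Lambda> ! N) \<noteq> None \<or> 0 < fst (diagram_rows \<Lambda> ! N)"
    unfolding set by (auto simp del: upt_Suc)
  then have "row_circle \<Lambda> (N + 1) \<noteq> None \<or> 1 \<le> row_len \<Lambda> (N + 1)"
    by (auto simp: row_circle_def row_len_def)
  then show "(N + 1, 1) \<in> cells \<Lambda>"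
    using gt len by (cases "row_len \<Lambda> (N + 1)") (auto simp: cells_def squares_def circles_def)
  have "cells \<Lambda> \<subseteq> Sigma {1..length (diagram_rows \<Lambda>)} (\<lambda>i. {1..row_len \<Lambda> i + 1})"
    by (auto simp: cells_def squares_def circles_def)
  then show "finite (cells \<Lambda>)" by (rule finite_subset) auto
qed

theorem proposition7:
  fixes m N :: nat and \<Lambda> :: "nat list \<times> nat list"
  assumes "m \<le> N" and "m_partition m \<Lambda>"
  shows "principal_spec (msym_macdonald \<Lambda> N) =
    tt powi (int (mpart_n \<Lambda>) - int (coInv (fst \<Lambda>))) *
    (qfact tt (N - m) / qfact tt N) *
    (\<Prod>s\<in>cells \<Lambda>.
       (1 - qq ^ coarm s * tt powi (int N - int (coleg s))) /
       (1 - qq ^ arm \<Lambda> s * tt ^ (leg \<Lambda> s + 1)))"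
proof (cases "m + length (snd \<Lambda>) \<le> N")
  case True
  interpret padded_diagram \<Lambda> N m
    by unfold_locales (use assms True in auto)
  show ?thesis using principal_spec_formula unfolding cell_factor_def .
next
  case False
  then have gt: "N < m + length (snd \<Lambda>)" by simp
  have "length (fst \<Lambda>) = m" using assms(2) by (simp add: m_partition_def)
  then have "principal_spec (msym_macdonald \<Lambda> N) = 0"
    using False by (simp add: msym_macdonald_def Let_def)
  moreover have "(\<Prod>s\<in>cells \<Lambda>. (1 - qq ^ coarm s * tt powi (int N - int (coleg s))) /
       (1 - qq ^ arm \<Lambda> s * tt ^ (leg \<Lambda> s + 1))) = 0"
    by (rule prod_zero[OF vanishing_cell(2)[OF assms(2) gt]])
      (use vanishing_cell(1)[OF assms(2) gt] in \<open>auto simp: coarm_def coleg_def intro!: bexI[of _ "(N + 1, 1)"]\<close>)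
  ultimately show ?thesis by simp
qed

end
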